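(* For any $\varepsilon>0$, $t_0>0$, integer $K\ge M$, integer $J\ge 0$, and all $x\in\mathbb R_\varepsilon^d$ and $t\ge t_0\varepsilon^\ell$, the first discrete Green function $\mathbf u^\varepsilon$ satisfies $$\frac{\partial^J\mathbf u^\varepsilon(x,t)}{\partial t^J}=\sum_{k=0}^K\frac{\varepsilon^k}{t^{(k+d)/\ell+J}}\,H_{Jk}\!\left(\frac{x}{t^{1/\ell}}\right)+\mathbf r_{\mathbf u}^\varepsilon(J,K;x,t),$$ where $H_{J0}=(-\mathcal A(\mathcal D))^JH$, $H_{Jk}=0$ for $k=1,\dots,M-1$, the functions $H_{Jk}$ with $k=M,\dots,K$ are finite linear combinations of derivatives of $H$, and $$|\mathbf r_{\mathbf u}^\varepsilon(J,K;x,t)|\le\frac{\varepsilon^{K+1}R_{\mathbf u}(J,K,t_0)}{t^{(K+d+1)/\ell+J}},$$ with a constant $R_{\mathbf u}(J,K,t_0)\ge 0$ that does not depend on $\varepsilon>0$, $x\in\mathbb R_\varepsilon^d$, and $t\ge t_0\varepsilon^\ell$.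
   Context: Differential operator. Let $d\in\mathbb N$ and let $\ell\in\mathbb N$ be even. Let $\mathcal A(\mathcal D)=\sum_{|\alpha|=\ell}b_\alpha\mathcal D^\alpha$ with $b_\alpha\in\mathbb C$, $\mathcal D_j=-i\,\partial/\partial y_j$, be a differential operator on $\mathbb R^d$ with symbol $\mathcal A(\xi)=\sum_{|\alpha|=\ell}b_\alpha\xi^\alpha$. It is strongly elliptic: there is $c>0$ with $\operatorname{Re}\mathcal A(\xi)\ge c|\xi|^\ell$ for all $\xi\in\mathbb R^d$. Difference operator. For $\varepsilon>0$ let $\mathbb R^d_\varepsilon=\varepsilon\mathbb Z^d$. For a function $u$ on $\mathbb R^d$ or on $\mathbb R^d_\varepsilon$ let $\delta_{\varepsilon,k\pm}u(y)=u(y\pm\varepsilon e_k)-u(y)$, where $e_k$ is the $k$th unit coordinate vector. Fix an integer $\hat\ell\ge\ell$ and coefficients $a_\nu\in\mathbb C$ (not depending on $\varepsilon$), $\nu=(\nu_1,\dots,\nu_{2d})$ a multi-index, and let $$\mathbf A_\varepsilon=\varepsilon^{-\ell}\sum_{\ell\le|\nu|\le\hat\ell}a_\nu\,\delta_{\varepsilon,1-}^{\nu_1}\delta_{\varepsilon,1+}^{\nu_2}\cdots\delta_{\varepsilon,d-}^{\nu_{2d-1}}\delta_{\varepsilon,d+}^{\nu_{2d}}.$$ A function on $\mathbb R^d$ is called smooth if it is continuous and bounded together with all its derivatives. Assume that $\mathbf A_\varepsilon$ is an $M$th order approximation of $\mathcal A(\mathcal D)$ for a fixed $M\in\mathbb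 N$: for every smooth $u$ there is $C(u)>0$ such that $\sup_{y\in\mathbb R^d}|\mathbf A_\varepsilon u(y)-\mathcal A(\mathcal D)u(y)|\le C(u)\varepsilon^M$ for all $\varepsilon>0$. The symbol of $\mathbf A_\varepsilon$ is $$A(\theta)=\sum_{\ell\le|\nu|\le\hat\ell}a_\nu(e^{-i\theta_1}-1)^{\nu_1}(e^{i\theta_1}-1)^{\nu_2}\cdots(e^{-i\theta_d}-1)^{\nu_{2d-1}}(e^{i\theta_d}-1)^{\nu_{2d}}.$$ Assume $\operatorname{Re}A(\theta)>0$ for all $\theta\in R_\pi\setminus\{0\}$, where $R_\lambda=[-\lambda,\lambda]^d$. First discrete Green function. $\mathbf u^\varepsilon(x,t)$, $x\in\mathbb R^d_\varepsilon$, $t\ge0$, is the function that is rapidly decreasing in $x$ (faster than any negative power of $|x|$), $C^1$ in $t\in[0,\infty)$, and satisfies $\partial_t\mathbf u^\varepsilon+\mathbf A_\varepsilon\mathbf u^\varepsilon=0$ for $t>0$, with $\mathbf u^\varepsilon(0,0)=\varepsilon^{-d}$ and $\mathbf u^\varepsilon(x,0)=0$ for $x\ne0$. It is given by $$\mathbf u^\varepsilon(x,t)=\frac1{(2\pi)^d}\int_{R_{\pi/\varepsilon}}e^{-t\varepsilon^{-\ell}A(\varepsilon\eta)}e^{ix\eta}\,d\eta.$$ The functions $H$, $H_{Jk}$. $H(y)=\frac{1}{(2\pi)^d}\int_{\mathbb R^d}e^{-\mathcal A(\xi)}e^{iy\xi}\,d\xi$. For integers $J,k\ge0$, the polynomials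 $\mathcal R_J^{[k]}(\xi)$ are the coefficients in the expansion, for each fixed $\xi\in\mathbb R^d$ as $s\to0+$ (any $K$), $$\bigl(-s^{-\ell}A(s\xi)\bigr)^J e^{-s^{-\ell}A(s\xi)}=e^{-\mathcal A(\xi)}\Bigl(\sum_{k=0}^K s^k\mathcal R_J^{[k]}(\xi)+O(s^{K+1})\Bigr),$$ and $H_{Jk}(y)=\mathcal R_J^{[k]}(\mathcal D)H(y)$. *)

theory Defs
  imports
    "HOL-Analysis.Analysis"
    "HOL-Library.Landau_Symbols"
    "HOL-Library.Poly_Mapping"
begin

definition mi_abs :: "('i::finite \<Rightarrow> nat) \<Rightarrow> nat" where
  "mi_abs \<nu> = (\<Sum>i\<in>UNIV. \<nu> i)"

(* T^\<nu> for a family T of operators. The factors are composed along some fixed enumeration of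
   the index type; below T always consists of operators that commute on the functions of
   interest, so the enumeration does not matter. *)
definition mi_op :: "('i::finite \<Rightarrow> 'f \<Rightarrow> 'f) \<Rightarrow> ('i \<Rightarrow> nat) \<Rightarrow> 'f \<Rightarrow> 'f" where
  "mi_op T \<nu> = foldr (\<lambda>i. T i ^^ \<nu> i) (SOME is. distinct is \<and> set is = UNIV)"

definition mi_monom :: "real ^ 'n \<Rightarrow> ('n \<Rightarrow> nat) \<Rightarrow> complex" where
  "mi_monom \<xi> \<alpha> = (\<Prod>j\<in>UNIV. complex_of_real (\<xi> $ j) ^ \<alpha> j)"

definition pderivative :: "'n \<Rightarrow> (real ^ 'n \<Rightarrow> complex) \<Rightarrow> real ^ 'n \<Rightarrow> complex" where
  "pderivative j u y = vector_derivative (\<lambda>s. u (y + s *\<^sub>R axis j 1)) (at 0)"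

definition Dop :: "'n \<Rightarrow> (real ^ 'n \<Rightarrow> complex) \<Rightarrow> real ^ 'n \<Rightarrow> complex" where
  "Dop j u y = - \<i> * pderivative j u y"

(* Continuous and bounded together with all derivatives; the list js runs through all iterated
   partial derivatives, in every order. *)
definition smooth_bounded :: "(real ^ 'n \<Rightarrow> complex) \<Rightarrow> bool" where
  "smooth_bounded u \<longleftrightarrow>
     (\<forall>js. let v = foldr pderivative js u in
        continuous_on UNIV v \<and> bounded (range v) \<and>
        (\<forall>j y. (\<lambda>s. v (y + s *\<^sub>R axis j 1)) differentiable (at 0)))"

definition diff_symbol :: "nat \<Rightarrow> (('n::finite \<Rightarrow> nat) \<Rightarrow> complex) \<Rightarrow> real ^ 'n \<Rightarrow> complex" where
  "diff_symbol l b \<xi> = (\<Sum>\<alpha> | mi_abs \<alpha> = l. b \<alpha> * mi_monom \<xi> \<alpha>)"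

definition diff_op ::
  "nat \<Rightarrow> (('n::finite \<Rightarrow> nat) \<Rightarrow> complex) \<Rightarrow> (real ^ 'n \<Rightarrow> complex) \<Rightarrow> real ^ 'n \<Rightarrow> complex" where
  "diff_op l b u y = (\<Sum>\<alpha> | mi_abs \<alpha> = l. b \<alpha> * mi_op Dop \<alpha> u y)"

definition strongly_elliptic :: "nat \<Rightarrow> (('n::finite \<Rightarrow> nat) \<Rightarrow> complex) \<Rightarrow> bool" where
  "strongly_elliptic l b \<longleftrightarrow> (\<exists>c>0. \<forall>\<xi>. Re (diff_symbol l b \<xi>) \<ge> c * norm \<xi> ^ l)"

definition lattice :: "real \<Rightarrow> (real ^ 'n) set" where
  "lattice \<epsilon> = {x. \<forall>i. \<exists>m::int. x $ i = \<epsilon> * of_int m}"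

(* The 2d one-sided difference operators: Inl k stands for k-, Inr k for k+.  A function on the
   lattice is represented by a function on the whole space whose values off the lattice are
   irrelevant; the differences at lattice points only use values at lattice points. *)
fun delta :: "real \<Rightarrow> 'n + 'n \<Rightarrow> (real ^ 'n \<Rightarrow> complex) \<Rightarrow> real ^ 'n \<Rightarrow> complex" where
  "delta \<epsilon> (Inl k) u y = u (y - \<epsilon> *\<^sub>R axis k 1) - u y"
| "delta \<epsilon> (Inr k) u y = u (y + \<epsilon> *\<^sub>R axis k 1) - u y"

(* L is the maximal order of the differences. *)
definition discr_op ::
  "nat \<Rightarrow> nat \<Rightarrow> (('n::finite + 'n \<Rightarrow> nat) \<Rightarrow> complex) \<Rightarrow> real
     \<Rightarrow> (real ^ 'n \<Rightarrow> complex) \<Rightarrow> real ^ 'n \<Rightarrow> complex" where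
  "discr_op l L a \<epsilon> u y =
     (\<Sum>\<nu> | l \<le> mi_abs \<nu> \<and> mi_abs \<nu> \<le> L. a \<nu> * mi_op (delta \<epsilon>) \<nu> u y) / complex_of_real (\<epsilon> ^ l)"

definition discr_symbol ::
  "nat \<Rightarrow> nat \<Rightarrow> (('n::finite + 'n \<Rightarrow> nat) \<Rightarrow> complex) \<Rightarrow> real ^ 'n \<Rightarrow> complex" where
  "discr_symbol l L a \<theta> =
     (\<Sum>\<nu> | l \<le> mi_abs \<nu> \<and> mi_abs \<nu> \<le> L.
        a \<nu> * (\<Prod>k\<in>UNIV. (cis (- (\<theta> $ k)) - 1) ^ \<nu> (Inl k) * (cis (\<theta> $ k) - 1) ^ \<nu> (Inr k)))"

definition approximates ::
  "nat \<Rightarrow> nat \<Rightarrow> nat \<Rightarrow> (('n::finite + 'n \<Rightarrow> nat) \<Rightarrow> complex) \<Rightarrow> (('n::finite \<Rightarrow> nat) \<Rightarrow> complex) \<Rightarrow> bool" where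
  "approximates M l L a b \<longleftrightarrow>
     (\<forall>u. smooth_bounded u \<longrightarrow>
        (\<exists>C>0. \<forall>\<epsilon>>0. \<forall>y. cmod (discr_op l L a \<epsilon> u y - diff_op l b u y) \<le> C * \<epsilon> ^ M))"

definition first_Green ::
  "nat \<Rightarrow> nat \<Rightarrow> (('n::finite + 'n \<Rightarrow> nat) \<Rightarrow> complex) \<Rightarrow> real
     \<Rightarrow> (real ^ 'n \<Rightarrow> real \<Rightarrow> complex) \<Rightarrow> bool" where
  "first_Green l L a \<epsilon> u \<longleftrightarrow>
     (\<forall>t\<ge>0. \<forall>N::nat. \<exists>C. \<forall>x\<in>lattice \<epsilon>. norm x ^ N * cmod (u x t) \<le> C) \<and>
     (\<forall>x\<in>lattice \<epsilon>. \<exists>v. continuous_on {0..} v \<and>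
        (\<forall>t\<ge>0. (u x has_vector_derivative v t) (at t within {0..}))) \<and>
     (\<forall>x\<in>lattice \<epsilon>. \<forall>t>0.
        vector_derivative (u x) (at t) + discr_op l L a \<epsilon> (\<lambda>z. u z t) x = 0) \<and>
     u 0 0 = complex_of_real (1 / \<epsilon> ^ CARD('n)) \<and>
     (\<forall>x\<in>lattice \<epsilon>. x \<noteq> 0 \<longrightarrow> u x 0 = 0)"

definition tderivative :: "(real \<Rightarrow> complex) \<Rightarrow> real \<Rightarrow> complex" where
  "tderivative f t = vector_derivative f (at t)"

definition Hfun :: "nat \<Rightarrow> (('n::finite \<Rightarrow> nat) \<Rightarrow> complex) \<Rightarrow> real ^ 'n \<Rightarrow> complex" where
  "Hfun l b y =
     (LINT \<xi>|lborel. exp (- diff_symbol l b \<xi>) * cis (y \<bullet> \<xi>)) / complex_of_real ((2 * pi) ^ CARD('n))"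

(* Polynomials in d variables with complex coefficients, as finitely supported coefficient
   families indexed by multi-indices. *)
type_synonym 'n mpol = "('n \<Rightarrow> nat) \<Rightarrow>\<^sub>0 complex"

definition mpol_eval :: "'n mpol \<Rightarrow> real ^ 'n \<Rightarrow> complex" where
  "mpol_eval p \<xi> = (\<Sum>\<alpha>\<in>Poly_Mapping.keys p. Poly_Mapping.lookup p \<alpha> * mi_monom \<xi> \<alpha>)"

definition mpol_D :: "'n mpol \<Rightarrow> (real ^ 'n \<Rightarrow> complex) \<Rightarrow> real ^ 'n \<Rightarrow> complex" where
  "mpol_D p u y = (\<Sum>\<alpha>\<in>Poly_Mapping.keys p. Poly_Mapping.lookup p \<alpha> * mi_op Dop \<alpha> u y)"

(* R k, for k = 0, 1, 2, ..., are the coefficients of s^k, up to the factor exp (-A(\<xi>)), in the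
   asymptotic expansion for s tending to 0 from the right, for each fixed \<xi>. *)
definition expansion_coeffs ::
  "nat \<Rightarrow> nat \<Rightarrow> (('n::finite + 'n \<Rightarrow> nat) \<Rightarrow> complex) \<Rightarrow> (('n::finite \<Rightarrow> nat) \<Rightarrow> complex) \<Rightarrow> nat
     \<Rightarrow> (nat \<Rightarrow> 'n mpol) \<Rightarrow> bool" where
  "expansion_coeffs l L a b J R \<longleftrightarrow>
     (\<forall>\<xi> K.
        (\<lambda>s. (- discr_symbol l L a (s *\<^sub>R \<xi>) / complex_of_real (s ^ l)) ^ J
               * exp (- discr_symbol l L a (s *\<^sub>R \<xi>) / complex_of_real (s ^ l))
             - exp (- diff_symbol l b \<xi>)
               * (\<Sum>k\<le>K. complex_of_real (s ^ k) * mpol_eval (R k) \<xi>))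
        \<in> O[at_right 0](\<lambda>s. complex_of_real (s ^ (K + 1))))"

definition Rpol ::
  "nat \<Rightarrow> nat \<Rightarrow> (('n::finite + 'n \<Rightarrow> nat) \<Rightarrow> complex) \<Rightarrow> (('n::finite \<Rightarrow> nat) \<Rightarrow> complex) \<Rightarrow> nat
     \<Rightarrow> nat \<Rightarrow> 'n mpol" where
  "Rpol l L a b J = (THE R. expansion_coeffs l L a b J R)"

definition HJk ::
  "nat \<Rightarrow> nat \<Rightarrow> (('n::finite + 'n \<Rightarrow> nat) \<Rightarrow> complex) \<Rightarrow> (('n::finite \<Rightarrow> nat) \<Rightarrow> complex) \<Rightarrow> nat \<Rightarrow> nat
     \<Rightarrow> real ^ 'n \<Rightarrow> complex" where
  "HJk l L a b J k = mpol_D (Rpol l L a b J k) (Hfun l b)"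

end

(* Discrete Fourier inversion writes the Green function as an integral over the cube R_pi. With
   s = eps / t^(1/l) and f(s, xi) = s^(-l) A(s xi), rescaling theta = s xi turns its J-th time
   derivative into t^(-d/l - J) times the integral of (-f)^J exp(-f) over the cube R_(pi/s).
   Since exp(i z) - 1 vanishes at z = 0 and only differences of order at least l occur, f extends
   smoothly to s = 0, with polynomial growth in xi of all its s-derivatives. Testing the
   approximation property on plane waves shows that f(0, xi) is the elliptic symbol and that
   f - f(0, .) = O(s^M). By compactness Re f(s, xi) >= c |xi|^l whenever s xi lies in R_pi, so
   Taylor's formula in s inside the cube, and |s xi| >= 1 outside, give a remainder s^(K+1) times
   an integrable function of xi.

   The hypotheses on the Green function bound it in x only for each single t, without uniformity
   in t, so its integral representation needs an argument with Baire's theorem. *)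

theory Submission
  imports Defs "HOL-Probability.Sinc_Integral"
begin

section \<open>Polynomial functions and multi-index powers of operators\<close>

text \<open>The dependence on s goes through the function algebra \<open>symclass\<close> rather
  than through derivatives of the quotient s^(-l) A(s xi). Its only transcendental generators are
  moments, integrals over [0,1] of tau^m exp(i tau z). They are bounded by 1 and their derivatives
  are again moments, so every s-derivative inherits polynomial growth in xi, uniformly for bounded
  s. The condition t >= t0 eps^l is what keeps s bounded.

  \<open>Rpol\<close> is a definite description. Before anything can be said about
  \<open>HJk\<close>, the Taylor coefficients must be known to be polynomials and the expansion must
  be known to be unique.

  For uniqueness of the Green function, a Gronwall estimate of the supremum over the lattice needs
  that supremum to be locally bounded in time. A bound for each single time leaves open that it is
  unbounded near some times; excluding this is the purpose of the Baire argument.\<close>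

lemma mi_monom_mult: "mi_monom \<xi> \<alpha> * mi_monom \<xi> \<beta> = mi_monom \<xi> (\<lambda>j. \<alpha> j + \<beta> j)"
  by (simp add: mi_monom_def power_add prod.distrib)

lemma mpol_eval_superset:
  assumes "finite S" "Poly_Mapping.keys p \<subseteq> S"
  shows "mpol_eval p \<xi> = (\<Sum>\<alpha>\<in>S. Poly_Mapping.lookup p \<alpha> * mi_monom \<xi> \<alpha>)"
  unfolding mpol_eval_def using assms
  by (intro sum.mono_neutral_left) (auto simp: in_keys_iff)

lemma mpol_eval_single: "mpol_eval (Poly_Mapping.single \<alpha> c) \<xi> = c * mi_monom \<xi> \<alpha>"
  by (subst mpol_eval_superset[of "{\<alpha>}"]) auto

lemma mpol_eval_add: "mpol_eval (p + q) \<xi> = mpol_eval p \<xi> + mpol_eval q \<xi>"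
proof -
  let ?S = "Poly_Mapping.keys p \<union> Poly_Mapping.keys q"
  have "Poly_Mapping.keys (p + q) \<subseteq> ?S" by (rule keys_add)
  then show ?thesis
    by (subst (1 2 3) mpol_eval_superset[of ?S])
       (auto simp: lookup_add sum.distrib[symmetric] algebra_simps)
qed

lemma mpol_eval_diff: "mpol_eval (p - q) \<xi> = mpol_eval p \<xi> - mpol_eval q \<xi>"
  using mpol_eval_add[of "p - q" q \<xi>] by simp

text \<open>Taylor coefficients first appear as functions of \<xi>, and closure under sums and
  products is simplest to state for functions. The coefficient family that \<open>Rpol\<close> asks
  for is extracted afterwards.\<close>

definition polyfn :: "(real ^ 'n::finite \<Rightarrow> complex) \<Rightarrow> bool" where
  "polyfn f \<longleftrightarrow> (\<exists>p. f = mpol_eval p)"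

lemma polyfn_monom: "polyfn (\<lambda>\<xi>. c * mi_monom \<xi> \<alpha>)"
  unfolding polyfn_def by (rule exI[of _ "Poly_Mapping.single \<alpha> c"]) (auto simp: mpol_eval_single)

lemma polyfn_const: "polyfn (\<lambda>\<xi>. c)"
  using polyfn_monom[of c "\<lambda>_. 0"] by (simp add: mi_monom_def)

lemma polyfn_coord: "polyfn (\<lambda>\<xi>. complex_of_real (\<xi> $ (k::'n::finite)))"
proof -
  have "(\<Prod>j\<in>UNIV. complex_of_real (\<xi> $ j) ^ (if j = k then 1 else 0)) = complex_of_real (\<xi> $ k)" for \<xi> :: "real^'n"
    by (subst prod.remove[of _ k]) auto
  then show ?thesis
    using polyfn_monom[of 1 "\<lambda>j. if j = k then 1 else 0"] by (simp add: mi_monom_def)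
qed

lemma polyfn_add: "polyfn f \<Longrightarrow> polyfn g \<Longrightarrow> polyfn (\<lambda>\<xi>. f \<xi> + g \<xi>)"
  unfolding polyfn_def by (auto simp: mpol_eval_add fun_eq_iff intro: exI[of _ "_ + _"])

lemma polyfn_sum: "(\<And>i. i \<in> S \<Longrightarrow> polyfn (f i)) \<Longrightarrow> polyfn (\<lambda>\<xi>. \<Sum>i\<in>S. f i \<xi>)"
  by (induction S rule: infinite_finite_induct) (auto simp: polyfn_const polyfn_add)

lemma polyfn_mult:
  assumes "polyfn f" "polyfn g"
  shows "polyfn (\<lambda>\<xi>. f \<xi> * g \<xi>)"
proof -
  from assms obtain p q where "f = mpol_eval p" "g = mpol_eval q" by (auto simp: polyfn_def)
  then have "(\<lambda>\<xi>. f \<xi> * g \<xi>) = (\<lambda>\<xi>. \<Sum>\<alpha>\<in>Poly_Mapping.keys p. \<Sum>\<beta>\<in>Poly_Mapping.keys q.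
      (Poly_Mapping.lookup p \<alpha> * Poly_Mapping.lookup q \<beta>) * mi_monom \<xi> (\<lambda>j. \<alpha> j + \<beta> j))"
    by (simp add: mpol_eval_def sum_product mi_monom_mult[symmetric] mult_ac)
  then show ?thesis by (simp add: polyfn_sum polyfn_monom)
qed

text \<open>Distinct monomials are distinct multiplicative characters of the componentwise product
  on \<open>\<real>\<^sup>n\<close>, so Dedekind's argument for the independence of characters applies.\<close>

lemma mi_monom_independent:
  fixes c :: "('n::finite \<Rightarrow> nat) \<Rightarrow> complex"
  assumes "finite S" "\<And>\<xi>. (\<Sum>\<alpha>\<in>S. c \<alpha> * mi_monom \<xi> \<alpha>) = 0" "\<alpha> \<in> S"
  shows "c \<alpha> = 0"
  using assms
proof (induction S arbitrary: c \<alpha> rule: finite_psubset_induct)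
  case (psubset S)
  have others: "c \<beta> = 0" if \<beta>: "\<beta> \<in> S" "\<beta> \<noteq> \<alpha>" for \<beta>
  proof -
    obtain j where j: "\<alpha> j \<noteq> \<beta> j" using \<beta>(2) by (metis ext)
    \<comment> \<open>A point that separates the characters \<alpha> and \<beta>. Replacing \<xi> by
      its componentwise product with \<eta> multiplies each monomial by its value at \<eta>;
      subtracting \<open>mi_monom \<eta> \<alpha>\<close> times the original relation then removes
      the \<alpha> term.\<close>
    define \<eta> :: "real ^ 'n" where "\<eta> = (\<chi> i. if i = j then 2 else 1)"
    have mon: "mi_monom \<eta> \<gamma> = 2 ^ \<gamma> j" for \<gamma>
      unfolding mi_monom_def by (subst prod.remove[of _ j]) (auto simp: \<eta>_def)
    have "(2::complex) ^ \<beta> j \<noteq> 2 ^ \<alpha> j"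
    proof
      assume "(2::complex) ^ \<beta> j = 2 ^ \<alpha> j"
      then have "cmod (2 ^ \<beta> j) = cmod (2 ^ \<alpha> j)" by simp
      then have "(2::real) ^ \<beta> j = 2 ^ \<alpha> j" by (simp only: norm_power norm_numeral)
      then show False using j by simp
    qed
    then have ne: "mi_monom \<eta> \<beta> - mi_monom \<eta> \<alpha> \<noteq> 0" by (simp add: mon)
    have zero: "(\<Sum>\<gamma>\<in>S - {\<alpha>}. (c \<gamma> * (mi_monom \<eta> \<gamma> - mi_monom \<eta> \<alpha>)) * mi_monom \<xi> \<gamma>) = 0" for \<xi>
    proof -
      have mm: "mi_monom (\<chi> i. \<eta> $ i * \<xi> $ i) \<gamma> = mi_monom \<eta> \<gamma> * mi_monom \<xi> \<gamma>" for \<gamma>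
        by (simp add: mi_monom_def power_mult_distrib prod.distrib)
      have "(\<Sum>\<gamma>\<in>S. (c \<gamma> * (mi_monom \<eta> \<gamma> - mi_monom \<eta> \<alpha>)) * mi_monom \<xi> \<gamma>)
          = (\<Sum>\<gamma>\<in>S. c \<gamma> * mi_monom (\<chi> i. \<eta> $ i * \<xi> $ i) \<gamma>) - mi_monom \<eta> \<alpha> * (\<Sum>\<gamma>\<in>S. c \<gamma> * mi_monom \<xi> \<gamma>)"
        by (simp add: mm sum_distrib_left sum_subtractf[symmetric] algebra_simps)
      also have "\<dots> = 0" by (simp add: psubset.prems(1))
      finally show ?thesis
        using psubset.hyps psubset.prems(2) by (simp add: sum.remove[of S \<alpha>])
    qed
    have "S - {\<alpha>} \<subset> S" "\<beta> \<in> S - {\<alpha>}" using \<beta> psubset.prems by auto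
    then have "c \<beta> * (mi_monom \<eta> \<beta> - mi_monom \<eta> \<alpha>) = 0"
      by (intro psubset.IH[where c = "\<lambda>\<gamma>. c \<gamma> * (mi_monom \<eta> \<gamma> - mi_monom \<eta> \<alpha>)" and B = "S - {\<alpha>}"] zero)
    then show ?thesis using ne by simp
  qed
  have "(\<Sum>\<gamma>\<in>S. c \<gamma> * mi_monom (\<chi> i. 1) \<gamma>) = c \<alpha>"
    using psubset others by (subst sum.remove[of S \<alpha>]) (auto simp: mi_monom_def)
  then show ?case using psubset.prems(1) by simp
qed

text \<open>An asymptotic expansion determines its coefficients only as values at each \<xi>. This
  lifts uniqueness to the polynomials themselves, as the definite description in \<open>Rpol\<close>
  requires.\<close>

lemma mpol_eval_inject:
  fixes p q :: "'n::finite mpol"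
  assumes "\<And>\<xi>. mpol_eval p \<xi> = mpol_eval q \<xi>"
  shows "p = q"
proof (rule ccontr)
  assume "p \<noteq> q"
  then have "Poly_Mapping.keys (p - q) \<noteq> {}" by simp
  then obtain \<alpha> where "\<alpha> \<in> Poly_Mapping.keys (p - q)" by blast
  have zero: "mpol_eval (p - q) \<xi> = 0" for \<xi> by (simp add: assms mpol_eval_diff)
  have "Poly_Mapping.lookup (p - q) \<alpha> = 0"
    by (rule mi_monom_independent[OF finite_keys zero[unfolded mpol_eval_def] \<open>\<alpha> \<in> _\<close>])
  with \<open>\<alpha> \<in> _\<close> show False by (simp add: in_keys_iff)
qed

section \<open>Multi-index powers of operator families\<close>

lemma mi_op_foldr:
  obtains xs :: "'i::finite list" where "distinct xs" "set xs = UNIV"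
    "\<And>(T :: 'i \<Rightarrow> 'f \<Rightarrow> 'f) \<nu>. mi_op T \<nu> = foldr (\<lambda>i. T i ^^ \<nu> i) xs"
proof -
  define xs :: "'i list" where "xs = (SOME is. distinct is \<and> set is = UNIV)"
  have "\<exists>is :: 'i list. distinct is \<and> set is = UNIV"
    using finite_distinct_list[of "UNIV :: 'i set"] by auto
  then have "distinct xs \<and> set xs = UNIV" unfolding xs_def by (rule someI_ex)
  then show thesis by (intro that[of xs]) (auto simp: mi_op_def xs_def)
qed

text \<open>The index n of \<open>P\<close> counts the operators applied so far, as in a sup bound
  that doubles with every difference.\<close>

lemma mi_op_invariant:
  fixes T :: "'i::finite \<Rightarrow> 'f \<Rightarrow> 'f"
  assumes "\<And>i n f. P n f \<Longrightarrow> P (Suc n) (T i f)" and "P m f"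
  shows "P (m + mi_abs \<nu>) (mi_op T \<nu> f)"
proof -
  obtain xs :: "'i list" where xs: "distinct xs" "set xs = UNIV"
    and op: "\<And>(T :: 'i \<Rightarrow> 'f \<Rightarrow> 'f) \<nu>. mi_op T \<nu> = foldr (\<lambda>i. T i ^^ \<nu> i) xs"
    by (rule mi_op_foldr) blast
  have 1: "P (n + k) ((T i ^^ k) g)" if "P n g" for n k i g
    using that by (induction k) (auto intro: assms(1))
  have "P (m + (\<Sum>i\<leftarrow>ys. \<nu> i)) (foldr (\<lambda>i. T i ^^ \<nu> i) ys f)" for ys
  proof (induction ys)
    case Nil then show ?case using assms(2) by simp
  next
    case (Cons i ys)
    from 1[OF Cons, of "\<nu> i" i] show ?case by (simp add: ac_simps)
  qed
  from this[of xs] show ?thesis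
    using xs by (simp add: op mi_abs_def sum_list_distinct_conv_sum_set)
qed

text \<open>\<open>\<Phi>\<close> turns a multiplier g into a function (Fourier integral, lattice
  wave, plane wave) on which \<open>T i\<close> acts as multiplication of g by
  \<open>\<mu> i\<close>. Multiplications commute, so any enumeration gives the same unordered
  product. \<open>P\<close> is the class of multipliers on which the operators may act.\<close>

lemma mi_op_multiplier:
  fixes T :: "'i::finite \<Rightarrow> 'f \<Rightarrow> 'f" and \<mu> :: "'i \<Rightarrow> 'a \<Rightarrow> complex"
  assumes step: "\<And>i g. P g \<Longrightarrow> P (\<lambda>\<xi>. \<mu> i \<xi> * g \<xi>)"
    "\<And>i g. P g \<Longrightarrow> T i (\<Phi> g) = \<Phi> (\<lambda>\<xi>. \<mu> i \<xi> * g \<xi>)"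
    and "P g"
  shows "P (\<lambda>\<xi>. (\<Prod>i\<in>UNIV. \<mu> i \<xi> ^ \<nu> i) * g \<xi>)"
    and "mi_op T \<nu> (\<Phi> g) = \<Phi> (\<lambda>\<xi>. (\<Prod>i\<in>UNIV. \<mu> i \<xi> ^ \<nu> i) * g \<xi>)"
proof -
  obtain xs :: "'i list" where xs: "distinct xs" "set xs = UNIV"
    and op: "\<And>(T :: 'i \<Rightarrow> 'f \<Rightarrow> 'f) \<nu>. mi_op T \<nu> = foldr (\<lambda>i. T i ^^ \<nu> i) xs"
    by (rule mi_op_foldr) blast
  have pow: "P (\<lambda>\<xi>. \<mu> i \<xi> ^ k * h \<xi>) \<and> (T i ^^ k) (\<Phi> h) = \<Phi> (\<lambda>\<xi>. \<mu> i \<xi> ^ k * h \<xi>)"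
    if "P h" for i k h
  proof (induction k)
    case 0 then show ?case using that by simp
  next
    case (Suc k)
    then show ?case
      using step(1)[of "\<lambda>\<xi>. \<mu> i \<xi> ^ k * h \<xi>" i] step(2)[of "\<lambda>\<xi>. \<mu> i \<xi> ^ k * h \<xi>" i]
      by (simp add: mult.assoc)
  qed
  have "P (\<lambda>\<xi>. (\<Prod>i\<leftarrow>ys. \<mu> i \<xi> ^ \<nu> i) * g \<xi>) \<and>
      foldr (\<lambda>i. T i ^^ \<nu> i) ys (\<Phi> g) = \<Phi> (\<lambda>\<xi>. (\<Prod>i\<leftarrow>ys. \<mu> i \<xi> ^ \<nu> i) * g \<xi>)" for ys
  proof (induction ys)
    case Nil then show ?case using \<open>P g\<close> by simp
  next
    case (Cons i ys)
    then show ?case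
      using pow[of "\<lambda>\<xi>. (\<Prod>i\<leftarrow>ys. \<mu> i \<xi> ^ \<nu> i) * g \<xi>" i "\<nu> i"] by (simp add: mult.assoc)
  qed
  from this[of xs] have "P (\<lambda>\<xi>. (\<Prod>i\<leftarrow>xs. \<mu> i \<xi> ^ \<nu> i) * g \<xi>) \<and>
      mi_op T \<nu> (\<Phi> g) = \<Phi> (\<lambda>\<xi>. (\<Prod>i\<leftarrow>xs. \<mu> i \<xi> ^ \<nu> i) * g \<xi>)" by (simp only: op)
  moreover have "(\<Prod>i\<leftarrow>xs. \<mu> i \<xi> ^ \<nu> i) = (\<Prod>i\<in>UNIV. \<mu> i \<xi> ^ \<nu> i)" for \<xi>
    using xs by (simp add: prod.distinct_set_conv_list[symmetric])
  ultimately show "P (\<lambda>\<xi>. (\<Prod>i\<in>UNIV. \<mu> i \<xi> ^ \<nu> i) * g \<xi>)"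
    "mi_op T \<nu> (\<Phi> g) = \<Phi> (\<lambda>\<xi>. (\<Prod>i\<in>UNIV. \<mu> i \<xi> ^ \<nu> i) * g \<xi>)" by simp_all
qed

section \<open>Taylor expansion in the scaling parameter\<close>

text \<open>\<open>cis_moment 0 z\<close> is (exp(i z) - 1) / (i z) with the singularity at 0
  removed. Written as an integral, its m-th derivative is i^m times the m-th moment.\<close>

definition cis_moment :: "nat \<Rightarrow> real \<Rightarrow> complex" where
  "cis_moment m z = integral {0..1} (\<lambda>\<tau>. complex_of_real (\<tau> ^ m) * cis (\<tau> * z))"

lemma has_vector_derivative_cis: "((\<lambda>x. cis (x * r)) has_vector_derivative \<i> * of_real r * cis (x * r)) (at x within S)"
proof -
  have "((\<lambda>x. exp (\<i> * of_real r * of_real x)) has_vector_derivative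
      (\<i> * of_real r) * exp (\<i> * of_real r * of_real x)) (at x within S)"
    by (rule has_vector_derivative_real_field) (auto intro!: derivative_eq_intros)
  then show ?thesis by (simp add: cis_conv_exp mult_ac)
qed

lemma cis_moment_deriv: "(cis_moment m has_vector_derivative \<i> * cis_moment (Suc m) z) (at z)"
proof -
  have "((\<lambda>z. integral (cbox 0 1) (\<lambda>\<tau>. complex_of_real (\<tau> ^ m) * cis (\<tau> * z))) has_vector_derivative
      integral (cbox 0 1) (\<lambda>\<tau>. \<i> * (complex_of_real (\<tau> ^ Suc m) * cis (\<tau> * z)))) (at z within UNIV)"
  proof (rule leibniz_rule_vector_derivative)
    show "((\<lambda>z. complex_of_real (\<tau> ^ m) * cis (\<tau> * z)) has_vector_derivative
        \<i> * (complex_of_real (\<tau> ^ Suc m) * cis (\<tau> * z))) (at z within UNIV)" for z \<tau>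
      using has_vector_derivative_mult_right[OF has_vector_derivative_cis[of \<tau> z UNIV], of "complex_of_real (\<tau> ^ m)"]
      by (simp add: mult_ac)
    show "(\<lambda>\<tau>. complex_of_real (\<tau> ^ m) * cis (\<tau> * z)) integrable_on cbox 0 1" for z
      by (intro integrable_continuous continuous_intros)
    show "continuous_on (UNIV \<times> cbox 0 1) (\<lambda>(z, \<tau>). \<i> * (complex_of_real (\<tau> ^ Suc m) * cis (\<tau> * z)))"
      unfolding split_beta by (intro continuous_intros)
  qed auto
  then show ?thesis by (simp add: cis_moment_def [abs_def])
qed

lemma cis_moment_0: "\<i> * of_real z * cis_moment 0 z = cis z - 1"
proof -
  have "((\<lambda>\<tau>. \<i> * of_real z * cis (\<tau> * z)) has_integral cis (1 * z) - cis (0 * z)) {0..1}"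
    by (rule fundamental_theorem_of_calculus) (auto intro: has_vector_derivative_cis)
  then have "integral {0..1} (\<lambda>\<tau>. \<i> * of_real z * cis (\<tau> * z)) = cis z - 1"
    by (intro integral_unique) simp
  then show ?thesis by (simp add: cis_moment_def mult.assoc)
qed

lemma cis_moment_bound: "cmod (cis_moment m z) \<le> 1"
proof -
  have "norm (integral {0..1} (\<lambda>\<tau>. complex_of_real (\<tau> ^ m) * cis (\<tau> * z))) \<le> 1 * (1 - 0)"
    by (rule integral_bound) (auto intro!: continuous_intros simp: norm_mult norm_power power_le_one)
  then show ?thesis by (simp add: cis_moment_def)
qed

lemma continuous_cis_moment: "continuous_on S (cis_moment m)"
  by (meson cis_moment_deriv continuous_at_imp_continuous_on has_vector_derivative_continuous)

text \<open>An algebra of functions that is closed under \<open>\<partial>/\<partial>\<sigma>\<close> and contains the divided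
  differences \<open>(cis (\<sigma> x) - 1) / \<sigma>\<close> (by \<open>cis_moment_0\<close>), hence \<open>\<sigma>\<^sup>-\<^sup>l A(\<sigma> \<xi>)\<close>
  including its extension to \<open>\<sigma> = 0\<close>.\<close>

inductive symclass :: "(real \<Rightarrow> real ^ 'n::finite \<Rightarrow> complex) \<Rightarrow> bool" where
  const: "symclass (\<lambda>\<sigma> \<xi>. c)"
| scale: "symclass (\<lambda>\<sigma> \<xi>. of_real \<sigma>)"
| coord: "symclass (\<lambda>\<sigma> \<xi>. of_real (\<xi> $ k))"
| moment: "symclass (\<lambda>\<sigma> \<xi>. cis_moment m (\<sigma> * (r * \<xi> $ k)))"
| add: "symclass f \<Longrightarrow> symclass g \<Longrightarrow> symclass (\<lambda>\<sigma> \<xi>. f \<sigma> \<xi> + g \<sigma> \<xi>)"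
| mult: "symclass f \<Longrightarrow> symclass g \<Longrightarrow> symclass (\<lambda>\<sigma> \<xi>. f \<sigma> \<xi> * g \<sigma> \<xi>)"

lemma symclass_uminus: "symclass f \<Longrightarrow> symclass (\<lambda>\<sigma> \<xi>. - f \<sigma> \<xi>)"
  using symclass.mult[OF symclass.const[of "-1"]] by simp

lemma symclass_diff: "symclass f \<Longrightarrow> symclass g \<Longrightarrow> symclass (\<lambda>\<sigma> \<xi>. f \<sigma> \<xi> - g \<sigma> \<xi>)"
  using symclass.add[OF _ symclass_uminus] by simp

lemma symclass_power: "symclass f \<Longrightarrow> symclass (\<lambda>\<sigma> \<xi>. f \<sigma> \<xi> ^ n)"
  by (induction n) (auto intro: symclass.intros symclass.const[of 1])

lemma symclass_sum: "(\<And>i. i \<in> S \<Longrightarrow> symclass (f i)) \<Longrightarrow> symclass (\<lambda>\<sigma> \<xi>. \<Sum>i\<in>S. f i \<sigma> \<xi>)"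
  by (induction S rule: infinite_finite_induct) (auto intro: symclass.intros symclass.const[of 0])

lemma symclass_prod: "(\<And>i. i \<in> S \<Longrightarrow> symclass (f i)) \<Longrightarrow> symclass (\<lambda>\<sigma> \<xi>. \<Prod>i\<in>S. f i \<sigma> \<xi>)"
  by (induction S rule: infinite_finite_induct) (auto intro: symclass.intros symclass.const[of 1])

text \<open>The only generator that is not polynomial is the moment: by the chain rule its
  \<sigma>-derivative is the next moment times a multiple of a coordinate of \<xi>.\<close>

lemma symclass_has_derivative:
  fixes f :: "real \<Rightarrow> real ^ 'n::finite \<Rightarrow> complex"
  shows "symclass f \<Longrightarrow> \<exists>g. symclass g \<and> (\<forall>\<sigma> \<xi>. ((\<lambda>\<sigma>. f \<sigma> \<xi>) has_vector_derivative g \<sigma> \<xi>) (at \<sigma>))"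
proof (induction rule: symclass.induct)
  case (const c)
  show ?case by (rule exI[of _ "\<lambda>\<sigma> \<xi>. 0"]) (auto intro: symclass.intros)
next
  case scale
  show ?case
    by (rule exI[of _ "\<lambda>\<sigma> \<xi>. 1"]) (auto intro!: symclass.intros has_vector_derivative_of_real[of "\<lambda>x. x" 1, simplified])
next
  case (coord k)
  show ?case by (rule exI[of _ "\<lambda>\<sigma> \<xi>. 0"]) (auto intro: symclass.intros)
next
  case (moment m r k)
  have "((\<lambda>\<sigma>. cis_moment m (\<sigma> * (r * \<xi> $ k))) has_vector_derivative
      of_real r * of_real (\<xi> $ k) * (\<i> * cis_moment (Suc m) (\<sigma> * (r * \<xi> $ k)))) (at \<sigma>)" for \<sigma> and \<xi> :: "real^'n"
  proof -
    have "((\<lambda>\<sigma>. \<sigma> * (r * \<xi> $ k)) has_vector_derivative r * \<xi> $ k) (at \<sigma>)"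
      by (auto intro!: derivative_eq_intros simp: has_real_derivative_iff_has_vector_derivative[symmetric])
    from vector_diff_chain_at[OF this cis_moment_deriv] show ?thesis
      by (simp add: o_def scaleR_conv_of_real)
  qed
  then show ?case
    by (intro exI[of _ "\<lambda>\<sigma> \<xi>. of_real r * of_real (\<xi> $ k) * (\<i> * cis_moment (Suc m) (\<sigma> * (r * \<xi> $ k)))"])
       (auto intro!: symclass.intros)
next
  case (add f g)
  then obtain f' g' where "symclass f'" "symclass g'"
    "\<And>\<sigma> \<xi>. ((\<lambda>\<sigma>. f \<sigma> \<xi>) has_vector_derivative f' \<sigma> \<xi>) (at \<sigma>)"
    "\<And>\<sigma> \<xi>. ((\<lambda>\<sigma>. g \<sigma> \<xi>) has_vector_derivative g' \<sigma> \<xi>) (at \<sigma>)" by blast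
  then show ?case
    by (intro exI[of _ "\<lambda>\<sigma> \<xi>. f' \<sigma> \<xi> + g' \<sigma> \<xi>"]) (auto intro!: symclass.intros has_vector_derivative_add)
next
  case (mult f g)
  then obtain f' g' where "symclass f'" "symclass g'"
    "\<And>\<sigma> \<xi>. ((\<lambda>\<sigma>. f \<sigma> \<xi>) has_vector_derivative f' \<sigma> \<xi>) (at \<sigma>)"
    "\<And>\<sigma> \<xi>. ((\<lambda>\<sigma>. g \<sigma> \<xi>) has_vector_derivative g' \<sigma> \<xi>) (at \<sigma>)" by blast
  then show ?case using mult.hyps
    by (intro exI[of _ "\<lambda>\<sigma> \<xi>. f \<sigma> \<xi> * g' \<sigma> \<xi> + f' \<sigma> \<xi> * g \<sigma> \<xi>"])
       (auto intro!: symclass.add symclass.mult has_vector_derivative_mult)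
qed

text \<open>A total operator, so that \<open>exp_coeff\<close> can iterate it. For members of
  \<open>symclass\<close> it is the true derivative, by \<open>symclass_scale_deriv\<close>.\<close>

definition scale_deriv :: "(real \<Rightarrow> 'a \<Rightarrow> complex) \<Rightarrow> real \<Rightarrow> 'a \<Rightarrow> complex" where
  "scale_deriv f \<sigma> \<xi> = vector_derivative (\<lambda>\<sigma>. f \<sigma> \<xi>) (at \<sigma>)"

lemma symclass_scale_deriv:
  assumes "symclass f"
  shows "symclass (scale_deriv f)"
    and "((\<lambda>\<sigma>. f \<sigma> \<xi>) has_vector_derivative scale_deriv f \<sigma> \<xi>) (at \<sigma>)"
proof -
  obtain g where g: "symclass g" "\<And>\<sigma> \<xi>. ((\<lambda>\<sigma>. f \<sigma> \<xi>) has_vector_derivative g \<sigma> \<xi>) (at \<sigma>)"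
    using symclass_has_derivative[OF assms] by blast
  then have "scale_deriv f = g"
    by (auto simp: fun_eq_iff scale_deriv_def intro: vector_derivative_at)
  with g show "symclass (scale_deriv f)"
    "((\<lambda>\<sigma>. f \<sigma> \<xi>) has_vector_derivative scale_deriv f \<sigma> \<xi>) (at \<sigma>)" by auto
qed

text \<open>Moments are bounded by 1, so only the scale and the coordinates grow. C and N depend on
  the function and on S, but not on \<sigma> and \<xi>.\<close>

lemma symclass_bound:
  fixes f :: "real \<Rightarrow> real ^ 'n::finite \<Rightarrow> complex"
  shows "symclass f \<Longrightarrow> \<exists>C\<ge>0. \<exists>N. \<forall>\<sigma> \<xi>. \<bar>\<sigma>\<bar> \<le> S \<longrightarrow> cmod (f \<sigma> \<xi>) \<le> C * (1 + norm \<xi>) ^ N"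
proof (induction rule: symclass.induct)
  case (const c)
  show ?case by (rule exI[of _ "cmod c"]) (auto intro: exI[of _ 0])
next
  case scale
  \<comment> \<open>The absolute value keeps the constant nonnegative for negative S too.\<close>
  show ?case by (rule exI[of _ "\<bar>S\<bar>"]) (auto intro: exI[of _ 0])
next
  case (coord k)
  have "\<bar>\<xi> $ k\<bar> \<le> 1 + norm \<xi>" for \<xi> :: "real^'n"
    using component_le_norm_cart[of \<xi> k] by linarith
  then show ?case by (intro exI[of _ 1]) (auto intro: exI[of _ 1])
next
  case (moment m r k)
  show ?case by (intro exI[of _ 1] exI[of _ 0] conjI) (simp_all add: cis_moment_bound)
next
  case (add f g)
  then obtain C N C' N' where B: "C \<ge> 0" "C' \<ge> 0"
    "\<And>\<sigma> \<xi>. \<bar>\<sigma>\<bar> \<le> S \<Longrightarrow> cmod (f \<sigma> \<xi>) \<le> C * (1 + norm \<xi>) ^ N"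
    "\<And>\<sigma> \<xi>. \<bar>\<sigma>\<bar> \<le> S \<Longrightarrow> cmod (g \<sigma> \<xi>) \<le> C' * (1 + norm \<xi>) ^ N'" by blast
  have "cmod (f \<sigma> \<xi> + g \<sigma> \<xi>) \<le> (C + C') * (1 + norm \<xi>) ^ (N + N')" if "\<bar>\<sigma>\<bar> \<le> S" for \<sigma> \<xi>
  proof -
    have "cmod (f \<sigma> \<xi> + g \<sigma> \<xi>) \<le> C * (1 + norm \<xi>) ^ N + C' * (1 + norm \<xi>) ^ N'"
      using B(3,4)[OF that, of \<xi>] by (intro norm_triangle_le) linarith
    also have "\<dots> \<le> C * (1 + norm \<xi>) ^ (N + N') + C' * (1 + norm \<xi>) ^ (N + N')"
      using B(1,2) by (intro add_mono mult_left_mono power_increasing) auto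
    finally show ?thesis by (simp add: algebra_simps)
  qed
  then show ?case using B(1,2) by (intro exI[of _ "C + C'"] conjI exI[of _ "N + N'"]) auto
next
  case (mult f g)
  then obtain C N C' N' where B: "C \<ge> 0" "C' \<ge> 0"
    "\<And>\<sigma> \<xi>. \<bar>\<sigma>\<bar> \<le> S \<Longrightarrow> cmod (f \<sigma> \<xi>) \<le> C * (1 + norm \<xi>) ^ N"
    "\<And>\<sigma> \<xi>. \<bar>\<sigma>\<bar> \<le> S \<Longrightarrow> cmod (g \<sigma> \<xi>) \<le> C' * (1 + norm \<xi>) ^ N'" by blast
  have "cmod (f \<sigma> \<xi> * g \<sigma> \<xi>) \<le> (C * C') * (1 + norm \<xi>) ^ (N + N')" if "\<bar>\<sigma>\<bar> \<le> S" for \<sigma> \<xi>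
  proof -
    have "cmod (f \<sigma> \<xi>) * cmod (g \<sigma> \<xi>) \<le> (C * (1 + norm \<xi>) ^ N) * (C' * (1 + norm \<xi>) ^ N')"
      using B(1,2) B(3,4)[OF that, of \<xi>] by (intro mult_mono) auto
    then show ?thesis by (simp add: norm_mult power_add mult_ac)
  qed
  then show ?case using B(1,2) by (intro exI[of _ "C * C'"] conjI exI[of _ "N + N'"]) auto
qed

text \<open>At \<sigma> = 0 every moment becomes the constant \<open>cis_moment m 0\<close>, which
  leaves a polynomial in the coordinates.\<close>

lemma symclass_polyfn: "symclass f \<Longrightarrow> polyfn (f 0)"
  by (induction rule: symclass.induct)
     (simp_all add: polyfn_const polyfn_coord polyfn_add polyfn_mult)

lemma symclass_continuous: "symclass f \<Longrightarrow> continuous_on UNIV (\<lambda>p. f (fst p) (snd p))"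
proof (induction rule: symclass.induct)
  case (moment m r k)
  show ?case
    by (intro continuous_on_compose2[OF continuous_cis_moment[of UNIV m]] continuous_intros) auto
qed (auto intro!: continuous_intros)

text \<open>The factor of \<open>exp (- f)\<close> in the \<open>n\<close>th \<open>\<sigma>\<close>-derivative of \<open>(- f)\<^sup>J exp (- f)\<close>.\<close>

primrec exp_coeff :: "(real \<Rightarrow> 'a \<Rightarrow> complex) \<Rightarrow> nat \<Rightarrow> nat \<Rightarrow> real \<Rightarrow> 'a \<Rightarrow> complex" where
  "exp_coeff f J 0 = (\<lambda>\<sigma> \<xi>. (- f \<sigma> \<xi>) ^ J)"
| "exp_coeff f J (Suc n) =
    (\<lambda>\<sigma> \<xi>. scale_deriv (exp_coeff f J n) \<sigma> \<xi> - scale_deriv f \<sigma> \<xi> * exp_coeff f J n \<sigma> \<xi>)"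

lemma symclass_exp_coeff: "symclass f \<Longrightarrow> symclass (exp_coeff f J n)"
  by (induction n)
     (auto intro!: symclass_power symclass_uminus symclass_diff symclass.mult symclass_scale_deriv(1))

text \<open>The product rule (q exp(-f))' = (q' - f' q) exp(-f) is the recursion of
  \<open>exp_coeff\<close>.\<close>

lemma exp_coeff_deriv:
  assumes "symclass f"
  shows "((\<lambda>\<sigma>. exp_coeff f J n \<sigma> \<xi> * exp (- f \<sigma> \<xi>)) has_vector_derivative
    exp_coeff f J (Suc n) \<sigma> \<xi> * exp (- f \<sigma> \<xi>)) (at \<sigma> within T)"
proof -
  have "((\<lambda>\<sigma>. - f \<sigma> \<xi>) has_vector_derivative - scale_deriv f \<sigma> \<xi>) (at \<sigma>)"
    by (intro has_vector_derivative_minus symclass_scale_deriv(2) assms)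
  from field_vector_diff_chain_at[OF this DERIV_exp]
  have "((\<lambda>\<sigma>. exp (- f \<sigma> \<xi>)) has_vector_derivative - scale_deriv f \<sigma> \<xi> * exp (- f \<sigma> \<xi>)) (at \<sigma>)"
    by (simp add: o_def)
  then have "((\<lambda>\<sigma>. exp_coeff f J n \<sigma> \<xi> * exp (- f \<sigma> \<xi>)) has_vector_derivative
      exp_coeff f J n \<sigma> \<xi> * (- scale_deriv f \<sigma> \<xi> * exp (- f \<sigma> \<xi>))
      + scale_deriv (exp_coeff f J n) \<sigma> \<xi> * exp (- f \<sigma> \<xi>)) (at \<sigma>)"
    by (rule has_vector_derivative_mult[rotated]) (rule symclass_scale_deriv(2)[OF symclass_exp_coeff[OF assms]])
  moreover have "exp_coeff f J n \<sigma> \<xi> * (- scale_deriv f \<sigma> \<xi> * exp (- f \<sigma> \<xi>))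
      + scale_deriv (exp_coeff f J n) \<sigma> \<xi> * exp (- f \<sigma> \<xi>)
      = exp_coeff f J (Suc n) \<sigma> \<xi> * exp (- f \<sigma> \<xi>)"
    by (simp add: algebra_simps)
  ultimately show ?thesis by (simp only: has_vector_derivative_at_within)
qed

text \<open>The bound E on exp(-f) along the segment [0, s] stays a parameter: a decaying E is
  available only inside the cube, while the pointwise expansion can use a crude one. C and N come
  from \<open>symclass_bound\<close>, hence are uniform in s and \<xi>.\<close>

lemma exp_taylor:
  fixes f :: "real \<Rightarrow> real ^ 'n::finite \<Rightarrow> complex"
  assumes "symclass f"
  obtains C N where "C \<ge> 0" "\<And>s \<xi> E. 0 \<le> s \<Longrightarrow> s \<le> S \<Longrightarrow> \<forall>\<sigma>. 0 \<le> \<sigma> \<and> \<sigma> \<le> s \<longrightarrow> cmod (exp (- f \<sigma> \<xi>)) \<le> E \<Longrightarrow>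
    cmod ((- f s \<xi>) ^ J * exp (- f s \<xi>)
      - exp (- f 0 \<xi>) * (\<Sum>k\<le>K. of_real (s ^ k) * (exp_coeff f J k 0 \<xi> / of_real (fact k))))
    \<le> s ^ (K + 1) * (C * (1 + norm \<xi>) ^ N * E)"
proof -
  obtain C N where C: "C \<ge> 0"
    "\<And>\<sigma> \<xi>. \<bar>\<sigma>\<bar> \<le> S \<Longrightarrow> cmod (exp_coeff f J (Suc K) \<sigma> \<xi>) \<le> C * (1 + norm \<xi>) ^ N"
    using symclass_bound[OF symclass_exp_coeff[OF assms], of S J "Suc K"] by blast
  show thesis
  proof (rule that[of C N])
    fix s \<xi> E
    assume s: "0 \<le> s" "s \<le> S" and "\<forall>\<sigma>. 0 \<le> \<sigma> \<and> \<sigma> \<le> s \<longrightarrow> cmod (exp (- f \<sigma> \<xi>)) \<le> E"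
    then have E: "\<And>\<sigma>. 0 \<le> \<sigma> \<Longrightarrow> \<sigma> \<le> s \<Longrightarrow> cmod (exp (- f \<sigma> \<xi>)) \<le> E" by blast
    let ?D = "\<lambda>n \<sigma>. exp_coeff f J n \<sigma> \<xi> * exp (- f \<sigma> \<xi>)"
    let ?B = "C * (1 + norm \<xi>) ^ N * E"
    have E0: "E \<ge> 0" using E[of 0] s norm_ge_zero order_trans by blast
    \<comment> \<open>Taylor's formula with K + 1 terms. The kernel (s - x)^K / K! is at most s^K
      and the interval has length s, which together give the factor s^(K + 1).\<close>
    have "((\<lambda>x. ((s - x) ^ (Suc K - 1) / fact (Suc K - 1)) *\<^sub>R ?D (Suc K) x) has_integral
        ?D 0 s - (\<Sum>i<Suc K. ((s - 0) ^ i / fact i) *\<^sub>R ?D i 0)) {0..s}"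
      using s by (intro Taylor_has_integral exp_coeff_deriv[OF assms]) auto
    then have "norm (?D 0 s - (\<Sum>i<Suc K. ((s - 0) ^ i / fact i) *\<^sub>R ?D i 0))
        \<le> (s ^ K * ?B) * measure lborel {0..s}"
    proof (rule has_integral_bound_real[OF _ finite.emptyI, rotated])
      show "0 \<le> s ^ K * ?B" using s E0 C(1) by simp
      fix x assume "x \<in> {0..s} - {}"
      then have x: "x \<in> {0..s}" by simp
      have "\<bar>(s - x) ^ K / fact K\<bar> \<le> s ^ K / 1"
        using x s by (simp only: abs_divide power_abs) (intro frac_le power_mono, auto simp: fact_ge_1)
      moreover have "cmod (?D (Suc K) x) \<le> ?B"
        unfolding norm_mult using x s E0 C(1)
        by (intro mult_mono C(2) E) auto
      ultimately show "norm (((s - x) ^ (Suc K - 1) / fact (Suc K - 1)) *\<^sub>R ?D (Suc K) x) \<le> s ^ K * ?B"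
        unfolding norm_scaleR using s by (intro mult_mono) auto
    qed
    moreover have "(\<Sum>i<Suc K. ((s - 0) ^ i / fact i) *\<^sub>R ?D i 0)
        = exp (- f 0 \<xi>) * (\<Sum>k\<le>K. of_real (s ^ k) * (exp_coeff f J k 0 \<xi> / of_real (fact k)))"
      by (simp only: lessThan_Suc_atMost sum_distrib_left) (simp add: scaleR_conv_of_real mult_ac)
    ultimately show "cmod ((- f s \<xi>) ^ J * exp (- f s \<xi>)
      - exp (- f 0 \<xi>) * (\<Sum>k\<le>K. of_real (s ^ k) * (exp_coeff f J k 0 \<xi> / of_real (fact k))))
      \<le> s ^ (K + 1) * ?B"
      using s by (simp add: mult_ac)
  qed (rule C(1))
qed

section \<open>Fourier integrals\<close>

text \<open>The remainder is i h (\<open>cis_moment 0 h\<close> - 1), and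
  \<open>cis_moment 0\<close> has value 1 at 0 and Lipschitz constant 1.\<close>

lemma cis_remainder: "cmod (cis h - 1 - \<i> * of_real h) \<le> h\<^sup>2"
proof -
  have "norm (cis_moment 0 h - cis_moment 0 0) \<le> 1 * norm (h - 0)"
  proof (rule differentiable_bound[of UNIV])
    show "(cis_moment 0 has_derivative (\<lambda>s. s *\<^sub>R (\<i> * cis_moment (Suc 0) x))) (at x within UNIV)" for x
      using cis_moment_deriv[of 0 x] by (simp add: has_vector_derivative_def)
    show "onorm (\<lambda>s. s *\<^sub>R (\<i> * cis_moment (Suc 0) x)) \<le> 1" for x
      using cis_moment_bound[of "Suc 0" x] by (intro onorm_le) (simp add: norm_mult mult_left_le)
  qed auto
  moreover have "cis_moment 0 0 = 1" by (simp add: cis_moment_def)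
  ultimately have "\<bar>h\<bar> * cmod (cis_moment 0 h - 1) \<le> \<bar>h\<bar> * \<bar>h\<bar>"
    by (intro mult_left_mono) auto
  moreover have "cis h - 1 - \<i> * of_real h = \<i> * of_real h * (cis_moment 0 h - 1)"
    using cis_moment_0[of h] by (simp add: algebra_simps)
  ultimately show ?thesis by (simp add: norm_mult power2_eq_square)
qed

text \<open>A quadratic remainder bound survives integration over the whole space, so pointwise
  bounds from \<open>cis_remainder\<close> lead to differentiation under a Fourier integral.\<close>

lemma has_vector_derivative_quadratic:
  fixes f :: "real \<Rightarrow> 'a::real_normed_vector"
  assumes "\<And>s. norm (f (t + s) - f t - s *\<^sub>R D) \<le> C * s\<^sup>2"
  shows "(f has_vector_derivative D) (at t)"
  unfolding has_vector_derivative_def has_derivative_at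
proof (intro conjI)
  show "bounded_linear (\<lambda>x. x *\<^sub>R D)" by (rule bounded_linear_scaleR_left)
  show "((\<lambda>s. norm (f (t + s) - f t - s *\<^sub>R D) / norm s) \<longlongrightarrow> 0) (at 0)"
  proof (rule tendsto_sandwich[OF _ _ tendsto_const])
    show "\<forall>\<^sub>F s in at 0. norm (f (t + s) - f t - s *\<^sub>R D) / norm s \<le> C * \<bar>s\<bar>"
    proof (rule eventually_mono[OF eventually_at_filter[THEN iffD2, OF always_eventually]])
      fix s :: real show "s \<noteq> 0 \<Longrightarrow> norm (f (t + s) - f t - s *\<^sub>R D) / norm s \<le> C * \<bar>s\<bar>"
        using assms[of s] by (simp add: divide_le_eq power2_eq_square mult.assoc)
    qed auto
    show "((\<lambda>s. C * \<bar>s\<bar>) \<longlongrightarrow> 0) (at 0)"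
      by (intro tendsto_eq_intros) auto
  qed (auto intro!: always_eventually)
qed

section \<open>Integration in coordinates, scaling, and integrable weights\<close>

lemma
  fixes f :: "'a::euclidean_space \<Rightarrow> real \<Rightarrow> 'c::{real_normed_field,banach,second_countable_topology}"
  assumes "\<And>b. b \<in> Basis \<Longrightarrow> integrable lborel (f b)"
  shows lborel_integrable_prod: "integrable lborel (\<lambda>x::'a. \<Prod>b\<in>Basis. f b (x \<bullet> b))"
    and lborel_integral_prod: "(LINT x|lborel. (\<Prod>b\<in>Basis. f b (x \<bullet> b))) = (\<Prod>b\<in>Basis. LINT x|lborel. f b x)"
proof -
  interpret product_sigma_finite "\<lambda>_::'a. lborel :: real measure" by standard
  let ?T = "\<lambda>g::'a \<Rightarrow> real. \<Sum>b\<in>Basis. g b *\<^sub>R b"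
  have T: "?T \<in> measurable (\<Pi>\<^sub>M b\<in>Basis. lborel) borel" by measurable
  have [measurable]: "f b \<in> borel_measurable borel" if "b \<in> Basis" for b
    using assms[OF that] by auto
  have m: "(\<lambda>x::'a. \<Prod>b\<in>Basis. f b (x \<bullet> b)) \<in> borel_measurable borel" by measurable
  have eq: "(\<Prod>b\<in>Basis. f b (?T g \<bullet> b)) = (\<Prod>b\<in>Basis. f b (g b))" for g
    by (intro prod.cong) auto
  show "integrable lborel (\<lambda>x::'a. \<Prod>b\<in>Basis. f b (x \<bullet> b))"
    by (subst lborel_eq, subst integrable_distr_eq[OF T m], subst eq)
       (intro product_integrable_prod assms finite_Basis)
  show "(LINT x|lborel. (\<Prod>b\<in>Basis. f b (x \<bullet> b))) = (\<Prod>b\<in>Basis. LINT x|lborel. f b x)"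
    by (subst lborel_eq, subst integral_distr[OF T m], subst eq)
       (intro product_integral_prod assms finite_Basis)
qed

lemma prod_Basis_cart: "(\<Prod>b\<in>Basis. F b) = (\<Prod>k\<in>UNIV. F (axis k (1::real) :: real ^ 'n::finite))"
proof -
  have basis: "(Basis :: (real ^ 'n) set) = (\<lambda>k. axis k 1) ` UNIV" by (auto simp: Basis_vec_def)
  have inj: "inj (\<lambda>k. axis k (1::real) :: real ^ 'n)" by (auto intro!: injI simp: axis_eq_axis)
  show ?thesis unfolding basis by (rule prod.reindex[OF inj, unfolded o_def])
qed

lemma
  fixes f :: "'n::finite \<Rightarrow> real \<Rightarrow> 'c::{real_normed_field,banach,second_countable_topology}"
  assumes "\<And>k. integrable lborel (f k)"
  shows cart_integrable_prod: "integrable lborel (\<lambda>x::real^'n. \<Prod>k\<in>UNIV. f k (x $ k))"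
    and cart_integral_prod: "(LINT x::real^'n|lborel. (\<Prod>k\<in>UNIV. f k (x $ k))) = (\<Prod>k\<in>UNIV. LINT x|lborel. f k x)"
proof -
  \<comment> \<open>Here the factors are indexed by basis vectors; the description recovers the
    coordinate from its unit vector.\<close>
  define g where "g = (\<lambda>b::real^'n. f (THE k. b = axis k 1))"
  have g: "g (axis k 1) = f k" for k by (auto simp: g_def axis_eq_axis)
  have *: "integrable lborel (g b)" if "b \<in> Basis" for b
    using that assms by (auto simp: Basis_vec_def g)
  show "integrable lborel (\<lambda>x::real^'n. \<Prod>k\<in>UNIV. f k (x $ k))"
    using lborel_integrable_prod[of g, OF *] by (simp add: prod_Basis_cart g inner_axis)
  show "(LINT x::real^'n|lborel. (\<Prod>k\<in>UNIV. f k (x $ k))) = (\<Prod>k\<in>UNIV. LINT x|lborel. f k x)"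
    using lborel_integral_prod[of g, OF *] by (simp add: prod_Basis_cart g inner_axis)
qed

lemma lborel_integral_scale:
  fixes g :: "'a::euclidean_space \<Rightarrow> 'b::{banach,second_countable_topology}"
  assumes [measurable]: "g \<in> borel_measurable borel" and "s > 0"
  shows "(LINT x|lborel. g x) = s ^ DIM('a) *\<^sub>R (LINT x|lborel. g (s *\<^sub>R x))"
proof -
  have "(LINT x|lborel. g x) = (LINT x|density (distr lborel borel (\<lambda>x. 0 + s *\<^sub>R x)) (\<lambda>_. ennreal (\<bar>s\<bar> ^ DIM('a))). g x)"
    using lborel_affine[of s "0::'a"] \<open>s > 0\<close> by simp
  also have "\<dots> = (LINT x|lborel. (s ^ DIM('a)) *\<^sub>R g (s *\<^sub>R x))"
    using \<open>s > 0\<close> by (subst integral_density) (auto simp: integral_distr)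
  finally show ?thesis by simp
qed

lemma poly_exp_bounded:
  fixes c :: real
  assumes "c > 0" "l > 0"
  obtains B where "B \<ge> 0" "\<And>r. r \<ge> 0 \<Longrightarrow> (1 + r) ^ m * exp (- (c * r ^ l)) \<le> B"
proof -
  \<comment> \<open>The exponent must be positive because (1 + x / n)^n \<le> exp x is applied with
    x = c (1 + r); this produces (n / c)^n. The factor exp(2 c) in B pays for passing from exp(-c
    r^l) to exp(-c (1 + r)) by r \<le> 1 + r^l.\<close>
  define n where "n = Suc m"
  define B where "B = exp (2 * c) * (real n / c) ^ n"
  have "(1 + r) ^ m * exp (- (c * r ^ l)) \<le> B" if r: "r \<ge> 0" for r
  proof -
    have "r \<le> 1 + r ^ l"
    proof (cases "r \<le> 1")
      case False then have "r ^ 1 \<le> r ^ l" using assms by (intro power_increasing) auto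
      then show ?thesis by simp
    qed (use r in \<open>simp add: add_increasing2\<close>)
    then have "c * r \<le> c * (1 + r ^ l)" using assms by (intro mult_left_mono) auto
    then have e: "exp (- (c * r ^ l)) \<le> exp (2 * c) * exp (- (c * (1 + r)))"
      by (simp add: exp_add[symmetric] algebra_simps)
    have "(c * (1 + r) / real n) ^ n \<le> (1 + c * (1 + r) / real n) ^ n"
      using r assms by (intro power_mono) auto
    also have "\<dots> \<le> exp (c * (1 + r))"
      using r assms by (intro exp_ge_one_plus_x_over_n_power_n) (auto simp: n_def intro: order_trans[of _ 0])
    finally have "(1 + r) ^ n * (c / real n) ^ n \<le> exp (c * (1 + r))"
      by (simp add: power_mult_distrib power_divide mult_ac)
    then have "(1 + r) ^ n \<le> (real n / c) ^ n * exp (c * (1 + r))"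
      using assms by (subst (asm) pos_le_divide_eq[symmetric]) (simp_all add: power_divide n_def divide_simps mult.commute)
    moreover have "(1 + r) ^ m \<le> (1 + r) ^ n" using r by (intro power_increasing) (auto simp: n_def)
    ultimately have "(1 + r) ^ m \<le> (real n / c) ^ n * exp (c * (1 + r))" by linarith
    then have "(1 + r) ^ m * exp (- (c * r ^ l))
        \<le> ((real n / c) ^ n * exp (c * (1 + r))) * (exp (2 * c) * exp (- (c * (1 + r))))"
      using e r assms by (intro mult_mono) auto
    also have "\<dots> = B" by (simp add: B_def exp_minus)
    finally show ?thesis .
  qed
  moreover have "B \<ge> 0" using assms by (simp add: B_def)
  ultimately show thesis using that by blast
qed

text \<open>Comparison with the product of the integrable functions 1 / (1 + \<xi>_k^2). Its
  reciprocal is at most (1 + |\<xi>|)^(2 d), which the exponential absorbs.\<close>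

lemma integrable_poly_exp:
  fixes c :: real
  assumes "c > 0" "l > 0"
  shows "integrable lborel (\<lambda>\<xi>::real^'n::finite. (1 + norm \<xi>) ^ N * exp (- (c * norm \<xi> ^ l)))"
proof -
  let ?d = "CARD('n)"
  obtain B where B: "B \<ge> 0" "\<And>r. r \<ge> 0 \<Longrightarrow> (1 + r) ^ (N + 2 * ?d) * exp (- (c * r ^ l)) \<le> B"
    using poly_exp_bounded[OF assms] by blast
  have "integrable lborel (\<lambda>x::real. inverse (1 + x\<^sup>2))"
    using integrable_inverse_1_plus_square by (simp add: set_integrable_def)
  then have int: "integrable lborel (\<lambda>\<xi>::real^'n. B * (\<Prod>k\<in>UNIV. inverse (1 + (\<xi> $ k)\<^sup>2)))"
    by (intro integrable_mult_right cart_integrable_prod) auto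
  show ?thesis
  proof (rule Bochner_Integration.integrable_bound[OF int])
    show "AE \<xi> :: real^'n in lborel. norm ((1 + norm \<xi>) ^ N * exp (- (c * norm \<xi> ^ l)))
        \<le> norm (B * (\<Prod>k\<in>UNIV. inverse (1 + (\<xi> $ k)\<^sup>2)))"
    proof (intro always_eventually allI)
      fix \<xi> :: "real^'n"
      have "(\<Prod>k\<in>UNIV. 1 + (\<xi> $ k)\<^sup>2) \<le> (\<Prod>k\<in>(UNIV::'n set). (1 + norm \<xi>)\<^sup>2)"
      proof (rule prod_mono, intro conjI)
        fix k
        have "\<bar>\<xi> $ k\<bar>\<^sup>2 \<le> (norm \<xi>)\<^sup>2" by (intro power_mono component_le_norm_cart) auto
        then show "1 + (\<xi> $ k)\<^sup>2 \<le> (1 + norm \<xi>)\<^sup>2" by (simp add: power2_sum add_increasing2)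
      qed (simp add: add_nonneg_nonneg)
      also have "\<dots> = (1 + norm \<xi>) ^ (2 * ?d)" by (simp add: power_mult)
      finally have p: "(\<Prod>k\<in>UNIV. 1 + (\<xi> $ k)\<^sup>2) \<le> (1 + norm \<xi>) ^ (2 * ?d)" .
      have p0: "(\<Prod>k\<in>UNIV. 1 + (\<xi> $ k)\<^sup>2) > 0" by (intro prod_pos) (simp add: add_pos_nonneg)
      have "(1 + norm \<xi>) ^ N * exp (- (c * norm \<xi> ^ l)) * (\<Prod>k\<in>UNIV. 1 + (\<xi> $ k)\<^sup>2)
          \<le> (1 + norm \<xi>) ^ N * exp (- (c * norm \<xi> ^ l)) * (1 + norm \<xi>) ^ (2 * ?d)"
        using p by (intro mult_left_mono) auto
      also have "\<dots> \<le> B" using B(2)[of "norm \<xi>"] by (simp add: power_add mult_ac)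
      finally have "(1 + norm \<xi>) ^ N * exp (- (c * norm \<xi> ^ l)) \<le> B / (\<Prod>k\<in>UNIV. 1 + (\<xi> $ k)\<^sup>2)"
        using p0 by (simp only: pos_le_divide_eq)
      also have "\<dots> = B * (\<Prod>k\<in>UNIV. inverse (1 + (\<xi> $ k)\<^sup>2))"
        by (simp only: prod_inversef[unfolded o_def, symmetric] divide_inverse)
      finally have "(1 + norm \<xi>) ^ N * exp (- (c * norm \<xi> ^ l)) \<le> B * (\<Prod>k\<in>UNIV. inverse (1 + (\<xi> $ k)\<^sup>2))" .
      then show "norm ((1 + norm \<xi>) ^ N * exp (- (c * norm \<xi> ^ l)))
        \<le> norm (B * (\<Prod>k\<in>UNIV. inverse (1 + (\<xi> $ k)\<^sup>2)))" by simp
    qed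
  qed measurable
qed

text \<open>Integrability of all polynomial moments, without smoothness or pointwise decay: the
  class is stable under multiplication by polynomials, and its Fourier integrals can be
  differentiated arbitrarily often.\<close>

definition rapid :: "(real ^ 'n::finite \<Rightarrow> complex) \<Rightarrow> bool" where
  "rapid g \<longleftrightarrow> g \<in> borel_measurable borel \<and>
     (\<forall>N. integrable lborel (\<lambda>\<xi>. (1 + norm \<xi>) ^ N * cmod (g \<xi>)))"

lemma rapid_mult:
  fixes g h :: "real ^ 'n::finite \<Rightarrow> complex"
  assumes g: "rapid g" and [measurable]: "h \<in> borel_measurable borel"
    and h: "\<And>\<xi>. cmod (h \<xi>) \<le> C * (1 + norm \<xi>) ^ m"
  shows "rapid (\<lambda>\<xi>. h \<xi> * g \<xi>)"
  unfolding rapid_def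
proof (intro conjI allI)
  have [measurable]: "g \<in> borel_measurable borel" using g by (simp add: rapid_def)
  show "(\<lambda>\<xi>. h \<xi> * g \<xi>) \<in> borel_measurable borel" by measurable
  fix N
  have "integrable lborel (\<lambda>\<xi>. C * ((1 + norm \<xi>) ^ (N + m) * cmod (g \<xi>)))"
    using g by (intro integrable_mult_right) (simp add: rapid_def)
  then show "integrable lborel (\<lambda>\<xi>. (1 + norm \<xi>) ^ N * cmod (h \<xi> * g \<xi>))"
  proof (rule Bochner_Integration.integrable_bound)
    show "AE \<xi> in lborel. norm ((1 + norm \<xi>) ^ N * cmod (h \<xi> * g \<xi>)) \<le> norm (C * ((1 + norm \<xi>) ^ (N + m) * cmod (g \<xi>)))"
    proof (intro always_eventually allI)
      fix \<xi> :: "real^'n"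
      have "(1 + norm \<xi>) ^ N * (cmod (h \<xi>) * cmod (g \<xi>)) \<le> (1 + norm \<xi>) ^ N * ((C * (1 + norm \<xi>) ^ m) * cmod (g \<xi>))"
        using h by (intro mult_left_mono mult_right_mono) auto
      also have "\<dots> = C * ((1 + norm \<xi>) ^ (N + m) * cmod (g \<xi>))" by (simp add: power_add mult_ac)
      finally have *: "(1 + norm \<xi>) ^ N * (cmod (h \<xi>) * cmod (g \<xi>)) \<le> C * ((1 + norm \<xi>) ^ (N + m) * cmod (g \<xi>))" .
      show "norm ((1 + norm \<xi>) ^ N * cmod (h \<xi> * g \<xi>)) \<le> norm (C * ((1 + norm \<xi>) ^ (N + m) * cmod (g \<xi>)))"
        using order_trans[OF * abs_ge_self] by (simp add: norm_mult)
    qed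
  qed measurable
qed

lemma rapid_coord:
  fixes g :: "real ^ 'n::finite \<Rightarrow> complex"
  assumes "rapid g"
  shows "rapid (\<lambda>\<xi>. c * of_real (\<xi> $ k) * g \<xi>)"
proof (rule rapid_mult[OF assms, of _ "cmod c" 1])
  show "(\<lambda>\<xi>. c * of_real (\<xi> $ k)) \<in> borel_measurable borel"
    by (intro borel_measurable_continuous_onI continuous_intros)
  have "\<bar>\<xi> $ k\<bar> \<le> 1 + norm \<xi>" for \<xi> :: "real^'n" using component_le_norm_cart[of \<xi> k] by linarith
  then show "cmod (c * of_real (\<xi> $ k)) \<le> cmod c * (1 + norm \<xi>) ^ 1" for \<xi>
    by (auto simp: norm_mult intro: mult_left_mono)
qed

lemma integrable_mult_cis:
  fixes g :: "real ^ 'n::finite \<Rightarrow> complex"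
  assumes "integrable lborel g" and [measurable]: "p \<in> borel_measurable borel"
  shows "integrable lborel (\<lambda>\<xi>. g \<xi> * cis (p \<xi>))"
proof -
  have [measurable]: "g \<in> borel_measurable borel" using assms by auto
  have "(\<lambda>\<xi>. cis (p \<xi>)) \<in> borel_measurable borel"
    by (rule measurable_compose[OF assms(2)]) (intro borel_measurable_continuous_onI continuous_intros)
  then have "(\<lambda>\<xi>. g \<xi> * cis (p \<xi>)) \<in> borel_measurable lborel" by measurable
  then show ?thesis
    by (rule Bochner_Integration.integrable_bound[OF assms(1)]) (simp add: norm_mult)
qed

lemma rapid_integrable: "rapid g \<Longrightarrow> integrable lborel g"
proof -
  assume g: "rapid g"
  then have "integrable lborel (\<lambda>\<xi>. (1 + norm \<xi>) ^ 0 * cmod (g \<xi>))" unfolding rapid_def by blast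
  with g show "integrable lborel g" by (simp add: integrable_norm_iff rapid_def)
qed

lemma rapid_integrable_cis: "rapid g \<Longrightarrow> integrable lborel (\<lambda>\<xi>. g \<xi> * cis (y \<bullet> \<xi>))"
  by (intro integrable_mult_cis rapid_integrable) auto

definition fourier :: "(real ^ 'n::finite \<Rightarrow> complex) \<Rightarrow> real ^ 'n \<Rightarrow> complex" where
  "fourier g y = (LINT \<xi>|lborel. g \<xi> * cis (y \<bullet> \<xi>)) / complex_of_real ((2 * pi) ^ CARD('n))"

lemma fourier_sum:
  assumes "\<And>i. i \<in> S \<Longrightarrow> rapid (g i)"
  shows "(\<Sum>i\<in>S. c i * fourier (g i) y) = fourier (\<lambda>\<xi>. \<Sum>i\<in>S. c i * g i \<xi>) y"
proof -
  have "(LINT \<xi>|lborel. (\<Sum>i\<in>S. c i * g i \<xi>) * cis (y \<bullet> \<xi>)) = (LINT \<xi>|lborel. (\<Sum>i\<in>S. c i * (g i \<xi> * cis (y \<bullet> \<xi>))))"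
    by (simp add: sum_distrib_right mult.assoc)
  also have "\<dots> = (\<Sum>i\<in>S. LINT \<xi>|lborel. c i * (g i \<xi> * cis (y \<bullet> \<xi>)))"
    by (intro Bochner_Integration.integral_sum integrable_mult_right rapid_integrable_cis assms)
  finally show ?thesis by (simp add: fourier_def sum_divide_distrib)
qed

text \<open>\<open>cis_remainder\<close> with h = s \<xi>_j bounds the pointwise remainder by s^2
  times a second moment of g, which is integrable; \<open>has_vector_derivative_quadratic\<close>
  then applies.\<close>

lemma fourier_pderivative:
  fixes g :: "real ^ 'n::finite \<Rightarrow> complex"
  assumes g: "rapid g"
  shows "pderivative j (fourier g) = fourier (\<lambda>\<xi>. (\<i> * of_real (\<xi> $ j)) * g \<xi>)"
proof
  fix y
  let ?P = "complex_of_real ((2 * pi) ^ CARD('n))"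
  define C where "C = (LINT \<xi>|lborel. (1 + norm \<xi>)\<^sup>2 * cmod (g \<xi>)) / (2 * pi) ^ CARD('n)"
  have rg': "rapid (\<lambda>\<xi>. (\<i> * of_real (\<xi> $ j)) * g \<xi>)" by (rule rapid_coord[OF g])
  have "((\<lambda>s. fourier g (y + s *\<^sub>R axis j 1)) has_vector_derivative fourier (\<lambda>\<xi>. (\<i> * of_real (\<xi> $ j)) * g \<xi>) y) (at 0)"
  proof (rule has_vector_derivative_quadratic)
    fix s :: real
    have bound: "cmod (I / ?P) \<le> C * r"
      if "cmod I \<le> (LINT \<xi>|lborel. r * ((1 + norm \<xi>)\<^sup>2 * cmod (g \<xi>)))" for I r
    proof -
      have "cmod (I / ?P) \<le> (r * (LINT \<xi>|lborel. (1 + norm \<xi>)\<^sup>2 * cmod (g \<xi>))) / (2 * pi) ^ CARD('n)"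
        using that by (simp only: norm_divide norm_of_real) (simp add: divide_right_mono)
      then show ?thesis by (simp add: C_def mult.commute)
    qed
    note ints = rapid_integrable_cis[OF g] rapid_integrable_cis[OF rg']
    let ?R = "\<lambda>\<xi>. g \<xi> * cis ((y + s *\<^sub>R axis j 1) \<bullet> \<xi>) - g \<xi> * cis (y \<bullet> \<xi>) - of_real s * ((\<i> * of_real (\<xi> $ j)) * g \<xi> * cis (y \<bullet> \<xi>))"
    have "fourier g (y + s *\<^sub>R axis j 1) - fourier g y - s *\<^sub>R fourier (\<lambda>\<xi>. (\<i> * of_real (\<xi> $ j)) * g \<xi>) y
       = (LINT \<xi>|lborel. ?R \<xi>) / ?P"
      by (simp add: fourier_def ints Bochner_Integration.integral_diff integrable_mult_right scaleR_conv_of_real diff_divide_distrib)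
    moreover have "cmod (LINT \<xi>|lborel. ?R \<xi>) \<le> (LINT \<xi>|lborel. s\<^sup>2 * ((1 + norm \<xi>)\<^sup>2 * cmod (g \<xi>)))"
    proof (rule Bochner_Integration.integral_norm_bound_integral)
      show "integrable lborel ?R"
        by (intro Bochner_Integration.integrable_diff integrable_mult_right ints)
      show "integrable lborel (\<lambda>\<xi>. s\<^sup>2 * ((1 + norm \<xi>)\<^sup>2 * cmod (g \<xi>)))"
        using g by (intro integrable_mult_right) (simp add: rapid_def)
      fix \<xi> :: "real^'n"
      have "?R \<xi> = g \<xi> * cis (y \<bullet> \<xi>) * (cis (s * \<xi> $ j) - 1 - \<i> * of_real (s * \<xi> $ j))"
        by (simp add: inner_add_left inner_axis' cis_mult[symmetric] algebra_simps)
      then have "cmod (?R \<xi>) = cmod (g \<xi>) * cmod (cis (s * \<xi> $ j) - 1 - \<i> * of_real (s * \<xi> $ j))"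
        by (simp add: norm_mult)
      also have "\<dots> \<le> cmod (g \<xi>) * (s * \<xi> $ j)\<^sup>2"
        by (intro mult_left_mono cis_remainder) auto
      also have "\<dots> \<le> cmod (g \<xi>) * (s\<^sup>2 * (1 + norm \<xi>)\<^sup>2)"
      proof -
        have "\<bar>\<xi> $ j\<bar>\<^sup>2 \<le> (1 + norm \<xi>)\<^sup>2"
          using component_le_norm_cart[of \<xi> j] by (intro power_mono) auto
        then show ?thesis by (auto simp: power_mult_distrib intro!: mult_left_mono)
      qed
      finally show "cmod (?R \<xi>) \<le> s\<^sup>2 * ((1 + norm \<xi>)\<^sup>2 * cmod (g \<xi>))" by (simp add: mult_ac)
    qed
    ultimately have "cmod (fourier g (y + s *\<^sub>R axis j 1) - fourier g y - s *\<^sub>R fourier (\<lambda>\<xi>. (\<i> * of_real (\<xi> $ j)) * g \<xi>) y) \<le> C * s\<^sup>2"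
      by (simp only: bound)
    then show "norm (fourier g (y + (0 + s) *\<^sub>R axis j 1) - fourier g (y + 0 *\<^sub>R axis j 1)
        - s *\<^sub>R fourier (\<lambda>\<xi>. (\<i> * of_real (\<xi> $ j)) * g \<xi>) y) \<le> C * s\<^sup>2"
      by simp
  qed
  then show "pderivative j (fourier g) y = fourier (\<lambda>\<xi>. (\<i> * of_real (\<xi> $ j)) * g \<xi>) y"
    by (simp add: pderivative_def vector_derivative_at)
qed

lemma fourier_cmult: "c * fourier g y = fourier (\<lambda>\<xi>. c * g \<xi>) y"
  by (simp add: fourier_def mult.assoc)

lemma fourier_Dop:
  assumes "rapid g"
  shows "Dop j (fourier g) = fourier (\<lambda>\<xi>. of_real (\<xi> $ j) * g \<xi>)"
proof -
  have "- (\<i> * (\<i> * a)) = a" for a by (simp add: mult.assoc[symmetric])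
  then show ?thesis
    by (simp add: fun_eq_iff Dop_def fourier_pderivative[OF assms])
       (simp add: fourier_cmult[of "- \<i>", simplified] mult.assoc)
qed

lemma fourier_mi_Dop:
  assumes "rapid g"
  shows "rapid (\<lambda>\<xi>. mi_monom \<xi> \<alpha> * g \<xi>)"
    and "mi_op Dop \<alpha> (fourier g) = fourier (\<lambda>\<xi>. mi_monom \<xi> \<alpha> * g \<xi>)"
proof -
  have 1: "rapid (\<lambda>\<xi>. of_real (\<xi> $ j) * h \<xi>)" if "rapid h" for j h
    using rapid_coord[OF that, of 1] by simp
  show "rapid (\<lambda>\<xi>. mi_monom \<xi> \<alpha> * g \<xi>)"
    unfolding mi_monom_def
    by (rule mi_op_multiplier(1)[where P = rapid and \<Phi> = fourier and T = Dop, OF 1 fourier_Dop assms])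
  show "mi_op Dop \<alpha> (fourier g) = fourier (\<lambda>\<xi>. mi_monom \<xi> \<alpha> * g \<xi>)"
    unfolding mi_monom_def
    by (rule mi_op_multiplier(2)[where P = rapid and \<Phi> = fourier and T = Dop, OF 1 fourier_Dop assms])
qed

text \<open>\<open>HJk\<close> is built from D = -i times the derivative, while the theorem speaks
  of plain derivatives; this supplies the conversion factor.\<close>

lemma fourier_mi_pderivative:
  assumes "rapid g"
  shows "mi_op pderivative \<alpha> (fourier g) = (\<lambda>y. \<i> ^ mi_abs \<alpha> * mi_op Dop \<alpha> (fourier g) y)"
proof -
  have "mi_op pderivative \<alpha> (fourier g) = fourier (\<lambda>\<xi>. (\<Prod>j\<in>UNIV. (\<i> * of_real (\<xi> $ j)) ^ \<alpha> j) * g \<xi>)"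
    by (rule mi_op_multiplier(2)[where P = rapid]) (use rapid_coord fourier_pderivative assms in auto)
  also have "\<dots> = (\<lambda>y. \<i> ^ mi_abs \<alpha> * mi_op Dop \<alpha> (fourier g) y)"
    by (simp add: fourier_mi_Dop(2)[OF assms] fourier_cmult power_mult_distrib prod.distrib mi_monom_def
        mi_abs_def power_sum mult.assoc)
  finally show ?thesis .
qed

lemma fourier_mpol_D:
  assumes "rapid g"
  shows "mpol_D p (fourier g) = fourier (\<lambda>\<xi>. mpol_eval p \<xi> * g \<xi>)"
  by (simp add: fun_eq_iff mpol_D_def mpol_eval_def fourier_mi_Dop[OF assms] fourier_sum sum_distrib_right mult.assoc)

lemma fourier_diff_op:
  assumes "rapid g"
  shows "diff_op l b (fourier g) = fourier (\<lambda>\<xi>. diff_symbol l b \<xi> * g \<xi>)"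
  by (simp add: fun_eq_iff diff_op_def diff_symbol_def fourier_mi_Dop[OF assms] fourier_sum sum_distrib_right mult.assoc)

lemma rapid_sum: "(\<And>i. i \<in> S \<Longrightarrow> rapid (g i)) \<Longrightarrow> rapid (\<lambda>\<xi>. \<Sum>i\<in>S. g i \<xi>)"
proof (induction S rule: infinite_finite_induct)
  case (insert x S)
  then have r: "rapid (g x)" "rapid (\<lambda>\<xi>. \<Sum>i\<in>S. g i \<xi>)" by auto
  have [measurable]: "g x \<in> borel_measurable borel" "(\<lambda>\<xi>. \<Sum>i\<in>S. g i \<xi>) \<in> borel_measurable borel"
    using r by (auto simp: rapid_def)
  have "rapid (\<lambda>\<xi>. g x \<xi> + (\<Sum>i\<in>S. g i \<xi>))"
    unfolding rapid_def
  proof (intro conjI allI)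
    show "(\<lambda>\<xi>. g x \<xi> + (\<Sum>i\<in>S. g i \<xi>)) \<in> borel_measurable borel" by measurable
    fix N
    have "integrable lborel (\<lambda>\<xi>. (1 + norm \<xi>) ^ N * cmod (g x \<xi>) + (1 + norm \<xi>) ^ N * cmod (\<Sum>i\<in>S. g i \<xi>))"
      using r by (intro Bochner_Integration.integrable_add) (simp_all add: rapid_def)
    then show "integrable lborel (\<lambda>\<xi>. (1 + norm \<xi>) ^ N * cmod (g x \<xi> + (\<Sum>i\<in>S. g i \<xi>)))"
    proof (rule Bochner_Integration.integrable_bound)
      show "AE \<xi> in lborel. norm ((1 + norm \<xi>) ^ N * cmod (g x \<xi> + (\<Sum>i\<in>S. g i \<xi>)))
          \<le> norm ((1 + norm \<xi>) ^ N * cmod (g x \<xi>) + (1 + norm \<xi>) ^ N * cmod (\<Sum>i\<in>S. g i \<xi>))"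
        by (intro always_eventually allI) (simp add: distrib_left[symmetric] mult_left_mono norm_triangle_ineq)
    qed measurable
  qed
  then show ?case using insert by simp
qed (simp_all add: rapid_def)

lemma rapid_diff_symbol:
  assumes "rapid g"
  shows "rapid (\<lambda>\<xi>. - diff_symbol l b \<xi> * g \<xi>)"
proof -
  have "rapid (\<lambda>\<xi>. \<Sum>\<alpha> | mi_abs \<alpha> = l. (- b \<alpha>) * (mi_monom \<xi> \<alpha> * g \<xi>))"
  proof (intro rapid_sum)
    fix \<alpha>
    show "rapid (\<lambda>\<xi>. (- b \<alpha>) * (mi_monom \<xi> \<alpha> * g \<xi>))"
      by (rule rapid_mult[OF fourier_mi_Dop(1)[OF assms], of _ "cmod (b \<alpha>)" 0]) auto
  qed
  then show ?thesis
    by (simp add: diff_symbol_def sum_distrib_right sum_negf mult.assoc)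
qed

section \<open>Evolution equations with bounded generator\<close>

text \<open>The a priori bound B disappears from the conclusion. If |v| \<le> 2 N + B / 2^n on
  [a, b], then v varies from time p by at most C (b - a) (2 N + B / 2^n) \<le> N + B / 2^(n + 1),
  hence |v| \<le> 2 N + B / 2^(n + 1). Let n tend to infinity. The time p may lie anywhere in the
  interval, so the bound runs forwards and backwards.\<close>

lemma short_interval_bound:
  fixes v D :: "'a \<Rightarrow> real \<Rightarrow> complex"
  assumes cont: "\<And>x. x \<in> X \<Longrightarrow> continuous_on {0..} (v x)"
    and der: "\<And>x t. x \<in> X \<Longrightarrow> t > 0 \<Longrightarrow> (v x has_vector_derivative D x t) (at t)"
    and gen: "\<And>t B x. t > 0 \<Longrightarrow> (\<And>z. z \<in> X \<Longrightarrow> cmod (v z t) \<le> B) \<Longrightarrow> x \<in> X \<Longrightarrow> cmod (D x t) \<le> C * B"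
    and "C \<ge> 0" "0 \<le> a" and len: "C * (b - a) \<le> 1/2"
    and bdd: "\<And>x t. x \<in> X \<Longrightarrow> t \<in> {a..b} \<Longrightarrow> cmod (v x t) \<le> B"
    and p: "p \<in> {a..b}" "\<And>x. x \<in> X \<Longrightarrow> cmod (v x p) \<le> N"
    and "x \<in> X" "t \<in> {a..b}"
  shows "cmod (v x t) \<le> 2 * N"
proof -
  have iter: "cmod (v x t) \<le> 2 * N + B / 2 ^ n" if "x \<in> X" "t \<in> {a..b}" for n x t
    using that
  proof (induction n arbitrary: x t)
    case 0
    have "0 \<le> N" using p(2)[OF 0(1)] norm_ge_zero order_trans by blast
    then show ?case using bdd[OF 0] by simp
  next
    case (Suc n)
    let ?B = "2 * N + B / 2 ^ n"
    have B0: "0 \<le> ?B" using Suc.IH[OF Suc.prems] norm_ge_zero order_trans by blast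
    have step: "cmod (v x \<tau> - v x \<sigma>) \<le> ?B / 2" if "\<sigma> < \<tau>" "\<sigma> \<in> {a..b}" "\<tau> \<in> {a..b}" for \<sigma> \<tau>
    proof -
      have "cmod (v x \<tau> - v x \<sigma>) \<le> C * ?B * \<tau> - C * ?B * \<sigma>"
      proof (rule differentiable_bound_general[where f' = "D x" and \<phi>' = "\<lambda>_. C * ?B"])
        show "continuous_on {\<sigma>..\<tau>} (v x)"
          using cont[OF Suc.prems(1)] that \<open>0 \<le> a\<close> by (auto elim: continuous_on_subset)
        show "(v x has_vector_derivative D x s) (at s)" if "\<sigma> < s" "s < \<tau>" for s
          using der[OF Suc.prems(1)] that \<open>\<sigma> \<in> _\<close> \<open>0 \<le> a\<close> by auto
        show "cmod (D x s) \<le> C * ?B" if "\<sigma> < s" "s < \<tau>" for s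
          using that \<open>\<sigma> \<in> _\<close> \<open>\<tau> \<in> _\<close> \<open>0 \<le> a\<close> Suc.prems(1)
          by (intro gen Suc.IH) auto
      qed (use that in \<open>auto intro!: continuous_intros derivative_eq_intros simp: has_real_derivative_iff_has_vector_derivative[symmetric]\<close>)
      also have "\<dots> = C * (\<tau> - \<sigma>) * ?B" by (simp only: right_diff_distrib left_diff_distrib mult_ac)
      also have "\<dots> \<le> (1/2) * ?B"
        using len that \<open>C \<ge> 0\<close>
        by (intro mult_right_mono B0 order_trans[OF _ len] mult_left_mono) auto
      finally show ?thesis by simp
    qed
    have "cmod (v x t - v x p) \<le> ?B / 2"
    proof (cases t p rule: linorder_cases)
      case less then show ?thesis using step[OF less] p(1) Suc.prems by (simp add: norm_minus_commute)
    next
      case greater then show ?thesis using step[OF greater] p(1) Suc.prems by simp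
    qed (use B0 in simp)
    then have "cmod (v x t) \<le> N + ?B / 2"
      using p(2)[OF Suc.prems(1)] norm_triangle_ineq[of "v x t - v x p" "v x p"] by (simp only: diff_add_cancel)
    also have "N + ?B / 2 = 2 * N + B / 2 ^ Suc n" by (simp add: add_divide_distrib)
    finally show ?case .
  qed
  have "(\<lambda>n. 2 * N + B * (1/2) ^ n) \<longlonglongrightarrow> 2 * N + B * 0"
    by (intro tendsto_intros LIMSEQ_power_zero) auto
  then have "cmod (v x t) \<le> 2 * N + B * 0"
    using iter[OF \<open>x \<in> X\<close> \<open>t \<in> {a..b}\<close>] by (intro LIMSEQ_le_const) (auto simp: power_divide)
  then show ?thesis by simp
qed

text \<open>Boundedness near t jointly in time and in the points of X, the uniformity that the
  hypotheses on the Green function do not state.\<close>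

definition bdd_near :: "'a set \<Rightarrow> ('a \<Rightarrow> real \<Rightarrow> complex) \<Rightarrow> real \<Rightarrow> bool" where
  "bdd_near X v t \<longleftrightarrow> (\<exists>r>0. \<exists>B. \<forall>s\<ge>0. \<bar>s - t\<bar> < r \<longrightarrow> (\<forall>x\<in>X. cmod (v x s) \<le> B))"

lemma bdd_near_compact:
  assumes "0 \<le> a" "\<And>t. t \<in> {a..b} \<Longrightarrow> bdd_near X v t"
  shows "\<exists>B. \<forall>x\<in>X. \<forall>t\<in>{a..b}. cmod (v x t) \<le> B"
proof -
  have "\<forall>t\<in>{a..b}. \<exists>r B. r > 0 \<and> (\<forall>s\<ge>0. \<bar>s - t\<bar> < r \<longrightarrow> (\<forall>x\<in>X. cmod (v x s) \<le> B))"
    using assms(2) unfolding bdd_near_def by blast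
  then obtain r B where r: "\<And>t. t \<in> {a..b} \<Longrightarrow> r t > 0"
    and rB: "\<And>t s x. t \<in> {a..b} \<Longrightarrow> s \<ge> 0 \<Longrightarrow> \<bar>s - t\<bar> < r t \<Longrightarrow> x \<in> X \<Longrightarrow> cmod (v x s) \<le> B t"
    by metis
  define U where "U = (\<lambda>t. ball t (r t))"
  have U: "t \<in> U t" "open (U t)" if "t \<in> {a..b}" for t
    using r[OF that] by (auto simp: U_def)
  have "compact {a..b}" by simp
  then obtain D where D: "D \<subseteq> {a..b}" "finite D" "{a..b} \<subseteq> (\<Union>t\<in>D. U t)"
    by (rule compactE_image[of "{a..b}" "{a..b}" U]) (use U in auto)
  have B: "cmod (v x s) \<le> B t" if "t \<in> D" "s \<in> U t" "s \<ge> 0" "x \<in> X" for t s x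
    using that D(1) by (intro rB) (auto simp: U_def dist_real_def abs_minus_commute)
  have "cmod (v x s) \<le> (\<Sum>t\<in>D. \<bar>B t\<bar>)" if "x \<in> X" "s \<in> {a..b}" for x s
  proof -
    obtain t where t: "t \<in> D" "s \<in> U t" using D(3) \<open>s \<in> {a..b}\<close> by auto
    have "cmod (v x s) \<le> B t" using B[OF t _ \<open>x \<in> X\<close>] that assms(1) by auto
    also have "\<dots> \<le> \<bar>B t\<bar>" by simp
    also have "\<dots> \<le> (\<Sum>t\<in>D. \<bar>B t\<bar>)" by (rule member_le_sum) (use t D in auto)
    finally show ?thesis .
  qed
  then show ?thesis by blast
qed

text \<open>Only a bound for each single time is assumed. By Baire's theorem the set \<open>F\<close> of times near
  which the solution is unbounded has, if nonempty, a relatively open part on which one bound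
  holds. The gaps of \<open>F\<close> are then controlled from their endpoints, which contradicts
  the definition of \<open>F\<close>.\<close>

lemma bounded_generator_unique:
  fixes v D :: "'a \<Rightarrow> real \<Rightarrow> complex"
  assumes cont: "\<And>x. x \<in> X \<Longrightarrow> continuous_on {0..} (v x)"
    and der: "\<And>x t. x \<in> X \<Longrightarrow> t > 0 \<Longrightarrow> (v x has_vector_derivative D x t) (at t)"
    and gen: "\<And>t B x. t > 0 \<Longrightarrow> (\<And>z. z \<in> X \<Longrightarrow> cmod (v z t) \<le> B) \<Longrightarrow> x \<in> X \<Longrightarrow> cmod (D x t) \<le> C * B"
    and C: "C > 0"
    and bdd: "\<And>t. t \<ge> 0 \<Longrightarrow> \<exists>B. \<forall>x\<in>X. cmod (v x t) \<le> B"
    and init: "\<And>x. x \<in> X \<Longrightarrow> v x 0 = 0"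
    and "x \<in> X" "t \<ge> 0"
  shows "v x t = 0"
proof -
  define F where "F = {t. t \<ge> 0 \<and> \<not> bdd_near X v t}"
  \<comment> \<open>C h = 1/2, the length allowed by \<open>short_interval_bound\<close>.\<close>
  define h where "h = 1 / (2 * C)"
  have h: "h > 0" using C by (simp add: h_def)
  have lenh: "C * (b - a) \<le> 1/2" if "b - a \<le> h" for a b
    using that C by (simp add: h_def field_simps)
  have short: "cmod (v x t) \<le> 2 * N"
    if "0 \<le> a" "b - a \<le> h" "\<forall>x\<in>X. \<forall>t\<in>{a..b}. cmod (v x t) \<le> B"
      "p \<in> {a..b}" "\<forall>x\<in>X. cmod (v x p) \<le> N" "x \<in> X" "t \<in> {a..b}" for a b B p N x t
    by (rule short_interval_bound[of X v D C a b B p N]) (use cont der gen C lenh that in auto)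
  have "open {t. bdd_near X v t}"
    unfolding open_dist
  proof (intro ballI)
    fix t assume "t \<in> {t. bdd_near X v t}"
    then obtain r B where r: "r > 0" "\<forall>s\<ge>0. \<bar>s - t\<bar> < r \<longrightarrow> (\<forall>x\<in>X. cmod (v x s) \<le> B)"
      by (auto simp: bdd_near_def)
    have "bdd_near X v t'" if "dist t' t < r/2" for t'
    proof -
      have "\<bar>s - t\<bar> < r" if "\<bar>s - t'\<bar> < r/2" for s
        using that \<open>dist t' t < r/2\<close> unfolding dist_real_def by linarith
      then show ?thesis unfolding bdd_near_def using r
        by (intro exI[of _ "r/2"]) auto
    qed
    then show "\<exists>e>0. \<forall>y. dist y t < e \<longrightarrow> y \<in> {t. bdd_near X v t}"
      using r(1) by (intro exI[of _ "r/2"]) auto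
  qed
  then have "closed ({0..} - {t. bdd_near X v t})" by (intro closed_Diff) auto
  also have "{0..} - {t. bdd_near X v t} = F" by (auto simp: F_def)
  finally have clF: "closed F" .
  have "F = {}"
  proof (rule ccontr)
    assume "F \<noteq> {}"
    \<comment> \<open>The times in F at which the bound n fails; relatively open by continuity of
      each \<open>v x\<close>. If all of them were dense in F, so would be their intersection by
      Baire, but it is empty because every single time has some bound.\<close>
    define S where "S = (\<lambda>n::nat. {t\<in>F. \<exists>x\<in>X. cmod (v x t) > n})"
    have op: "openin (top_of_set F) (S n)" for n
    proof -
      have "closedin (top_of_set F) {t\<in>F. v x t \<in> cball 0 (real n)}" if "x \<in> X" for x
        using cont[OF that] by (intro continuous_closedin_preimage[unfolded vimage_def Int_def, simplified])
          (auto simp: F_def elim: continuous_on_subset)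
      then have "openin (top_of_set F) (F - {t\<in>F. v x t \<in> cball 0 (real n)})" if "x \<in> X" for x
        using that by (intro openin_diff) auto
      then have "openin (top_of_set F) (\<Union>x\<in>X. F - {t\<in>F. v x t \<in> cball 0 (real n)})"
        by (intro openin_Union) auto
      also have "(\<Union>x\<in>X. F - {t\<in>F. v x t \<in> cball 0 (real n)}) = S n"
        by (force simp: S_def not_le)
      finally show ?thesis .
    qed
    have "\<exists>n. \<not> F \<subseteq> closure (S n)"
    proof (rule ccontr)
      assume "\<nexists>n. \<not> F \<subseteq> closure (S n)"
      then have "F \<subseteq> closure (\<Inter> (range S))"
        using clF op by (intro Baire) auto
      moreover have "\<Inter> (range S) = {}"
      proof -
        have False if t: "\<And>n. t \<in> S n" for t
        proof -
          from t[of 0] have "t \<ge> 0" by (auto simp: S_def F_def)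
          then obtain B where B: "\<forall>x\<in>X. cmod (v x t) \<le> B" using bdd by blast
          obtain n :: nat where "B \<le> n" using real_arch_simple by blast
          with t[of n] B show False by (force simp: S_def)
        qed
        then show ?thesis by blast
      qed
      ultimately show False using \<open>F \<noteq> {}\<close> by simp
    qed
    then obtain n t0 where t0: "t0 \<in> F" "t0 \<notin> closure (S n)" by blast
    then obtain r0 where r0: "r0 > 0" "\<And>t. dist t t0 < r0 \<Longrightarrow> t \<notin> S n"
      by (auto simp: closure_approachable)
    \<comment> \<open>r \<le> h makes every interval between t0 and a time within r of it short
      enough for \<open>short\<close>.\<close>
    define r where "r = min r0 h"
    have r: "r > 0" "r \<le> r0" "r \<le> h" using r0 h by (auto simp: r_def)
    have t00: "t0 \<ge> 0" using t0(1) by (simp add: F_def)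
    have onF: "cmod (v x t) \<le> n" if "x \<in> X" "t \<in> F" "\<bar>t - t0\<bar> < r" for x t
      using r0(2)[of t] that r by (force simp: S_def dist_real_def)
    \<comment> \<open>p is the endpoint in F, t the other one. For s \<noteq> p the interval between
      s and t avoids F, so a bound N at time t gives 2 N at s, independently of how close s is to p.
      With the bound n at p itself the solution is bounded on all of [a, b], and a second
      application, now started from p, replaces that bound by 2 n, in which N no longer
      occurs.\<close>
    have gap: "cmod (v x t) \<le> 2 * n"
      if "a \<ge> 0" "a \<le> b" "b - a \<le> h" "p \<in> {a,b}" "p \<in> F" "\<bar>p - t0\<bar> < r"
        "t \<in> {a,b}" "p \<noteq> t" and free: "\<And>s. s \<in> {a..b} \<Longrightarrow> s \<noteq> p \<Longrightarrow> s \<notin> F"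
        and x: "x \<in> X" for a b p t x
    proof -
      have t: "t \<ge> 0" "t \<in> {a..b}" "p \<ge> 0" "p \<in> {a..b}" using that by auto
      obtain N where N: "\<And>x. x \<in> X \<Longrightarrow> cmod (v x t) \<le> N" using bdd t by blast
      have "cmod (v x s) \<le> 2 * N" if x: "x \<in> X" and s: "s \<in> {a..b}" "s \<noteq> p" for x s
      proof -
        define a' b' where "a' = min s t" and "b' = max s t"
        have ab: "a' \<ge> a" "b' \<le> b" "s \<in> {a'..b'}" "t \<in> {a'..b'}" "p \<notin> {a'..b'}"
          using s t that \<open>p \<in> {a,b}\<close> \<open>t \<in> {a,b}\<close> \<open>p \<noteq> t\<close> by (auto simp: a'_def b'_def)
        have "bdd_near X v \<tau>" if "\<tau> \<in> {a'..b'}" for \<tau>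
          using free[of \<tau>] that ab \<open>a \<ge> 0\<close> by (fastforce simp: F_def)
        then obtain B where B: "\<forall>x\<in>X. \<forall>t\<in>{a'..b'}. cmod (v x t) \<le> B"
          using bdd_near_compact[of a' b' X v] ab \<open>a \<ge> 0\<close> by auto
        show ?thesis
          by (rule short[OF _ _ B ab(4) _ x ab(3)]) (use ab N \<open>a \<ge> 0\<close> \<open>b - a \<le> h\<close> in auto)
      qed
      then have "cmod (v x s) \<le> max (2 * N) n" if "x \<in> X" "s \<in> {a..b}" for x s
        using that onF[of x p] \<open>p \<in> F\<close> \<open>\<bar>p - t0\<bar> < r\<close> by (cases "s = p") (force simp: le_max_iff_disj)+
      then have "cmod (v x t) \<le> 2 * real n"
        using onF \<open>p \<in> F\<close> \<open>\<bar>p - t0\<bar> < r\<close> that t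
        by (intro short[where a = a and b = b and p = p and B = "max (2 * N) n"]) auto
      then show "cmod (v x t) \<le> 2 * n" by simp
    qed
    have "cmod (v x t) \<le> 2 * n" if "x \<in> X" "t \<ge> 0" "\<bar>t - t0\<bar> < r" for x t
    proof (cases "t \<in> F")
      case True then show ?thesis using onF[OF that(1) True that(3)] by simp
    next
      case False
      then have "t \<noteq> t0" using t0 by auto
      then consider "t0 < t" | "t < t0" by linarith
      then show ?thesis
      proof cases
        case 1
        \<comment> \<open>The last time of F between t0 and t. It lies within r of t0, so the bound
          n holds there, and (a, t] is free of F.\<close>
        define a where "a = Sup (F \<inter> {t0..t})"
        have ne: "F \<inter> {t0..t} \<noteq> {}" "bdd_above (F \<inter> {t0..t})" using t0 1 by auto
        have "a \<in> F \<inter> {t0..t}" unfolding a_def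
          using clF ne by (intro closed_contains_Sup) auto
        moreover have "s \<notin> F" if "s \<in> {a..t}" "s \<noteq> a" for s
        proof
          assume "s \<in> F"
          then have "s \<le> a" unfolding a_def using that \<open>a \<in> F \<inter> _\<close> ne by (intro cSup_upper) auto
          then show False using that by auto
        qed
        ultimately show ?thesis using False that 1 r t00
          by (intro gap[of a t a t x]) auto
      next
        case 2
        define b where "b = Inf (F \<inter> {t..t0})"
        have ne: "F \<inter> {t..t0} \<noteq> {}" "bdd_below (F \<inter> {t..t0})" using t0 2 by auto
        have "b \<in> F \<inter> {t..t0}" unfolding b_def
          using clF ne by (intro closed_contains_Inf) auto
        moreover have "s \<notin> F" if "s \<in> {t..b}" "s \<noteq> b" for s
        proof
          assume "s \<in> F"
          then have "b \<le> s" unfolding b_def using that \<open>b \<in> F \<inter> _\<close> ne by (intro cInf_lower) auto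
          then show False using that by auto
        qed
        ultimately show ?thesis using False that 2 r t00
          by (intro gap[of t b b t x]) auto
      qed
    qed
    then have "bdd_near X v t0" unfolding bdd_near_def using r(1) by blast
    then show False using t0(1) by (simp add: F_def)
  qed
  then have near: "bdd_near X v t" if "t \<ge> 0" for t using that by (auto simp: F_def)
  \<comment> \<open>Now that boundedness is locally uniform, each interval of length h propagates
    the value 0: the bound 2 N is applied with N = 0 at the left endpoint.\<close>
  have zero: "v x t = 0" if "x \<in> X" "0 \<le> t" "t \<le> real n * h" for n x t
    using that
  proof (induction n arbitrary: x t)
    case 0 then show ?case using init by simp
  next
    case (Suc n)
    show ?case
    proof (cases "t \<le> real n * h")
      case True then show ?thesis using Suc by simp
    next
      case False
      let ?a = "real n * h"
      have a0: "?a \<ge> 0" using h by simp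
      obtain B where B: "\<forall>x\<in>X. \<forall>s\<in>{?a..t}. cmod (v x s) \<le> B"
        using bdd_near_compact[of ?a t X v] near a0 by auto
      have "cmod (v x t) \<le> 2 * 0"
        by (rule short[OF a0 _ B, of ?a]) (use Suc False a0 in \<open>auto simp: algebra_simps\<close>)
      then show ?thesis by simp
    qed
  qed
  obtain n :: nat where "t / h \<le> n" using real_arch_simple by blast
  then show ?thesis using zero[of x t n] assms h by (simp add: field_simps)
qed

section \<open>The discrete Green function\<close>

lemma prod_UNIV_sum: "(\<Prod>i\<in>UNIV. F i) = (\<Prod>k\<in>(UNIV::'n::finite set). F (Inl k) * F (Inr k :: 'n + 'n))"
  unfolding UNIV_Plus_UNIV[symmetric] by (subst prod.Plus) (auto simp: prod.distrib)

text \<open>A map that intertwines two operator families intertwines all their multi-index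
  powers.\<close>

lemma mi_op_commute:
  assumes "\<And>i f. T i (h f) = h (T' i f)"
  shows "mi_op T \<nu> (h f) = h (mi_op T' \<nu> f)"
proof -
  have "(T i ^^ k) (h f) = h ((T' i ^^ k) f)" for i k f
    by (induction k) (auto simp: assms)
  then have "foldr (\<lambda>i. T i ^^ \<nu> i) xs (h f) = h (foldr (\<lambda>i. T' i ^^ \<nu> i) xs f)" for xs
    by (induction xs) auto
  then show ?thesis by (simp add: mi_op_def)
qed

lemma mi_op_delta_diff:
  "mi_op (delta \<epsilon>) \<nu> (\<lambda>z. f z - g z) x = mi_op (delta \<epsilon>) \<nu> f x - mi_op (delta \<epsilon>) \<nu> g x"
proof -
  \<comment> \<open>Additivity by acting on pairs: subtraction and both projections intertwine the
    action on pairs with the action on functions.\<close>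
  let ?T = "\<lambda>i (f, g). (delta \<epsilon> i f, delta \<epsilon> i g)"
  have "mi_op (delta \<epsilon>) \<nu> ((\<lambda>(f, g) z. f z - g z) (f, g)) = (\<lambda>(f, g) z. f z - g z) (mi_op ?T \<nu> (f, g))"
  proof (rule mi_op_commute)
    show "delta \<epsilon> i (case p of (f, g) \<Rightarrow> \<lambda>z. f z - g z) = (case ?T i p of (f, g) \<Rightarrow> \<lambda>z. f z - g z)" for i p
      by (cases i; cases p) (simp_all add: fun_eq_iff)
  qed
  moreover have "mi_op (delta \<epsilon>) \<nu> (fst (f, g)) = fst (mi_op ?T \<nu> (f, g))"
    by (rule mi_op_commute) (auto split: prod.splits)
  moreover have "mi_op (delta \<epsilon>) \<nu> (snd (f, g)) = snd (mi_op ?T \<nu> (f, g))"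
    by (rule mi_op_commute) (auto split: prod.splits)
  ultimately show ?thesis by (simp add: case_prod_unfold)
qed

lemma discr_op_diff:
  "discr_op l L a \<epsilon> (\<lambda>z. f z - g z) x = discr_op l L a \<epsilon> f x - discr_op l L a \<epsilon> g x"
  by (simp add: discr_op_def mi_op_delta_diff sum_subtractf diff_divide_distrib right_diff_distrib)

lemma lattice_shift:
  assumes "x \<in> lattice \<epsilon>"
  shows "x + \<epsilon> *\<^sub>R axis k 1 \<in> lattice \<epsilon>" "x - \<epsilon> *\<^sub>R axis k 1 \<in> lattice \<epsilon>"
proof -
  have "\<exists>m::int. (x + of_int s *\<^sub>R (\<epsilon> *\<^sub>R axis k 1)) $ i = \<epsilon> * of_int m" for s i
  proof -
    obtain m :: int where "x $ i = \<epsilon> * of_int m" using assms by (auto simp: lattice_def)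
    then show ?thesis
      by (intro exI[of _ "m + (if i = k then s else 0)"]) (auto simp: axis_def algebra_simps)
  qed
  from this[of 1] this[of "-1"] show "x + \<epsilon> *\<^sub>R axis k 1 \<in> lattice \<epsilon>" "x - \<epsilon> *\<^sub>R axis k 1 \<in> lattice \<epsilon>"
    by (auto simp: lattice_def)
qed

lemma discr_op_bound:
  fixes a :: "('n::finite + 'n \<Rightarrow> nat) \<Rightarrow> complex"
  assumes "\<epsilon> > 0"
  obtains C where "C > 0" "\<And>f B x. (\<And>z. z \<in> lattice \<epsilon> \<Longrightarrow> cmod (f z) \<le> B) \<Longrightarrow> x \<in> lattice \<epsilon> \<Longrightarrow>
    cmod (discr_op l L a \<epsilon> f x) \<le> C * B"
proof -
  let ?N = "{\<nu>. l \<le> mi_abs \<nu> \<and> mi_abs \<nu> \<le> L}"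
  define S where "S = (\<Sum>\<nu>\<in>?N. cmod (a \<nu>) * 2 ^ mi_abs \<nu>)"
  \<comment> \<open>S counts a factor 2 for every difference. The summand 1 makes the constant
    positive even if all coefficients vanish, since \<open>bounded_generator_unique\<close> divides
    by it.\<close>
  show thesis
  proof (rule that[of "S / \<epsilon> ^ l + 1"])
    show "0 < S / \<epsilon> ^ l + 1"
      using assms by (auto simp: S_def intro!: add_nonneg_pos divide_nonneg_pos sum_nonneg)
    fix f :: "real^'n \<Rightarrow> complex" and B and x :: "real^'n"
    assume f: "\<And>z. z \<in> lattice \<epsilon> \<Longrightarrow> cmod (f z) \<le> B" and x: "x \<in> lattice \<epsilon>"
    have B: "B \<ge> 0" using f[OF x] norm_ge_zero order_trans by blast
    have op: "cmod (mi_op (delta \<epsilon>) \<nu> f x) \<le> 2 ^ mi_abs \<nu> * B" for \<nu>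
    proof -
      have "\<forall>z\<in>lattice \<epsilon>. cmod (mi_op (delta \<epsilon>) \<nu> f z) \<le> 2 ^ (0 + mi_abs \<nu>) * B"
      proof (rule mi_op_invariant[where P = "\<lambda>n f. \<forall>z\<in>lattice \<epsilon>. cmod (f z) \<le> 2 ^ n * B"])
        fix i n and g :: "real^'n \<Rightarrow> complex"
        assume g: "\<forall>z\<in>lattice \<epsilon>. cmod (g z) \<le> 2 ^ n * B"
        have tri: "cmod (g z' - g z) \<le> 2 ^ Suc n * B" if "z \<in> lattice \<epsilon>" "z' \<in> lattice \<epsilon>" for z z'
        proof -
          have "cmod (g z' - g z) \<le> 2 ^ n * B + 2 ^ n * B"
            using g that by (intro order_trans[OF norm_triangle_ineq4] add_mono) auto
          also have "2 ^ n * B + 2 ^ n * B = 2 ^ Suc n * B" by simp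
          finally show ?thesis .
        qed
        then show "\<forall>z\<in>lattice \<epsilon>. cmod (delta \<epsilon> i g z) \<le> 2 ^ Suc n * B"
          by (cases i) (simp_all add: lattice_shift del: power_Suc)
      qed (use f in simp)
      then show ?thesis using x by simp
    qed
    have "cmod (\<Sum>\<nu>\<in>?N. a \<nu> * mi_op (delta \<epsilon>) \<nu> f x) \<le> (\<Sum>\<nu>\<in>?N. cmod (a \<nu>) * (2 ^ mi_abs \<nu> * B))"
      by (rule sum_norm_le) (auto simp: norm_mult intro!: mult_left_mono op)
    also have "\<dots> = S * B" by (simp add: S_def sum_distrib_right mult.assoc)
    finally have "cmod (discr_op l L a \<epsilon> f x) \<le> S * B / \<epsilon> ^ l"
      using assms by (simp add: discr_op_def norm_divide norm_power divide_right_mono)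
    then show "cmod (discr_op l L a \<epsilon> f x) \<le> (S / \<epsilon> ^ l + 1) * B"
      using B by (simp add: algebra_simps)
  qed
qed

lemma continuous_discr_symbol: "continuous_on UNIV (discr_symbol l L a)"
  unfolding discr_symbol_def [abs_def] by (intro continuous_intros)

section \<open>Fourier integrals over the cube for lattice functions\<close>

definition pi_box :: "(real ^ 'n::finite) set" where
  "pi_box = {\<theta>. \<forall>i. \<bar>\<theta> $ i\<bar> \<le> pi}"

lemma pi_box_cbox: "pi_box = cbox (\<chi> i. - pi) (\<chi> i. pi)"
  by (auto simp: pi_box_def mem_box_cart abs_le_iff minus_le_iff)

lemma compact_pi_box: "compact pi_box"
  by (simp add: pi_box_cbox)

text \<open>The inversion integral over the cube of half-width pi / \<epsilon> after \<theta> =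
  \<epsilon> \<eta>: the domain no longer depends on \<epsilon>, and the Jacobian turns (2 pi)^d
  into (2 pi \<epsilon>)^d.\<close>

definition wave :: "(real ^ 'n::finite \<Rightarrow> complex) \<Rightarrow> real \<Rightarrow> real ^ 'n \<Rightarrow> complex" where
  "wave g \<epsilon> x = (LINT \<theta>|lborel. indicator pi_box \<theta> *\<^sub>R (g \<theta> * cis ((x \<bullet> \<theta>) / \<epsilon>))) /
     complex_of_real ((2 * pi * \<epsilon>) ^ CARD('n))"

lemma continuous_wave:
  assumes "continuous_on UNIV g" "\<epsilon> > 0"
  shows "continuous_on S (\<lambda>\<theta>. g \<theta> * cis ((x \<bullet> \<theta>) / \<epsilon>))"
  using assms by (intro continuous_intros continuous_on_subset[OF assms(1)]) auto

lemma wave_integrable: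
  assumes "continuous_on UNIV g" "\<epsilon> > 0"
  shows "integrable lborel (\<lambda>\<theta>. indicator pi_box \<theta> *\<^sub>R (g \<theta> * cis ((x \<bullet> \<theta>) / \<epsilon>)))"
  by (intro borel_integrable_compact compact_pi_box continuous_wave assms)

lemma wave_sum:
  assumes "\<And>i. i \<in> S \<Longrightarrow> continuous_on UNIV (g i)" "\<epsilon> > 0"
  shows "(\<Sum>i\<in>S. c i * wave (g i) \<epsilon> x) = wave (\<lambda>\<theta>. \<Sum>i\<in>S. c i * g i \<theta>) \<epsilon> x"
proof -
  have "(LINT \<theta>|lborel. indicator pi_box \<theta> *\<^sub>R ((\<Sum>i\<in>S. c i * g i \<theta>) * cis ((x \<bullet> \<theta>) / \<epsilon>)))
      = (LINT \<theta>|lborel. (\<Sum>i\<in>S. c i * (indicator pi_box \<theta> *\<^sub>R (g i \<theta> * cis ((x \<bullet> \<theta>) / \<epsilon>)))))"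
    by (simp add: sum_distrib_right scaleR_sum_right mult.assoc)
  also have "\<dots> = (\<Sum>i\<in>S. LINT \<theta>|lborel. c i * (indicator pi_box \<theta> *\<^sub>R (g i \<theta> * cis ((x \<bullet> \<theta>) / \<epsilon>))))"
    by (intro Bochner_Integration.integral_sum integrable_mult_right wave_integrable assms)
  also have "\<dots> = (\<Sum>i\<in>S. c i * (LINT \<theta>|lborel. indicator pi_box \<theta> *\<^sub>R (g i \<theta> * cis ((x \<bullet> \<theta>) / \<epsilon>))))"
    by (simp only: integral_mult_right_zero)
  finally show ?thesis by (simp add: wave_def sum_divide_distrib)
qed

lemma wave_cmult: "c * wave g \<epsilon> x = wave (\<lambda>\<theta>. c * g \<theta>) \<epsilon> x"
proof -
  have "(LINT \<theta>|lborel. indicator pi_box \<theta> *\<^sub>R (c * g \<theta> * cis ((x \<bullet> \<theta>) / \<epsilon>)))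
      = (LINT \<theta>|lborel. c * (indicator pi_box \<theta> *\<^sub>R (g \<theta> * cis ((x \<bullet> \<theta>) / \<epsilon>))))"
    by (simp add: mult.assoc)
  also have "\<dots> = c * (LINT \<theta>|lborel. indicator pi_box \<theta> *\<^sub>R (g \<theta> * cis ((x \<bullet> \<theta>) / \<epsilon>)))"
    by (rule integral_mult_right_zero)
  finally show ?thesis by (simp add: wave_def)
qed

lemma wave_bounded:
  fixes g :: "real ^ 'n::finite \<Rightarrow> complex"
  assumes "continuous_on UNIV g" "\<epsilon> > 0"
  shows "\<exists>B. \<forall>x. cmod (wave g \<epsilon> x) \<le> B"
proof (intro exI allI)
  fix x :: "real^'n"
  have "cmod (LINT \<theta>|lborel. indicator pi_box \<theta> *\<^sub>R (g \<theta> * cis ((x \<bullet> \<theta>) / \<epsilon>)))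
      \<le> (LINT \<theta>|lborel. norm (indicator pi_box \<theta> *\<^sub>R (g \<theta> * cis ((x \<bullet> \<theta>) / \<epsilon>))))"
    by (rule integral_norm_bound)
  also have "\<dots> = (LINT \<theta>|lborel. indicator pi_box \<theta> * cmod (g \<theta>))"
    by (intro Bochner_Integration.integral_cong) (auto simp: norm_mult)
  finally show "cmod (wave g \<epsilon> x) \<le> (LINT \<theta>|lborel. indicator pi_box \<theta> * cmod (g \<theta>)) / (2 * pi * \<epsilon>) ^ CARD('n)"
    using \<open>\<epsilon> > 0\<close> by (simp add: wave_def norm_divide norm_power norm_mult divide_right_mono)
qed

primrec delta_symbol :: "'n + 'n \<Rightarrow> real ^ 'n::finite \<Rightarrow> complex" where
  "delta_symbol (Inl k) \<theta> = cis (- (\<theta> $ k)) - 1"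
| "delta_symbol (Inr k) \<theta> = cis (\<theta> $ k) - 1"

lemma wave_delta:
  fixes g :: "real ^ 'n::finite \<Rightarrow> complex"
  assumes "continuous_on UNIV g" "\<epsilon> > 0"
  shows "delta \<epsilon> i (wave g \<epsilon>) = wave (\<lambda>\<theta>. delta_symbol i \<theta> * g \<theta>) \<epsilon>"
proof
  fix x :: "real^'n"
  have *: "wave g \<epsilon> (x + (r * \<epsilon>) *\<^sub>R axis k 1) - wave g \<epsilon> x = wave (\<lambda>\<theta>. (cis (r * \<theta> $ k) - 1) * g \<theta>) \<epsilon> x" for r k
  proof -
    have "wave g \<epsilon> (x + (r * \<epsilon>) *\<^sub>R axis k 1) - wave g \<epsilon> x =
       (LINT \<theta>|lborel. indicator pi_box \<theta> *\<^sub>R (g \<theta> * cis (((x + (r * \<epsilon>) *\<^sub>R axis k 1) \<bullet> \<theta>) / \<epsilon>))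
         - indicator pi_box \<theta> *\<^sub>R (g \<theta> * cis ((x \<bullet> \<theta>) / \<epsilon>))) / complex_of_real ((2 * pi * \<epsilon>) ^ CARD('n))"
      unfolding wave_def diff_divide_distrib[symmetric]
      by (subst Bochner_Integration.integral_diff[OF wave_integrable[OF assms] wave_integrable[OF assms]]) simp
    also have "(\<lambda>\<theta>. indicator pi_box \<theta> *\<^sub>R (g \<theta> * cis (((x + (r * \<epsilon>) *\<^sub>R axis k 1) \<bullet> \<theta>) / \<epsilon>))
         - indicator pi_box \<theta> *\<^sub>R (g \<theta> * cis ((x \<bullet> \<theta>) / \<epsilon>)))
       = (\<lambda>\<theta>. indicator pi_box \<theta> *\<^sub>R ((cis (r * \<theta> $ k) - 1) * g \<theta> * cis ((x \<bullet> \<theta>) / \<epsilon>)))"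
      using \<open>\<epsilon> > 0\<close>
      by (auto simp: fun_eq_iff inner_add_left inner_axis' add_divide_distrib cis_mult[symmetric]
          indicator_def algebra_simps)
    finally show ?thesis by (simp add: wave_def)
  qed
  show "delta \<epsilon> i (wave g \<epsilon>) x = wave (\<lambda>\<theta>. delta_symbol i \<theta> * g \<theta>) \<epsilon> x"
    using *[of 1] *[of "-1"] by (cases i) simp_all
qed

lemma wave_discr_op:
  fixes g :: "real ^ 'n::finite \<Rightarrow> complex"
  assumes "continuous_on UNIV g" "\<epsilon> > 0"
  shows "discr_op l L a \<epsilon> (wave g \<epsilon>) x = wave (\<lambda>\<theta>. discr_symbol l L a \<theta> / of_real (\<epsilon> ^ l) * g \<theta>) \<epsilon> x"
proof -
  let ?P = "\<lambda>\<nu> \<theta>. \<Prod>k\<in>UNIV. (cis (- (\<theta> $ k)) - 1) ^ \<nu> (Inl k) * (cis (\<theta> $ k) - 1) ^ \<nu> (Inr k)"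
  have cont: "continuous_on UNIV (\<lambda>\<theta>. delta_symbol i \<theta> * h \<theta>)" if "continuous_on UNIV h" for i h
    using that by (cases i) (auto intro!: continuous_intros)
  have mop: "continuous_on UNIV (\<lambda>\<theta>. ?P \<nu> \<theta> * g \<theta>)"
    "mi_op (delta \<epsilon>) \<nu> (wave g \<epsilon>) = wave (\<lambda>\<theta>. ?P \<nu> \<theta> * g \<theta>) \<epsilon>" for \<nu>
    using mi_op_multiplier[where P = "continuous_on UNIV" and \<Phi> = "\<lambda>g. wave g \<epsilon>" and T = "delta \<epsilon>",
        OF cont wave_delta[OF _ \<open>\<epsilon> > 0\<close>] assms(1), of \<nu>]
    by (simp_all add: prod_UNIV_sum)
  have "discr_op l L a \<epsilon> (wave g \<epsilon>) x = inverse (of_real (\<epsilon> ^ l)) *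
      (\<Sum>\<nu> | l \<le> mi_abs \<nu> \<and> mi_abs \<nu> \<le> L. a \<nu> * wave (\<lambda>\<theta>. ?P \<nu> \<theta> * g \<theta>) \<epsilon> x)"
    by (simp add: discr_op_def mop divide_inverse mult.commute)
  also have "\<dots> = wave (\<lambda>\<theta>. inverse (of_real (\<epsilon> ^ l)) *
      (\<Sum>\<nu> | l \<le> mi_abs \<nu> \<and> mi_abs \<nu> \<le> L. a \<nu> * (?P \<nu> \<theta> * g \<theta>))) \<epsilon> x"
    by (subst wave_sum[OF mop(1) \<open>\<epsilon> > 0\<close>]) (rule wave_cmult)
  also have "(\<lambda>\<theta>. inverse (of_real (\<epsilon> ^ l)) * (\<Sum>\<nu> | l \<le> mi_abs \<nu> \<and> mi_abs \<nu> \<le> L. a \<nu> * (?P \<nu> \<theta> * g \<theta>)))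
      = (\<lambda>\<theta>. discr_symbol l L a \<theta> / of_real (\<epsilon> ^ l) * g \<theta>)"
    by (simp add: fun_eq_iff discr_symbol_def sum_distrib_right sum_distrib_left divide_inverse mult_ac)
  finally show ?thesis .
qed

lemma integral_cis_int:
  "(LINT \<theta>|lborel. indicator {-pi..pi} \<theta> *\<^sub>R cis (\<theta> * of_int m)) = (if m = 0 then complex_of_real (2 * pi) else 0)"
proof (cases "m = 0")
  case True
  then show ?thesis by (simp add: scaleR_conv_of_real)
next
  case False
  have "(LINT \<theta>|lborel. indicator {-pi..pi} \<theta> *\<^sub>R cis (\<theta> * of_int m))
     = cis (pi * of_int m) / (\<i> * of_int m) - cis (- pi * of_int m) / (\<i> * of_int m)"
  proof (rule integral_FTC_atLeastAtMost)
    fix \<theta>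
    have "((\<lambda>\<theta>. cis (\<theta> * of_int m) / (\<i> * of_int m)) has_vector_derivative
        \<i> * of_real (of_int m) * cis (\<theta> * of_int m) / (\<i> * of_int m)) (at \<theta> within {-pi..pi})"
      by (intro has_vector_derivative_divide has_vector_derivative_cis)
    then show "((\<lambda>\<theta>. cis (\<theta> * of_int m) / (\<i> * of_int m)) has_vector_derivative cis (\<theta> * of_int m)) (at \<theta> within {-pi..pi})"
      using False by simp
  qed (auto intro!: continuous_intros)
  also have "cis (- pi * of_int m) = cis (pi * of_int m)"
  proof -
    have "cis (pi * of_int m) = cis (- pi * of_int m) * cis (2 * pi * of_int m)"
      by (simp only: cis_mult) simp
    moreover have "cis (2 * pi * of_int m) = 1" by (rule cis_multiple_2pi) auto
    ultimately show ?thesis by (simp only: mult_1_right minus_mult_left)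
  qed
  finally show ?thesis using False by simp
qed

text \<open>The initial condition. On the lattice x / \<epsilon> is an integer vector, so the
  integral factors into one-dimensional ones and orthogonality of the exponentials leaves only x =
  0.\<close>

lemma wave_one_lattice:
  fixes x :: "real ^ 'n::finite"
  assumes "x \<in> lattice \<epsilon>" "\<epsilon> > 0"
  shows "wave (\<lambda>_. 1) \<epsilon> x = (if x = 0 then complex_of_real (1 / \<epsilon> ^ CARD('n)) else 0)"
proof -
  obtain m :: "'n \<Rightarrow> int" where m: "\<And>i. x $ i = \<epsilon> * of_int (m i)"
    using assms(1) unfolding lattice_def mem_Collect_eq by metis
  define f where "f = (\<lambda>(k::'n) \<theta>. indicator {-pi..pi} \<theta> *\<^sub>R cis (\<theta> * of_int (m k)))"
  have "indicator pi_box \<theta> *\<^sub>R (1 * cis ((x \<bullet> \<theta>) / \<epsilon>)) = (\<Prod>k\<in>UNIV. f k (\<theta> $ k))" for \<theta>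
  proof -
    have "(x \<bullet> \<theta>) / \<epsilon> = (\<Sum>k\<in>UNIV. \<theta> $ k * of_int (m k))"
      using \<open>\<epsilon> > 0\<close> by (simp add: inner_vec_def m sum_divide_distrib mult_ac)
    then have "cis ((x \<bullet> \<theta>) / \<epsilon>) = (\<Prod>k\<in>UNIV. cis (\<theta> $ k * of_int (m k)))"
      by (simp add: cis_conv_exp exp_sum sum_distrib_left)
    moreover have "(indicator pi_box \<theta> :: real) = (\<Prod>k\<in>UNIV. indicator {-pi..pi} (\<theta> $ k))"
    proof (cases "\<theta> \<in> pi_box")
      case True then show ?thesis by (auto simp: pi_box_def abs_le_iff minus_le_iff)
    next
      case False
      then obtain k where "\<not> \<bar>\<theta> $ k\<bar> \<le> pi" by (auto simp: pi_box_def)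
      then have "indicator {-pi..pi} (\<theta> $ k) = (0::real)" by (auto simp: indicator_def)
      then show ?thesis using False by (auto simp: prod_zero_iff)
    qed
    ultimately show ?thesis by (simp add: f_def scaleR_conv_of_real prod.distrib)
  qed
  moreover have "(LINT \<theta>|lborel. (\<Prod>k\<in>UNIV. f k (\<theta> $ k))) = (\<Prod>k\<in>UNIV. LINT \<theta>|lborel. f k \<theta>)"
    by (rule cart_integral_prod)
       (auto simp: f_def intro!: borel_integrable_compact continuous_intros)
  moreover have "(LINT \<theta>|lborel. f k \<theta>) = (if m k = 0 then complex_of_real (2 * pi) else 0)" for k
    by (simp only: f_def integral_cis_int)
  ultimately have w: "wave (\<lambda>_. 1) \<epsilon> x = (\<Prod>k\<in>UNIV. if m k = 0 then complex_of_real (2 * pi) else 0) / complex_of_real ((2 * pi * \<epsilon>) ^ CARD('n))"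
    by (simp add: wave_def)
  show ?thesis
  proof (cases "x = 0")
    case True
    then have "m k = 0" for k using m[of k] \<open>\<epsilon> > 0\<close> by simp
    then show ?thesis unfolding w using True \<open>\<epsilon> > 0\<close> by (simp add: power_mult_distrib)
  next
    case False
    then obtain k where "x $ k \<noteq> 0" by (auto simp: vec_eq_iff)
    then have "m k \<noteq> 0" using m[of k] by auto
    then have "(\<Prod>k\<in>UNIV. if m k = 0 then complex_of_real (2 * pi) else 0) = 0"
      by (auto simp: prod_zero_iff)
    then show ?thesis using False by (simp add: w)
  qed
qed

text \<open>The amplitude q is general so that the rule can be iterated, with q running through the
  powers of - A.\<close>

lemma wave_time_derivative:
  fixes q A :: "real ^ 'n::finite \<Rightarrow> complex"
  assumes q: "continuous_on UNIV q" and A: "continuous_on UNIV A" and "\<epsilon> > 0"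
  shows "((\<lambda>t. wave (\<lambda>\<theta>. q \<theta> * exp (- of_real t * A \<theta>)) \<epsilon> x) has_vector_derivative
    wave (\<lambda>\<theta>. (- A \<theta> * q \<theta>) * exp (- of_real t * A \<theta>)) \<epsilon> x) (at t)"
proof -
  let ?lo = "(\<chi> i. - pi) :: real^'n" and ?hi = "(\<chi> i. pi) :: real^'n"
  have c2: "continuous_on S (\<lambda>z. h (snd z))" if "continuous_on UNIV h" for h :: "real^'n \<Rightarrow> complex" and S :: "(real \<times> (real^'n)) set"
    by (rule continuous_on_compose2[OF that]) (auto intro!: continuous_intros)
  have W: "wave h \<epsilon> x = integral (cbox ?lo ?hi) (\<lambda>\<theta>. h \<theta> * cis ((x \<bullet> \<theta>) / \<epsilon>)) / complex_of_real ((2 * pi * \<epsilon>) ^ CARD('n))"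
    if "continuous_on UNIV h" for h
  proof -
    have "set_integrable lborel pi_box (\<lambda>\<theta>. h \<theta> * cis ((x \<bullet> \<theta>) / \<epsilon>))"
      unfolding set_integrable_def by (rule wave_integrable[OF that \<open>\<epsilon> > 0\<close>])
    from set_borel_integral_eq_integral(2)[OF this] show ?thesis
      by (simp add: wave_def set_lebesgue_integral_def pi_box_cbox)
  qed
  have "((\<lambda>t. integral (cbox ?lo ?hi) (\<lambda>\<theta>. q \<theta> * exp (- of_real t * A \<theta>) * cis ((x \<bullet> \<theta>) / \<epsilon>))) has_vector_derivative
     integral (cbox ?lo ?hi) (\<lambda>\<theta>. (- A \<theta> * q \<theta>) * exp (- of_real t * A \<theta>) * cis ((x \<bullet> \<theta>) / \<epsilon>))) (at t within UNIV)"
  proof (rule leibniz_rule_vector_derivative)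
    fix t :: real and \<theta> :: "real^'n"
    have "((\<lambda>s. exp ((- A \<theta>) * of_real s)) has_vector_derivative (- A \<theta>) * exp ((- A \<theta>) * of_real t)) (at t within UNIV)"
      by (rule has_vector_derivative_real_field) (auto intro!: derivative_eq_intros)
    then have "((\<lambda>s. (q \<theta> * cis ((x \<bullet> \<theta>) / \<epsilon>)) * exp ((- A \<theta>) * of_real s)) has_vector_derivative
        (q \<theta> * cis ((x \<bullet> \<theta>) / \<epsilon>)) * ((- A \<theta>) * exp ((- A \<theta>) * of_real t))) (at t within UNIV)"
      by (rule has_vector_derivative_mult_right)
    then show "((\<lambda>t. q \<theta> * exp (- of_real t * A \<theta>) * cis ((x \<bullet> \<theta>) / \<epsilon>)) has_vector_derivative
        (- A \<theta> * q \<theta>) * exp (- of_real t * A \<theta>) * cis ((x \<bullet> \<theta>) / \<epsilon>)) (at t within UNIV)"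
      by (simp add: mult_ac)
  next
    fix t :: real
    show "(\<lambda>\<theta>. q \<theta> * exp (- of_real t * A \<theta>) * cis ((x \<bullet> \<theta>) / \<epsilon>)) integrable_on cbox ?lo ?hi"
      by (intro integrable_continuous continuous_wave continuous_intros q A \<open>\<epsilon> > 0\<close>)
  next
    show "continuous_on (UNIV \<times> cbox ?lo ?hi)
        (\<lambda>(t, \<theta>). (- A \<theta> * q \<theta>) * exp (- of_real t * A \<theta>) * cis ((x \<bullet> \<theta>) / \<epsilon>))"
      unfolding split_beta using \<open>\<epsilon> > 0\<close> by (intro continuous_intros c2 q A) auto
  qed auto
  from has_vector_derivative_divide[OF this] show ?thesis
    by (subst W, (intro continuous_intros q A)[1])+ simp
qed

section \<open>Integral representation of the Green function and its time derivatives\<close>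

locale green_solution =
  fixes l L :: nat and a :: "('n::finite + 'n \<Rightarrow> nat) \<Rightarrow> complex" and \<epsilon> :: real
    and u :: "real ^ 'n \<Rightarrow> real \<Rightarrow> complex"
  assumes green: "first_Green l L a \<epsilon> u" and eps: "\<epsilon> > 0"
begin

definition A :: "real ^ 'n \<Rightarrow> complex" where
  "A \<theta> = discr_symbol l L a \<theta> / of_real (\<epsilon> ^ l)"

text \<open>The expected j-th time derivative of the Green function. The formula makes sense for
  every real t, so two-sided derivatives exist also at t = 0.\<close>

definition w :: "nat \<Rightarrow> real ^ 'n \<Rightarrow> real \<Rightarrow> complex" where
  "w j x t = wave (\<lambda>\<theta>. (- A \<theta>) ^ j * exp (- of_real t * A \<theta>)) \<epsilon> x"

lemma cont_A: "continuous_on UNIV A"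
  unfolding A_def [abs_def] using eps continuous_discr_symbol[of l L a] by (auto intro!: continuous_intros)

lemma w_deriv: "(w j x has_vector_derivative w (Suc j) x t) (at t)"
  using wave_time_derivative[OF _ cont_A eps, of "\<lambda>\<theta>. (- A \<theta>) ^ j" x t]
  by (simp add: w_def [abs_def] continuous_intros cont_A)

text \<open>The difference of the two solutions starts from 0 and evolves under
  \<open>discr_op\<close>, which is bounded in the sup norm over the lattice by
  \<open>discr_op_bound\<close>.\<close>

lemma u_eq_w0:
  assumes x: "x \<in> lattice \<epsilon>" and t: "t \<ge> 0"
  shows "u x t = w 0 x t"
proof -
  obtain C where C: "C > 0" "\<And>f B x. (\<And>z. z \<in> lattice \<epsilon> \<Longrightarrow> cmod (f z) \<le> B) \<Longrightarrow> x \<in> lattice \<epsilon> \<Longrightarrow>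
    cmod (discr_op l L a \<epsilon> f x) \<le> C * B"
    using discr_op_bound[OF eps] by blast
  define v where "v = (\<lambda>x t. u x t - w 0 x t)"
  have u_der: "(u x has_vector_derivative vector_derivative (u x) (at t)) (at t)" if "x \<in> lattice \<epsilon>" "t > 0" for x t
  proof -
    have "\<forall>x\<in>lattice \<epsilon>. \<exists>v. continuous_on {0..} v \<and> (\<forall>t\<ge>0. (u x has_vector_derivative v t) (at t within {0..}))"
      using green by (simp add: first_Green_def)
    from bspec[OF this that(1)] obtain d where "\<forall>t\<ge>0. (u x has_vector_derivative d t) (at t within {0..})"
      by (elim exE conjE)
    then have "(u x has_vector_derivative d t) (at t within {0..})" using that(2) by simp
    moreover have "at t within {0..} = at t" using that by (intro at_within_interior) simp
    ultimately show ?thesis by (metis vector_derivative_at)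
  qed
  have "v x t = 0"
  proof (rule bounded_generator_unique[where X = "lattice \<epsilon>" and D = "\<lambda>x t. - discr_op l L a \<epsilon> (\<lambda>z. v z t) x", OF _ _ _ C(1)])
    fix x :: "real^'n" assume x: "x \<in> lattice \<epsilon>"
    have "continuous_on {0..} (u x)"
      unfolding continuous_on_eq_continuous_within
      using green x unfolding first_Green_def by (meson atLeast_iff has_vector_derivative_continuous)
    moreover have "continuous_on {0..} (w 0 x)"
      by (meson w_deriv continuous_at_imp_continuous_on has_vector_derivative_continuous)
    ultimately show "continuous_on {0..} (v x)" unfolding v_def by (intro continuous_intros)
    fix t :: real assume t: "t > 0"
    have "w (Suc 0) x t = - discr_op l L a \<epsilon> (\<lambda>z. w 0 z t) x"
    proof -
      have "discr_op l L a \<epsilon> (wave (\<lambda>\<theta>. exp (- of_real t * A \<theta>)) \<epsilon>) x = wave (\<lambda>\<theta>. A \<theta> * exp (- of_real t * A \<theta>)) \<epsilon> x"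
        unfolding A_def using eps
        by (intro wave_discr_op continuous_intros continuous_discr_symbol) simp_all
      then show ?thesis
        using wave_cmult[of "-1" "\<lambda>\<theta>. A \<theta> * exp (- of_real t * A \<theta>)" \<epsilon> x] by (simp add: w_def)
    qed
    moreover have "vector_derivative (u x) (at t) = - discr_op l L a \<epsilon> (\<lambda>z. u z t) x"
      using green x t unfolding first_Green_def by (simp add: eq_neg_iff_add_eq_0)
    ultimately have "vector_derivative (u x) (at t) - w (Suc 0) x t = - discr_op l L a \<epsilon> (\<lambda>z. v z t) x"
      by (simp add: v_def discr_op_diff)
    then show "(v x has_vector_derivative - discr_op l L a \<epsilon> (\<lambda>z. v z t) x) (at t)"
      using has_vector_derivative_diff[OF u_der[OF x t] w_deriv[of 0 x t]] by (simp add: v_def [abs_def])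
  next
    fix t B and x :: "real^'n" assume "\<And>z. z \<in> lattice \<epsilon> \<Longrightarrow> cmod (v z t) \<le> B" "x \<in> lattice \<epsilon>"
    then show "cmod (- discr_op l L a \<epsilon> (\<lambda>z. v z t) x) \<le> C * B"
      using C(2)[of "\<lambda>z. v z t"] by simp
  next
    fix t :: real assume t: "t \<ge> 0"
    \<comment> \<open>The decay condition with exponent 0 is the sup bound at the single time
      t.\<close>
    obtain B1 where B1: "\<forall>x\<in>lattice \<epsilon>. norm x ^ 0 * cmod (u x t) \<le> B1"
      using green t unfolding first_Green_def by blast
    obtain B2 where B2: "\<And>x. cmod (w 0 x t) \<le> B2"
      using wave_bounded[of "\<lambda>\<theta>. (- A \<theta>) ^ 0 * exp (- of_real t * A \<theta>)" \<epsilon>] eps cont_A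
      unfolding w_def by (fastforce intro!: continuous_intros)
    have "cmod (v x t) \<le> B1 + B2" if "x \<in> lattice \<epsilon>" for x
      unfolding v_def using B1 B2 that by (intro order_trans[OF norm_triangle_ineq4] add_mono) auto
    then show "\<exists>B. \<forall>x\<in>lattice \<epsilon>. cmod (v x t) \<le> B" by blast
  next
    fix x :: "real^'n" assume x: "x \<in> lattice \<epsilon>"
    have "w 0 x 0 = wave (\<lambda>_. 1) \<epsilon> x" by (simp add: w_def)
    also have "\<dots> = u x 0" using green x unfolding wave_one_lattice[OF x eps] first_Green_def by auto
    finally show "v x 0 = 0" by (simp add: v_def)
  qed (use x t in auto)
  then show ?thesis by (simp add: v_def)
qed

text \<open>Differentiability is recorded with the value because \<open>tderivative\<close> yields
  an arbitrary number where there is no derivative. The induction needs equality on the whole open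
  half-line, not just at one t.\<close>

lemma u_tderivative:
  assumes x: "x \<in> lattice \<epsilon>" and "t > 0"
  shows "(tderivative ^^ j) (u x) t = w j x t" and "(tderivative ^^ j) (u x) differentiable (at t)"
proof -
  have eq: "\<forall>t>0. (tderivative ^^ j) (u x) t = w j x t" for j
  proof (induction j)
    case 0 then show ?case using u_eq_w0[OF x] by simp
  next
    case (Suc j)
    show ?case
    proof (intro allI impI)
      fix t :: real assume t: "t > 0"
      have "((tderivative ^^ j) (u x) has_vector_derivative w (Suc j) x t) (at t)"
        by (rule has_vector_derivative_transform_within_open[OF w_deriv, of "{0<..}"]) (use Suc t in auto)
      then show "(tderivative ^^ Suc j) (u x) t = w (Suc j) x t"
        by (simp add: tderivative_def vector_derivative_at)
    qed
  qed
  then show "(tderivative ^^ j) (u x) t = w j x t" using \<open>t > 0\<close> by blast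
  have "((tderivative ^^ j) (u x) has_vector_derivative w (Suc j) x t) (at t)"
    by (rule has_vector_derivative_transform_within_open[OF w_deriv, of "{0<..}"]) (use eq \<open>t > 0\<close> in auto)
  then show "(tderivative ^^ j) (u x) differentiable (at t)"
    by (rule differentiableI_vector)
qed

end

section \<open>Asymptotic expansion\<close>

text \<open>\<open>\<sigma>\<^sup>-\<^sup>l A(\<sigma> \<xi>)\<close>, with each factor \<open>cis (\<plusminus> \<sigma> \<xi>\<^sub>k) - 1\<close> divided by \<open>\<sigma>\<close> so that \<open>\<sigma> = 0\<close>
  makes sense. The factors \<open>1\<close> and \<open>-1\<close> are the \<open>r\<close> of \<open>symclass.moment\<close>.\<close>

definition scaled_symbol ::
  "nat \<Rightarrow> nat \<Rightarrow> (('n::finite + 'n \<Rightarrow> nat) \<Rightarrow> complex) \<Rightarrow> real \<Rightarrow> real ^ 'n \<Rightarrow> complex" where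
  "scaled_symbol l L a \<sigma> \<xi> = (\<Sum>\<nu> | l \<le> mi_abs \<nu> \<and> mi_abs \<nu> \<le> L.
     a \<nu> * (of_real \<sigma> ^ (mi_abs \<nu> - l) *
       (\<Prod>k\<in>UNIV. (- \<i> * of_real (\<xi> $ k) * cis_moment 0 (\<sigma> * (-1 * \<xi> $ k))) ^ \<nu> (Inl k) *
          (\<i> * of_real (\<xi> $ k) * cis_moment 0 (\<sigma> * (1 * \<xi> $ k))) ^ \<nu> (Inr k))))"

lemma scaled_symbol_eq:
  assumes "\<sigma> \<noteq> 0"
  shows "scaled_symbol l L a \<sigma> \<xi> = discr_symbol l L a (\<sigma> *\<^sub>R \<xi>) / of_real (\<sigma> ^ l)"
  unfolding scaled_symbol_def discr_symbol_def sum_divide_distrib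
proof (rule sum.cong)
  fix \<nu> :: "'a + 'a \<Rightarrow> nat" assume "\<nu> \<in> {\<nu>. l \<le> mi_abs \<nu> \<and> mi_abs \<nu> \<le> L}"
  then have l: "l \<le> mi_abs \<nu>" by simp
  let ?p = "\<lambda>k. - \<i> * of_real (\<xi> $ k) * cis_moment 0 (\<sigma> * (-1 * \<xi> $ k))"
  let ?q = "\<lambda>k. \<i> * of_real (\<xi> $ k) * cis_moment 0 (\<sigma> * (1 * \<xi> $ k))"
  have "(\<Prod>k\<in>UNIV. (cis (- ((\<sigma> *\<^sub>R \<xi>) $ k)) - 1) ^ \<nu> (Inl k) * (cis ((\<sigma> *\<^sub>R \<xi>) $ k) - 1) ^ \<nu> (Inr k))
     = (\<Prod>k\<in>UNIV. (of_real \<sigma> * ?p k) ^ \<nu> (Inl k) * (of_real \<sigma> * ?q k) ^ \<nu> (Inr k))"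
    by (simp add: cis_moment_0[symmetric] mult_ac)
  also have "\<dots> = (\<Prod>k\<in>UNIV. of_real \<sigma> ^ \<nu> (Inl k) * of_real \<sigma> ^ \<nu> (Inr k)) * (\<Prod>k\<in>UNIV. ?p k ^ \<nu> (Inl k) * ?q k ^ \<nu> (Inr k))"
    unfolding power_mult_distrib prod.distrib[symmetric] by (intro prod.cong refl) (simp only: mult_ac)
  also have "(\<Prod>k\<in>UNIV. of_real \<sigma> ^ \<nu> (Inl k) * of_real \<sigma> ^ \<nu> (Inr k)) = (of_real \<sigma> ^ mi_abs \<nu> :: complex)"
    by (simp add: mi_abs_def power_sum prod_UNIV_sum)
  also have "(of_real \<sigma> ^ mi_abs \<nu> :: complex) = of_real \<sigma> ^ (mi_abs \<nu> - l) * of_real \<sigma> ^ l"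
    using l by (simp add: power_add[symmetric])
  finally show "a \<nu> * (of_real \<sigma> ^ (mi_abs \<nu> - l) * (\<Prod>k\<in>UNIV. ?p k ^ \<nu> (Inl k) * ?q k ^ \<nu> (Inr k))) =
     a \<nu> * (\<Prod>k\<in>UNIV. (cis (- ((\<sigma> *\<^sub>R \<xi>) $ k)) - 1) ^ \<nu> (Inl k) * (cis ((\<sigma> *\<^sub>R \<xi>) $ k) - 1) ^ \<nu> (Inr k)) / of_real (\<sigma> ^ l)"
    using assms by simp
qed simp

lemma symclass_scaled_symbol: "symclass (scaled_symbol l L a)"
  unfolding scaled_symbol_def [abs_def]
  by (intro symclass_sum symclass.mult symclass_prod symclass_power symclass.const symclass.scale symclass.coord symclass.moment)

text \<open>As l > 0, every term contains a difference, hence a factor \<xi>_k. This settles the one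
  point that \<open>f_lower_bound\<close> cannot normalise to a unit vector.\<close>

lemma scaled_symbol_zero:
  assumes "l > 0"
  shows "scaled_symbol l L a \<sigma> 0 = 0"
  unfolding scaled_symbol_def
proof (rule sum.neutral, rule ballI)
  fix \<nu> :: "'a + 'a \<Rightarrow> nat" assume "\<nu> \<in> {\<nu>. l \<le> mi_abs \<nu> \<and> mi_abs \<nu> \<le> L}"
  then have "mi_abs \<nu> \<noteq> 0" using assms by simp
  then obtain i where "\<nu> i \<noteq> 0" by (auto simp: mi_abs_def)
  then have "\<exists>k. \<nu> (Inl k) \<noteq> 0 \<or> \<nu> (Inr k) \<noteq> 0" by (cases i) auto
  then show "a \<nu> * (of_real \<sigma> ^ (mi_abs \<nu> - l) *
       (\<Prod>k\<in>UNIV. (- \<i> * of_real ((0 :: real^'a) $ k) * cis_moment 0 (\<sigma> * (-1 * (0 :: real^'a) $ k))) ^ \<nu> (Inl k) *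
          (\<i> * of_real ((0 :: real^'a) $ k) * cis_moment 0 (\<sigma> * (1 * (0 :: real^'a) $ k))) ^ \<nu> (Inr k))) = 0"
    by (auto simp: prod_zero_iff)
qed

section \<open>Plane waves as test functions for the approximation property\<close>

lemma plane_wave_deriv:
  "((\<lambda>s. c * cis ((y + s *\<^sub>R axis j 1) \<bullet> \<xi>)) has_vector_derivative \<i> * of_real (\<xi> $ j) * c * cis (y \<bullet> \<xi>)) (at 0)"
  using has_vector_derivative_mult_right[OF has_vector_derivative_cis[of "\<xi> $ j" 0 UNIV], of "c * cis (y \<bullet> \<xi>)"]
  by (simp add: inner_add_left inner_axis' cis_mult[symmetric] mult_ac)

lemma plane_wave_pderivative:
  "pderivative j (\<lambda>y. c * cis (y \<bullet> \<xi>)) = (\<lambda>y. \<i> * of_real (\<xi> $ j) * c * cis (y \<bullet> \<xi>))"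
  by (simp add: fun_eq_iff pderivative_def vector_derivative_at[OF plane_wave_deriv])

lemma smooth_bounded_plane_wave: "smooth_bounded (\<lambda>y. cis (y \<bullet> \<xi>))"
proof -
  have ex: "\<exists>c. foldr pderivative js (\<lambda>y. 1 * cis (y \<bullet> \<xi>)) = (\<lambda>y. c * cis (y \<bullet> \<xi>))" for js
  proof (induction js)
    case Nil
    show ?case by (intro exI[of _ 1]) simp
  next
    case (Cons j js)
    then obtain c where "foldr pderivative js (\<lambda>y. 1 * cis (y \<bullet> \<xi>)) = (\<lambda>y. c * cis (y \<bullet> \<xi>))" by blast
    then show ?case by (auto simp: plane_wave_pderivative)
  qed
  show ?thesis
    unfolding smooth_bounded_def Let_def
  proof (intro allI)
    fix js
    obtain c where c: "foldr pderivative js (\<lambda>y. cis (y \<bullet> \<xi>)) = (\<lambda>y. c * cis (y \<bullet> \<xi>))"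
      using ex[of js] by auto
    have "continuous_on UNIV (\<lambda>y. c * cis (y \<bullet> \<xi>))" by (intro continuous_intros)
    moreover have "bounded (range (\<lambda>y. c * cis (y \<bullet> \<xi>)))"
      by (auto simp: bounded_iff norm_mult)
    moreover have "(\<lambda>s. c * cis ((y + s *\<^sub>R axis j 1) \<bullet> \<xi>)) differentiable at 0" for j y
      by (rule differentiableI_vector[OF plane_wave_deriv])
    ultimately show "continuous_on UNIV (foldr pderivative js (\<lambda>y. cis (y \<bullet> \<xi>))) \<and>
        bounded (range (foldr pderivative js (\<lambda>y. cis (y \<bullet> \<xi>)))) \<and>
        (\<forall>j y. (\<lambda>s. foldr pderivative js (\<lambda>y. cis (y \<bullet> \<xi>)) (y + s *\<^sub>R axis j 1)) differentiable at 0)"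
      by (simp add: c)
  qed
qed

lemma diff_op_plane_wave: "diff_op l b (\<lambda>y. cis (y \<bullet> \<xi>)) y = diff_symbol l b \<xi> * cis (y \<bullet> \<xi>)"
proof -
  \<comment> \<open>With \<xi> fixed, \<open>mi_op_multiplier\<close> is applied to the map sending
    g to the plane wave of amplitude g \<xi>.\<close>
  have D: "Dop j (\<lambda>y. g \<xi> * cis (y \<bullet> \<xi>)) = (\<lambda>y. (of_real (\<xi> $ j) * g \<xi>) * cis (y \<bullet> \<xi>))" for j g
    by (simp add: fun_eq_iff Dop_def plane_wave_pderivative mult.assoc[symmetric])
  have "mi_op Dop \<alpha> (\<lambda>y. 1 * cis (y \<bullet> \<xi>)) = (\<lambda>y. (mi_monom \<xi> \<alpha> * 1) * cis (y \<bullet> \<xi>))" for \<alpha>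
    using mi_op_multiplier(2)[where P = "\<lambda>_. True" and \<Phi> = "\<lambda>g y. g \<xi> * cis (y \<bullet> \<xi>)" and g = "\<lambda>_. 1" and T = Dop
        and \<mu> = "\<lambda>j \<xi>. of_real (\<xi> $ j)"] D by (simp add: mi_monom_def)
  then show ?thesis by (simp add: diff_op_def diff_symbol_def sum_distrib_right mult.assoc)
qed

lemma discr_op_plane_wave:
  "discr_op l L a \<epsilon> (\<lambda>y. cis (y \<bullet> \<xi>)) y = discr_symbol l L a (\<epsilon> *\<^sub>R \<xi>) / of_real (\<epsilon> ^ l) * cis (y \<bullet> \<xi>)"
proof -
  have D: "delta \<epsilon> i (\<lambda>y. g \<xi> * cis (y \<bullet> \<xi>)) = (\<lambda>y. (delta_symbol i (\<epsilon> *\<^sub>R \<xi>) * g \<xi>) * cis (y \<bullet> \<xi>))" for i g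
  proof
    fix y
    have "cis ((y + r *\<^sub>R axis k 1) \<bullet> \<xi>) = cis (r * \<xi> $ k) * cis (y \<bullet> \<xi>)" for r k
      by (simp add: inner_add_left inner_axis' cis_mult add.commute)
    from this[of \<epsilon>] this[of "- \<epsilon>"]
    show "delta \<epsilon> i (\<lambda>y. g \<xi> * cis (y \<bullet> \<xi>)) y = (delta_symbol i (\<epsilon> *\<^sub>R \<xi>) * g \<xi>) * cis (y \<bullet> \<xi>)"
      by (cases i) (simp_all add: algebra_simps)
  qed
  have "mi_op (delta \<epsilon>) \<nu> (\<lambda>y. 1 * cis (y \<bullet> \<xi>)) = (\<lambda>y. ((\<Prod>i\<in>UNIV. delta_symbol i (\<epsilon> *\<^sub>R \<xi>) ^ \<nu> i) * 1) * cis (y \<bullet> \<xi>))" for \<nu>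
    using mi_op_multiplier(2)[where P = "\<lambda>_. True" and \<Phi> = "\<lambda>g y. g \<xi> * cis (y \<bullet> \<xi>)" and g = "\<lambda>_. 1" and T = "delta \<epsilon>"
        and \<mu> = "\<lambda>i \<xi>. delta_symbol i (\<epsilon> *\<^sub>R \<xi>)"] D by simp
  then show ?thesis by (simp add: discr_op_def discr_symbol_def prod_UNIV_sum sum_distrib_right mult.assoc)
qed

section \<open>Uniqueness of asymptotic expansions\<close>

lemma asymptotic_coeff_0:
  fixes c :: "nat \<Rightarrow> complex"
  assumes "\<forall>\<^sub>F s in at_right 0. cmod (\<Sum>k\<le>K. of_real (s ^ k) * c k) \<le> C * s ^ (K + 1)"
  shows "c 0 = 0"
proof -
  have "((\<lambda>s. cmod (\<Sum>k\<le>K. of_real (s ^ k) * c k)) \<longlongrightarrow> cmod (\<Sum>k\<le>K. of_real (0 ^ k) * c k)) (at_right 0)"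
    by (intro tendsto_intros)
  moreover have "((\<lambda>s. C * s ^ (K + 1)) \<longlongrightarrow> C * 0 ^ (K + 1)) (at_right 0)"
    by (intro tendsto_intros)
  ultimately have "cmod (\<Sum>k\<le>K. of_real (0 ^ k) * c k) \<le> C * 0 ^ (K + 1)"
    using assms by (intro tendsto_le[of "at_right (0::real)"]) auto
  moreover have "(\<Sum>k\<le>K. of_real (0 ^ k) * c k) = c 0"
    by (subst sum.atMost_shift) simp
  ultimately show ?thesis by simp
qed

text \<open>Letting s tend to 0 kills the constant term; dividing by s > 0 then lowers the order by
  one.\<close>

lemma asymptotic_coeffs_zero:
  fixes c :: "nat \<Rightarrow> complex"
  assumes "\<forall>\<^sub>F s in at_right 0. cmod (\<Sum>k\<le>K. of_real (s ^ k) * c k) \<le> C * s ^ (K + 1)" and "k \<le> K"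
  shows "c k = 0"
  using assms
proof (induction K arbitrary: c k)
  case 0
  then show ?case using asymptotic_coeff_0[OF 0(1)] by simp
next
  case (Suc K)
  have c0: "c 0 = 0" by (rule asymptotic_coeff_0[OF Suc.prems(1)])
  have "\<forall>\<^sub>F s in at_right 0. cmod (\<Sum>k\<le>K. of_real (s ^ k) * c (Suc k)) \<le> C * s ^ (K + 1)"
    using Suc.prems(1) eventually_at_right_less[of 0]
  proof eventually_elim
    case (elim s)
    have "(\<Sum>k\<le>Suc K. of_real (s ^ k) * c k) = of_real s * (\<Sum>k\<le>K. of_real (s ^ k) * c (Suc k))"
      by (subst sum.atMost_Suc_shift) (simp add: c0 sum_distrib_left mult.assoc)
    then have "s * cmod (\<Sum>k\<le>K. of_real (s ^ k) * c (Suc k)) \<le> s * (C * s ^ (K + 1))"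
      using elim by (simp add: norm_mult mult_ac)
    then show ?case using elim by simp
  qed
  from Suc.IH[OF this] have "c (Suc j) = 0" if "j \<le> K" for j using that .
  then show ?case using Suc.prems(2) c0 by (cases k) auto
qed

text \<open>Truncated at order k, the difference of the two expansions is a polynomial in s that is
  O(s^(k + 1)), so its coefficients vanish; the common factor exp(-A(\<xi>)) is nonzero.\<close>

lemma expansion_coeffs_unique:
  assumes "expansion_coeffs l L a b J R" "expansion_coeffs l L a b J R'"
  shows "R = R'"
proof
  fix k
  show "R k = R' k"
  proof (rule mpol_eval_inject)
    fix \<xi>
    let ?e = "exp (- diff_symbol l b \<xi>)"
    have "(\<lambda>s. ?e * (\<Sum>k\<le>k. of_real (s ^ k) * mpol_eval (R' k) \<xi>) - ?e * (\<Sum>k\<le>k. of_real (s ^ k) * mpol_eval (R k) \<xi>))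
        \<in> O[at_right 0](\<lambda>s. complex_of_real (s ^ (k + 1)))"
      using sum_in_bigo(2)[OF assms(1)[unfolded expansion_coeffs_def, rule_format, of \<xi> k]
        assms(2)[unfolded expansion_coeffs_def, rule_format, of \<xi> k]] by simp
    also have "(\<lambda>s. ?e * (\<Sum>k\<le>k. of_real (s ^ k) * mpol_eval (R' k) \<xi>) - ?e * (\<Sum>k\<le>k. of_real (s ^ k) * mpol_eval (R k) \<xi>))
       = (\<lambda>s. \<Sum>k\<le>k. of_real (s ^ k) * (?e * (mpol_eval (R' k) \<xi> - mpol_eval (R k) \<xi>)))"
      by (simp add: fun_eq_iff sum_distrib_left sum_subtractf[symmetric] algebra_simps)
    finally obtain C where "\<forall>\<^sub>F s in at_right 0. cmod (\<Sum>k\<le>k. of_real (s ^ k) * (?e * (mpol_eval (R' k) \<xi> - mpol_eval (R k) \<xi>)))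
        \<le> C * cmod (complex_of_real (s ^ (k + 1)))"
      by (auto elim!: landau_o.bigE)
    then have "\<forall>\<^sub>F s in at_right 0. cmod (\<Sum>k\<le>k. of_real (s ^ k) * (?e * (mpol_eval (R' k) \<xi> - mpol_eval (R k) \<xi>)))
        \<le> C * s ^ (k + 1)"
      using eventually_at_right_less[of 0]
      by eventually_elim (simp add: norm_mult norm_power)
    from asymptotic_coeffs_zero[OF this order_refl] show "mpol_eval (R k) \<xi> = mpol_eval (R' k) \<xi>" by simp
  qed
qed

section \<open>The scaled symbol: lower bounds and Taylor coefficients\<close>

locale difference_scheme =
  fixes l L M :: nat and b :: "('n::finite \<Rightarrow> nat) \<Rightarrow> complex" and a :: "('n + 'n \<Rightarrow> nat) \<Rightarrow> complex"
  assumes l_pos: "l > 0" and M_pos: "M > 0"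
    and elliptic: "strongly_elliptic l b"
    and approx: "approximates M l L a b"
    and pos: "\<And>\<theta>. (\<forall>i. \<bar>\<theta> $ i\<bar> \<le> pi) \<Longrightarrow> \<theta> \<noteq> 0 \<Longrightarrow> Re (discr_symbol l L a \<theta>) > 0"
begin

abbreviation "\<A> \<equiv> diff_symbol l b"
abbreviation "f \<equiv> scaled_symbol l L a"

lemmas symclass_f = symclass_scaled_symbol[of l L a]

lemma continuous_f: "continuous_on S (\<lambda>\<sigma>. f \<sigma> \<xi>)"
  by (rule continuous_on_compose2[OF symclass_continuous[OF symclass_f], of S "\<lambda>\<sigma>. (\<sigma>, \<xi>)", simplified])
     (intro continuous_intros)

text \<open>The approximation estimate for a plane wave, read off at y = 0. C depends on \<xi>, so
  it can only identify coefficients pointwise; the uniform estimates come from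
  \<open>symclass\<close>.\<close>

lemma f_approx:
  obtains C where "C > 0" "\<And>\<sigma>. \<sigma> > 0 \<Longrightarrow> cmod (f \<sigma> \<xi> - \<A> \<xi>) \<le> C * \<sigma> ^ M"
proof -
  obtain C where C: "C > 0" "\<forall>\<epsilon>>0. \<forall>y. cmod (discr_op l L a \<epsilon> (\<lambda>y. cis (y \<bullet> \<xi>)) y - diff_op l b (\<lambda>y. cis (y \<bullet> \<xi>)) y) \<le> C * \<epsilon> ^ M"
    using approx smooth_bounded_plane_wave unfolding approximates_def by blast
  have "cmod (f \<sigma> \<xi> - \<A> \<xi>) \<le> C * \<sigma> ^ M" if "\<sigma> > 0" for \<sigma>
    using C(2)[rule_format, OF that, of 0] that
    by (simp add: diff_op_plane_wave discr_op_plane_wave scaled_symbol_eq)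
  with C(1) show thesis by (rule that)
qed

text \<open>Two limits as \<sigma> tends to 0 from the right: continuity gives f 0 \<xi>, and
  approximation gives the elliptic symbol because M > 0.\<close>

lemma f_0: "f 0 \<xi> = \<A> \<xi>"
proof -
  obtain C where C: "\<And>\<sigma>. \<sigma> > 0 \<Longrightarrow> cmod (f \<sigma> \<xi> - \<A> \<xi>) \<le> C * \<sigma> ^ M" using f_approx by blast
  have "((\<lambda>\<sigma>. f \<sigma> \<xi>) \<longlongrightarrow> f 0 \<xi>) (at 0)"
    using continuous_f[of UNIV \<xi>] by (simp add: continuous_on_def)
  then have "((\<lambda>\<sigma>. f \<sigma> \<xi>) \<longlongrightarrow> f 0 \<xi>) (at_right 0)" by (rule filterlim_mono) (auto simp: at_le)
  moreover have "((\<lambda>\<sigma>. f \<sigma> \<xi>) \<longlongrightarrow> \<A> \<xi>) (at_right 0)"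
  proof (rule Lim_transform_bound[THEN LIM_zero_cancel])
    have "((\<lambda>\<sigma>::real. C * \<sigma> ^ M) \<longlongrightarrow> C * 0 ^ M) (at_right 0)" by (intro tendsto_intros)
    then show "((\<lambda>\<sigma>::real. C * \<sigma> ^ M) \<longlongrightarrow> 0) (at_right 0)" using M_pos by (simp only: zero_power mult_zero_right)
    show "\<forall>\<^sub>F \<sigma> in at_right 0. norm (f \<sigma> \<xi> - \<A> \<xi>) \<le> norm (C * \<sigma> ^ M)"
      using eventually_at_right_less[of 0] by eventually_elim (use C in \<open>force intro: order_trans[OF _ abs_ge_self]\<close>)
  qed
  ultimately show ?thesis by (rule tendsto_unique[rotated]) simp
qed

text \<open>The identity f(\<sigma>, r \<omega>) = r^l f(\<sigma> r, \<omega>) reduces the claim to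
  unit vectors \<omega>. The pairs with \<sigma> \<ge> 0 and \<sigma> \<omega> in the cube form a
  compact set on which Re f is positive: by ellipticity at \<sigma> = 0, by positivity of the
  discrete symbol otherwise.\<close>

lemma f_lower_bound:
  obtains c where "c > 0" "\<And>\<sigma> \<xi>. \<sigma> \<ge> 0 \<Longrightarrow> \<sigma> *\<^sub>R \<xi> \<in> pi_box \<Longrightarrow> Re (f \<sigma> \<xi>) \<ge> c * norm \<xi> ^ l"
    "\<And>\<xi>. Re (\<A> \<xi>) \<ge> c * norm \<xi> ^ l"
proof -
  obtain c0 where c0: "c0 > 0" "\<And>\<xi>. Re (\<A> \<xi>) \<ge> c0 * norm \<xi> ^ l"
    using elliptic by (auto simp: strongly_elliptic_def)
  define S where "S = {p :: real \<times> (real^'n). fst p \<ge> 0 \<and> norm (snd p) = 1 \<and> (\<forall>i. \<bar>(fst p *\<^sub>R snd p) $ i\<bar> \<le> pi)}"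
  have "closed S"
    unfolding S_def
    by (intro closed_Collect_conj closed_Collect_le closed_Collect_eq closed_Collect_all continuous_intros)
  moreover have "bounded S"
  proof -
    \<comment> \<open>The second component is a unit vector, so the first is the norm of a point of
      the cube; the summand 1 is for the second.\<close>
    have "norm p \<le> real CARD('n) * pi + 1" if "p \<in> S" for p
    proof -
      have p: "fst p \<ge> 0" "norm (snd p) = 1" "\<And>i. \<bar>(fst p *\<^sub>R snd p) $ i\<bar> \<le> pi" using that by (auto simp: S_def)
      have "fst p = norm (fst p *\<^sub>R snd p)" using p by simp
      also have "\<dots> \<le> (\<Sum>i\<in>UNIV. \<bar>(fst p *\<^sub>R snd p) $ i\<bar>)" by (rule norm_le_l1_cart)
      also have "\<dots> \<le> (\<Sum>i\<in>(UNIV :: 'n set). pi)" by (intro sum_mono p(3))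
      finally have "norm (fst p) + norm (snd p) \<le> real CARD('n) * pi + 1" using p by simp
      then show ?thesis using norm_Pair_le[of "fst p" "snd p"] by simp
    qed
    then show ?thesis unfolding bounded_iff by blast
  qed
  ultimately have "compact S" by (simp add: compact_eq_bounded_closed)
  moreover have "(0, axis undefined 1) \<in> S" by (simp add: S_def norm_axis_1)
  then have "S \<noteq> {}" by blast
  moreover have cont: "continuous_on S (\<lambda>p. Re (f (fst p) (snd p)))"
    by (intro continuous_intros continuous_on_subset[OF symclass_continuous[OF symclass_f]]) auto
  ultimately obtain p0 where p0: "p0 \<in> S" "\<And>p. p \<in> S \<Longrightarrow> Re (f (fst p0) (snd p0)) \<le> Re (f (fst p) (snd p))"
    using continuous_attains_inf[of S "\<lambda>p. Re (f (fst p) (snd p))"] by blast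
  define m where "m = Re (f (fst p0) (snd p0))"
  have "m > 0"
  proof (cases "fst p0 = 0")
    case True
    then show ?thesis using c0(2)[of "snd p0"] c0(1) p0(1) by (simp add: m_def f_0 S_def)
  next
    case False
    then have s: "fst p0 > 0" "snd p0 \<noteq> 0" using p0(1) by (auto simp: S_def)
    then have "Re (discr_symbol l L a (fst p0 *\<^sub>R snd p0)) > 0"
      using p0(1) by (intro pos) (auto simp: S_def)
    then show ?thesis using s by (simp add: m_def scaled_symbol_eq Re_divide_of_real)
  qed
  \<comment> \<open>The minimum with c0 lets one constant serve both f in the cube and the elliptic
    symbol on the whole space.\<close>
  have le: "min m c0 * norm \<xi> ^ l \<le> Re (\<A> \<xi>)" for \<xi>
    using c0(2)[of \<xi>] by (rule order_trans[rotated]) (auto intro: mult_right_mono)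
  have "min m c0 * norm \<xi> ^ l \<le> Re (f \<sigma> \<xi>)" if "\<sigma> \<ge> 0" and box: "\<sigma> *\<^sub>R \<xi> \<in> pi_box" for \<sigma> \<xi>
  proof -
    consider "\<sigma> = 0" | "\<xi> = 0" | "\<sigma> > 0" "\<xi> \<noteq> 0" using \<open>\<sigma> \<ge> 0\<close> by force
    then show ?thesis
    proof cases
      case 1 then show ?thesis using le by (simp add: f_0)
    next
      case 2 then show ?thesis using l_pos by (simp add: scaled_symbol_zero zero_power)
    next
      case 3
      let ?r = "norm \<xi>" and ?\<omega> = "\<xi> /\<^sub>R norm \<xi>"
      have r: "?r > 0" using 3 by simp
      have cancel: "(\<sigma> * ?r) *\<^sub>R ?\<omega> = \<sigma> *\<^sub>R \<xi>" using r by (simp add: mult.assoc)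
      have nz: "\<sigma> \<noteq> 0" "\<sigma> * ?r \<noteq> 0" using 3 by auto
      have "(\<sigma> * ?r, ?\<omega>) \<in> S"
        unfolding S_def mem_Collect_eq fst_conv snd_conv cancel using 3 box by (simp add: pi_box_def)
      from p0(2)[OF this] have "m \<le> Re (f (\<sigma> * ?r) ?\<omega>)" by (simp add: m_def)
      moreover have "f \<sigma> \<xi> = of_real (?r ^ l) * f (\<sigma> * ?r) ?\<omega>"
        unfolding scaled_symbol_eq[OF nz(1)] scaled_symbol_eq[OF nz(2)] cancel
        using 3 by (simp add: power_mult_distrib)
      ultimately have "m * ?r ^ l \<le> Re (f \<sigma> \<xi>)" using r by (simp add: mult.commute)
      moreover have "min m c0 * ?r ^ l \<le> m * ?r ^ l" by (intro mult_right_mono) auto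
      ultimately show ?thesis by linarith
    qed
  qed
  then show thesis using that[of "min m c0"] le \<open>m > 0\<close> c0(1) by auto
qed

definition P :: "nat \<Rightarrow> nat \<Rightarrow> real ^ 'n \<Rightarrow> complex" where
  "P J k \<xi> = exp_coeff f J k 0 \<xi> / of_real (fact k)"

lemma polyfn_P: "polyfn (P J k)"
  unfolding P_def [abs_def] divide_inverse
  by (intro polyfn_mult polyfn_const symclass_polyfn symclass_exp_coeff symclass_f)

lemma P_0: "P J 0 \<xi> = (- \<A> \<xi>) ^ J"
  by (simp add: P_def f_0)

text \<open>C may depend on \<xi>, so exp(-f) is bounded crudely by the exponential of the growth
  bound on |f|, inside or outside the cube.\<close>

lemma expansion_bound:
  obtains C where "\<And>s. 0 \<le> s \<Longrightarrow> s \<le> 1 \<Longrightarrow> cmod ((- f s \<xi>) ^ J * exp (- f s \<xi>)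
      - exp (- \<A> \<xi>) * (\<Sum>k\<le>K. of_real (s ^ k) * P J k \<xi>)) \<le> C * s ^ (K + 1)"
proof -
  obtain C N where "C \<ge> 0" and T: "\<And>s \<xi> E. 0 \<le> s \<Longrightarrow> s \<le> 1 \<Longrightarrow> \<forall>\<sigma>. 0 \<le> \<sigma> \<and> \<sigma> \<le> s \<longrightarrow> cmod (exp (- f \<sigma> \<xi>)) \<le> E \<Longrightarrow>
    cmod ((- f s \<xi>) ^ J * exp (- f s \<xi>)
      - exp (- f 0 \<xi>) * (\<Sum>k\<le>K. of_real (s ^ k) * (exp_coeff f J k 0 \<xi> / of_real (fact k))))
    \<le> s ^ (K + 1) * (C * (1 + norm \<xi>) ^ N * E)"
    by (rule exp_taylor[OF symclass_f, of 1 J K]) (rule that)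
  obtain C' N' where B: "\<And>\<sigma> \<xi>. \<bar>\<sigma>\<bar> \<le> 1 \<Longrightarrow> cmod (f \<sigma> \<xi>) \<le> C' * (1 + norm \<xi>) ^ N'"
    using symclass_bound[OF symclass_f, of 1] by blast
  define E where "E = exp (C' * (1 + norm \<xi>) ^ N')"
  have E: "cmod (exp (- f \<sigma> \<xi>)) \<le> E" if "0 \<le> \<sigma>" "\<sigma> \<le> 1" for \<sigma>
  proof -
    have "- Re (f \<sigma> \<xi>) \<le> cmod (f \<sigma> \<xi>)" using abs_Re_le_cmod[of "f \<sigma> \<xi>"] by linarith
    also have "\<dots> \<le> C' * (1 + norm \<xi>) ^ N'" using that by (intro B) auto
    finally show ?thesis by (simp add: E_def)
  qed
  show thesis
    by (rule that[of "C * (1 + norm \<xi>) ^ N * E"])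
       (use T[of _ \<xi> E] E in \<open>simp add: f_0 P_def mult_ac\<close>)
qed

text \<open>\<open>expansion_bound\<close> shows that the Taylor coefficients form an expansion, and
  uniqueness then makes them the value of the definite description.\<close>

lemma Rpol_eval: "mpol_eval (Rpol l L a b J k) \<xi> = P J k \<xi>"
proof -
  obtain R where R: "\<And>k. P J k = mpol_eval (R k)"
    using polyfn_P[of J] unfolding polyfn_def by metis
  have "expansion_coeffs l L a b J R"
    unfolding expansion_coeffs_def
  proof (intro allI)
    fix \<xi> K
    obtain C where C: "\<And>s. 0 \<le> s \<Longrightarrow> s \<le> 1 \<Longrightarrow> cmod ((- f s \<xi>) ^ J * exp (- f s \<xi>)
      - exp (- \<A> \<xi>) * (\<Sum>k\<le>K. of_real (s ^ k) * P J k \<xi>)) \<le> C * s ^ (K + 1)"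
      using expansion_bound by blast
    have "\<forall>\<^sub>F s in at_right (0::real). s < 1" by (rule eventually_at_right_field[THEN iffD2]) (auto intro: exI[of _ 1])
    then have "\<forall>\<^sub>F s in at_right 0. cmod ((- discr_symbol l L a (s *\<^sub>R \<xi>) / complex_of_real (s ^ l)) ^ J
               * exp (- discr_symbol l L a (s *\<^sub>R \<xi>) / complex_of_real (s ^ l))
             - exp (- diff_symbol l b \<xi>)
               * (\<Sum>k\<le>K. complex_of_real (s ^ k) * mpol_eval (R k) \<xi>)) \<le> C * cmod (complex_of_real (s ^ (K + 1)))"
      using eventually_at_right_less[of 0]
    proof eventually_elim
      case (elim s)
      then have eq: "- discr_symbol l L a (s *\<^sub>R \<xi>) / complex_of_real (s ^ l) = - f s \<xi>"
        by (simp add: scaled_symbol_eq)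
      show ?case unfolding eq using C[of s] elim by (simp add: R norm_power norm_mult)
    qed
    then show "(\<lambda>s. (- discr_symbol l L a (s *\<^sub>R \<xi>) / complex_of_real (s ^ l)) ^ J
               * exp (- discr_symbol l L a (s *\<^sub>R \<xi>) / complex_of_real (s ^ l))
             - exp (- diff_symbol l b \<xi>)
               * (\<Sum>k\<le>K. complex_of_real (s ^ k) * mpol_eval (R k) \<xi>))
        \<in> O[at_right 0](\<lambda>s. complex_of_real (s ^ (K + 1)))"
      by (rule bigoI)
  qed
  then have "Rpol l L a b J = R"
    unfolding Rpol_def by (intro the_equality) (auto intro: expansion_coeffs_unique)
  then show ?thesis by (simp add: R)
qed

lemma exp_power_lipschitz:
  fixes z0 :: complex
  obtains B where "\<And>z. cmod (z - z0) \<le> 1 \<Longrightarrow> cmod ((- z) ^ J * exp (- z) - (- z0) ^ J * exp (- z0)) \<le> B * cmod (z - z0)"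
proof -
  \<comment> \<open>The complex derivative of (-z)^J exp(-z); for J = 0 the truncated exponent J - 1
    is multiplied by 0.\<close>
  define g' where "g' = (\<lambda>z::complex. - (of_nat J * (- z) ^ (J - 1)) * exp (- z) - (- z) ^ J * exp (- z))"
  have "compact (g' ` cball z0 1)"
    unfolding g'_def by (intro compact_continuous_image continuous_intros compact_cball)
  then obtain B where B: "\<And>z. z \<in> cball z0 1 \<Longrightarrow> cmod (g' z) \<le> B"
    by (meson bounded_iff compact_imp_bounded imageI)
  show thesis
  proof (rule that[of B])
    fix z assume "cmod (z - z0) \<le> 1"
    then have z: "z \<in> cball z0 1" by (simp add: dist_norm norm_minus_commute)
    show "cmod ((- z) ^ J * exp (- z) - (- z0) ^ J * exp (- z0)) \<le> B * cmod (z - z0)"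
      by (rule field_differentiable_bound[where f = "\<lambda>z. (- z) ^ J * exp (- z)" and f' = g', OF convex_cball _ B z])
         (auto simp: g'_def intro!: derivative_eq_intros)
  qed
qed

text \<open>Since f - A = O(s^M) and z \<mapsto> (-z)^J exp(-z) is Lipschitz near A(\<xi>), the
  function differs from its value at s = 0 by O(s^M). In the expansion to order M - 1 all terms
  after the first must therefore vanish.\<close>

lemma P_zero:
  assumes "0 < k" "k < M"
  shows "P J k \<xi> = 0"
proof -
  define K where "K = M - 1"
  have K: "K + 1 = M" "k \<le> K" using assms by (auto simp: K_def)
  obtain C where C: "\<And>s. 0 \<le> s \<Longrightarrow> s \<le> 1 \<Longrightarrow> cmod ((- f s \<xi>) ^ J * exp (- f s \<xi>)
      - exp (- \<A> \<xi>) * (\<Sum>k\<le>K. of_real (s ^ k) * P J k \<xi>)) \<le> C * s ^ (K + 1)"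
    using expansion_bound by blast
  obtain C' where C': "C' > 0" "\<And>\<sigma>. \<sigma> > 0 \<Longrightarrow> cmod (f \<sigma> \<xi> - \<A> \<xi>) \<le> C' * \<sigma> ^ M" using f_approx by blast
  obtain B where B: "\<And>z. cmod (z - \<A> \<xi>) \<le> 1 \<Longrightarrow> cmod ((- z) ^ J * exp (- z) - (- \<A> \<xi>) ^ J * exp (- \<A> \<xi>)) \<le> B * cmod (z - \<A> \<xi>)"
    using exp_power_lipschitz by blast
  \<comment> \<open>The coefficients without the term k = 0, which is the value at s = 0 and need
    not vanish.\<close>
  define c where "c = (\<lambda>k. if k = 0 then 0 else exp (- \<A> \<xi>) * P J k \<xi>)"
  have "((\<lambda>s. f s \<xi>) \<longlongrightarrow> f 0 \<xi>) (at 0)"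
    using continuous_f[of UNIV \<xi>] by (simp add: continuous_on_def)
  then have "\<forall>\<^sub>F s in at 0. dist (f s \<xi>) (\<A> \<xi>) < 1" using tendstoD[of _ "f 0 \<xi>" _ 1] by (simp add: f_0)
  then have "\<forall>\<^sub>F s in at_right 0. dist (f s \<xi>) (\<A> \<xi>) < 1" by (rule filter_leD[OF at_le, rotated]) simp
  moreover have "\<forall>\<^sub>F s in at_right (0::real). s < 1" by (rule eventually_at_right_field[THEN iffD2]) (auto intro: exI[of _ 1])
  ultimately have "\<forall>\<^sub>F s in at_right 0. cmod (\<Sum>k\<le>K. of_real (s ^ k) * c k) \<le> (C + \<bar>B\<bar> * C') * s ^ (K + 1)"
    using eventually_at_right_less[of 0]
  proof eventually_elim
    case (elim s)
    let ?G = "\<lambda>z. (- z) ^ J * exp (- z) :: complex"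
    have "exp (- \<A> \<xi>) * (\<Sum>k\<le>K. of_real (s ^ k) * P J k \<xi>) = (\<Sum>k\<le>K. of_real (s ^ k) * c k) + ?G (\<A> \<xi>)"
      by (subst (1 2) sum.atMost_shift) (simp add: c_def P_0 sum_distrib_left algebra_simps)
    then have "(\<Sum>k\<le>K. of_real (s ^ k) * c k) = (?G (f s \<xi>) - ?G (\<A> \<xi>))
        - (?G (f s \<xi>) - exp (- \<A> \<xi>) * (\<Sum>k\<le>K. of_real (s ^ k) * P J k \<xi>))" by simp
    also have "cmod \<dots> \<le> cmod (?G (f s \<xi>) - ?G (\<A> \<xi>)) + C * s ^ (K + 1)"
    proof -
      have "cmod (?G (f s \<xi>) - exp (- \<A> \<xi>) * (\<Sum>k\<le>K. of_real (s ^ k) * P J k \<xi>)) \<le> C * s ^ (K + 1)"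
        by (rule C) (use elim in auto)
      then show ?thesis by (rule order_trans[OF norm_triangle_ineq4 add_left_mono])
    qed
    also have "cmod (?G (f s \<xi>) - ?G (\<A> \<xi>)) \<le> \<bar>B\<bar> * cmod (f s \<xi> - \<A> \<xi>)"
      using B[of "f s \<xi>"] elim by (force simp: dist_norm intro: order_trans mult_right_mono)
    also have "\<dots> \<le> \<bar>B\<bar> * (C' * s ^ M)" using C'(2)[of s] elim by (intro mult_left_mono) auto
    finally show ?case by (simp add: K(1)[symmetric] algebra_simps)
  qed
  from asymptotic_coeffs_zero[OF this K(2)] show ?thesis using assms by (simp add: c_def)
qed

abbreviation "eA \<equiv> \<lambda>\<xi>. exp (- \<A> \<xi>)"

lemma Hfun_eq: "Hfun l b = fourier eA"
  by (simp add: fun_eq_iff Hfun_def fourier_def)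

lemma continuous_mi_monom: "continuous_on S (\<lambda>\<xi>. mi_monom \<xi> \<alpha>)"
  unfolding mi_monom_def by (intro continuous_intros)

lemma continuous_diff_symbol: "continuous_on S \<A>"
  unfolding diff_symbol_def [abs_def] by (intro continuous_intros continuous_mi_monom)

lemma rapid_eA: "rapid eA"
  unfolding rapid_def
proof (intro conjI allI)
  show [measurable]: "eA \<in> borel_measurable borel"
    by (intro borel_measurable_continuous_onI continuous_intros continuous_diff_symbol)
  fix N
  obtain c where c: "c > 0" "\<And>\<xi>. Re (\<A> \<xi>) \<ge> c * norm \<xi> ^ l"
    using elliptic by (auto simp: strongly_elliptic_def)
  show "integrable lborel (\<lambda>\<xi>. (1 + norm \<xi>) ^ N * cmod (eA \<xi>))"
  proof (rule Bochner_Integration.integrable_bound[OF integrable_poly_exp[OF c(1) l_pos, of N]])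
    show "AE \<xi> :: real^'n in lborel. norm ((1 + norm \<xi>) ^ N * cmod (eA \<xi>)) \<le> norm ((1 + norm \<xi>) ^ N * exp (- (c * norm \<xi> ^ l)))"
      using c(2) by (intro always_eventually allI) (simp add: mult_left_mono)
  qed measurable
qed

lemma HJk_eq: "HJk l L a b J k = fourier (\<lambda>\<xi>. P J k \<xi> * eA \<xi>)"
  by (simp add: HJk_def Hfun_eq fourier_mpol_D[OF rapid_eA] Rpol_eval)

lemma HJk_0: "HJk l L a b J 0 = ((\<lambda>g y. - diff_op l b g y) ^^ J) (Hfun l b)"
proof -
  have "rapid (\<lambda>\<xi>. (- \<A> \<xi>) ^ j * eA \<xi>) \<and>
    ((\<lambda>g y. - diff_op l b g y) ^^ j) (Hfun l b) = fourier (\<lambda>\<xi>. (- \<A> \<xi>) ^ j * eA \<xi>)" for j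
  proof (induction j)
    case 0 then show ?case using rapid_eA by (simp add: Hfun_eq)
  next
    case (Suc j)
    then have r: "rapid (\<lambda>\<xi>. (- \<A> \<xi>) ^ j * eA \<xi>)" by simp
    have "- fourier (\<lambda>\<xi>. \<A> \<xi> * ((- \<A> \<xi>) ^ j * eA \<xi>)) y = fourier (\<lambda>\<xi>. - \<A> \<xi> * ((- \<A> \<xi>) ^ j * eA \<xi>)) y" for y
      using fourier_cmult[of "-1" "\<lambda>\<xi>. \<A> \<xi> * ((- \<A> \<xi>) ^ j * eA \<xi>)" y] by simp
    then show ?case using rapid_diff_symbol[OF r, of l b] Suc fourier_diff_op[OF r, of l b]
      by (simp add: mult.assoc)
  qed
  then show ?thesis by (simp add: HJk_eq P_0)
qed

lemma HJk_zero: "0 < k \<Longrightarrow> k < M \<Longrightarrow> HJk l L a b J k = (\<lambda>y. 0)"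
  by (simp add: HJk_eq P_zero fourier_def fun_eq_iff)

lemma HJk_pderivatives:
  "\<exists>p :: 'n mpol. \<forall>y. HJk l L a b J k y = (\<Sum>\<alpha>\<in>Poly_Mapping.keys p.
     Poly_Mapping.lookup p \<alpha> * mi_op pderivative \<alpha> (Hfun l b) y)"
proof (intro exI allI)
  fix y
  let ?R = "Rpol l L a b J k"
  \<comment> \<open>Division by i^|\<alpha>| absorbs the factor between D^\<alpha> and the plain
    derivative; it is by a nonzero number, so the keys stay the same.\<close>
  let ?p = "Poly_Mapping.mapp (\<lambda>\<alpha> c. c / \<i> ^ mi_abs \<alpha>) ?R"
  have "Poly_Mapping.keys ?p = Poly_Mapping.keys ?R"
    by (auto simp: in_keys_iff lookup_mapp when_def)
  then show "HJk l L a b J k y = (\<Sum>\<alpha>\<in>Poly_Mapping.keys ?p.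
     Poly_Mapping.lookup ?p \<alpha> * mi_op pderivative \<alpha> (Hfun l b) y)"
    by (simp add: HJk_def mpol_D_def Hfun_eq fourier_mi_pderivative[OF rapid_eA] lookup_mapp)
qed

end

lemma symclass_continuous_snd:
  assumes "symclass g"
  shows "continuous_on S (g \<sigma>)"
  using continuous_on_compose2[OF symclass_continuous[OF assms], of S "\<lambda>\<xi>. (\<sigma>, \<xi>)"]
  by (simp add: continuous_intros)

text \<open>Polynomials re-enter the class as functions constant in \<sigma>, and so inherit its
  growth bounds and continuity.\<close>

lemma polyfn_symclass:
  assumes "polyfn p"
  shows "symclass (\<lambda>\<sigma>. p)"
proof -
  obtain q where "p = mpol_eval q" using assms by (auto simp: polyfn_def)
  then show ?thesis
    unfolding mpol_eval_def [abs_def] mi_monom_def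
    by (simp add: symclass_sum symclass_prod symclass_power symclass.const symclass.coord symclass.mult)
qed

section \<open>Expansion of the integral with a uniform remainder\<close>

context difference_scheme
begin

lemma rapid_P: "rapid (\<lambda>\<xi>. P J k \<xi> * eA \<xi>)"
proof -
  note sc = polyfn_symclass[OF polyfn_P[of J k]]
  obtain C N where "\<And>\<xi>. cmod (P J k \<xi>) \<le> C * (1 + norm \<xi>) ^ N"
    using symclass_bound[OF sc, of 0] by (metis abs_zero order_refl)
  then show ?thesis
    by (rule rapid_mult[OF rapid_eA, rotated])
       (intro borel_measurable_continuous_onI symclass_continuous_snd[OF sc])
qed

text \<open>The cube integral of the exact function is compared with the whole-space integral of its
  Taylor polynomial. R is uniform in y because |\<open>cis\<close>| = 1 and the pointwise error is
  at most s^(K + 1) times one integrable weight W.\<close>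

lemma integral_expansion:
  assumes "s0 > 0"
  obtains R where "R \<ge> 0" "\<And>s y. 0 < s \<Longrightarrow> s \<le> s0 \<Longrightarrow>
    cmod ((LINT \<xi>|lborel. indicator pi_box (s *\<^sub>R \<xi>) *\<^sub>R ((- f s \<xi>) ^ J * exp (- f s \<xi>) * cis (y \<bullet> \<xi>))) /
        of_real ((2 * pi) ^ CARD('n))
      - (\<Sum>k\<le>K. of_real (s ^ k) * HJk l L a b J k y)) \<le> s ^ (K + 1) * R"
proof -
  obtain c where c: "c > 0"
    and low: "\<And>\<sigma> \<xi>. \<sigma> \<ge> 0 \<Longrightarrow> \<sigma> *\<^sub>R \<xi> \<in> pi_box \<Longrightarrow> Re (f \<sigma> \<xi>) \<ge> c * norm \<xi> ^ l"
    and lowA: "\<And>\<xi>. Re (\<A> \<xi>) \<ge> c * norm \<xi> ^ l"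
    by (rule f_lower_bound) (rule that)
  obtain C N where C: "C \<ge> 0"
    and T: "\<And>s \<xi> E. 0 \<le> s \<Longrightarrow> s \<le> s0 \<Longrightarrow> \<forall>\<sigma>. 0 \<le> \<sigma> \<and> \<sigma> \<le> s \<longrightarrow> cmod (exp (- f \<sigma> \<xi>)) \<le> E \<Longrightarrow>
    cmod ((- f s \<xi>) ^ J * exp (- f s \<xi>)
      - exp (- f 0 \<xi>) * (\<Sum>k\<le>K. of_real (s ^ k) * (exp_coeff f J k 0 \<xi> / of_real (fact k))))
    \<le> s ^ (K + 1) * (C * (1 + norm \<xi>) ^ N * E)"
    by (rule exp_taylor[OF symclass_f, of s0 J K]) (rule that)
  define g where "g = (\<lambda>\<sigma> \<xi>. \<Sum>k\<le>K. of_real \<sigma> ^ k * P J k \<xi>)"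
  have sg: "symclass g"
    unfolding g_def
    by (intro symclass_sum symclass.mult symclass_power symclass.scale polyfn_symclass polyfn_P)
  obtain D N' where D: "D \<ge> 0" and gb: "\<And>\<sigma> \<xi>. \<bar>\<sigma>\<bar> \<le> s0 \<Longrightarrow> cmod (g \<sigma> \<xi>) \<le> D * (1 + norm \<xi>) ^ N'"
    using symclass_bound[OF sg, of s0] by blast
  \<comment> \<open>N is used by the Taylor remainder inside the cube, N' + (K + 1) by the
    polynomial tail outside it; the sum covers both.\<close>
  define m where "m = N + N' + (K + 1)"
  define W where "W = (\<lambda>\<xi>::real^'n. (C + D) * ((1 + norm \<xi>) ^ m * exp (- (c * norm \<xi> ^ l))))"
  have intW: "integrable lborel W"
    unfolding W_def by (intro integrable_mult_right integrable_poly_exp c l_pos)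
  have W0: "W \<xi> \<ge> 0" for \<xi> using C D by (simp add: W_def)
  define F where "F = (\<lambda>s \<xi>. indicator pi_box (s *\<^sub>R \<xi>) *\<^sub>R ((- f s \<xi>) ^ J * exp (- f s \<xi>)))"
  \<comment> \<open>Only the exact function is cut off at the cube. Outside it the error is the
    whole Taylor polynomial times exp(-A).\<close>
  define h where "h = (\<lambda>s \<xi>. F s \<xi> - eA \<xi> * g s \<xi>)"
  have h_bound: "cmod (h s \<xi>) \<le> s ^ (K + 1) * W \<xi>" if s: "0 < s" "s \<le> s0" for s \<xi>
  proof -
    let ?e = "exp (- (c * norm \<xi> ^ l))"
    have eA: "cmod (eA \<xi>) \<le> ?e" using lowA[of \<xi>] by simp
    have pw: "(1 + norm \<xi>) ^ i \<le> (1 + norm \<xi>) ^ m" if "i \<le> m" for i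
      using that by (intro power_increasing) auto
    have "cmod (h s \<xi>) \<le> s ^ (K + 1) * ((C + D) * ((1 + norm \<xi>) ^ m * ?e))"
    proof (cases "s *\<^sub>R \<xi> \<in> pi_box")
      case True
      have "cmod (exp (- f \<sigma> \<xi>)) \<le> ?e" if "0 \<le> \<sigma>" "\<sigma> \<le> s" for \<sigma>
      proof -
        \<comment> \<open>The cube is star-shaped about 0, so the lower bound on Re f holds along
          the entire segment on which the remainder needs it.\<close>
        have "\<bar>\<sigma> * \<xi> $ i\<bar> \<le> pi" for i
        proof -
          have "\<bar>\<sigma> * \<xi> $ i\<bar> \<le> \<bar>s * \<xi> $ i\<bar>" using that by (simp add: abs_mult mult_right_mono)
          also have "\<dots> \<le> pi" using True by (simp add: pi_box_def)
          finally show ?thesis .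
        qed
        then have "c * norm \<xi> ^ l \<le> Re (f \<sigma> \<xi>)" using that by (intro low) (auto simp: pi_box_def)
        then show ?thesis by simp
      qed
      then have "\<forall>\<sigma>. 0 \<le> \<sigma> \<and> \<sigma> \<le> s \<longrightarrow> cmod (exp (- f \<sigma> \<xi>)) \<le> ?e" by blast
      from T[OF less_imp_le[OF s(1)] s(2) this]
      have "cmod (h s \<xi>) \<le> s ^ (K + 1) * (C * (1 + norm \<xi>) ^ N * ?e)"
        using True by (simp add: h_def F_def g_def P_def f_0)
      also have "\<dots> \<le> s ^ (K + 1) * ((C + D) * (1 + norm \<xi>) ^ m * ?e)"
        using s C D pw[of N] by (intro mult_left_mono mult_right_mono mult_mono) (auto simp: m_def)
      finally show ?thesis by (simp only: mult.assoc)
    next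
      case False
      then obtain i where i: "\<bar>s * \<xi> $ i\<bar> > pi" by (auto simp: pi_box_def not_le)
      \<comment> \<open>Outside the cube s (1 + |\<xi>|) \<ge> 1, so its power K + 1 can be
        inserted; this creates the required s^(K + 1) at the cost of polynomial growth.\<close>
      have "1 \<le> \<bar>s * \<xi> $ i\<bar>" using i pi_gt3 by linarith
      also have "\<dots> \<le> s * (1 + norm \<xi>)"
        using s component_le_norm_cart[of \<xi> i] by (simp add: abs_mult)
      finally have "1 ^ (K + 1) \<le> (s * (1 + norm \<xi>)) ^ (K + 1)" by (intro power_mono) auto
      then have one: "1 \<le> s ^ (K + 1) * (1 + norm \<xi>) ^ (K + 1)" by (simp only: power_one power_mult_distrib)
      have "cmod (h s \<xi>) = cmod (eA \<xi>) * cmod (g s \<xi>)" using False by (simp add: h_def F_def norm_mult)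
      also have "\<dots> \<le> ?e * (D * (1 + norm \<xi>) ^ N')"
        using eA gb[of s \<xi>] s D by (intro mult_mono) auto
      also have "\<dots> = 1 * (?e * (D * (1 + norm \<xi>) ^ N'))" by simp
      also have "\<dots> \<le> (s ^ (K + 1) * (1 + norm \<xi>) ^ (K + 1)) * (?e * (D * (1 + norm \<xi>) ^ N'))"
        using one D by (intro mult_right_mono) auto
      also have "\<dots> = s ^ (K + 1) * (D * (1 + norm \<xi>) ^ (N' + (K + 1)) * ?e)"
        unfolding power_add[of _ N' "K + 1"] by (simp only: mult_ac)
      also have "\<dots> \<le> s ^ (K + 1) * ((C + D) * (1 + norm \<xi>) ^ m * ?e)"
        using s C D pw[of "N' + (K + 1)"] by (intro mult_left_mono mult_right_mono mult_mono) (auto simp: m_def)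
      finally show ?thesis by (simp only: mult.assoc)
    qed
    then show ?thesis by (simp only: W_def)
  qed
  show thesis
  proof (rule that[of "(LINT \<xi>|lborel. W \<xi>) / (2 * pi) ^ CARD('n)"])
    show "(LINT \<xi>|lborel. W \<xi>) / (2 * pi) ^ CARD('n) \<ge> 0"
      using W0 by (intro divide_nonneg_nonneg Bochner_Integration.integral_nonneg) auto
    fix s :: real and y :: "real^'n"
    assume s: "0 < s" "s \<le> s0"
    have [measurable]: "f s \<in> borel_measurable borel" "g s \<in> borel_measurable borel" "eA \<in> borel_measurable borel"
      "(\<lambda>\<xi>. cis (y \<bullet> \<xi>)) \<in> borel_measurable borel"
      by (intro borel_measurable_continuous_onI symclass_continuous_snd symclass_f sg continuous_intros continuous_diff_symbol)+
    have [measurable]: "(pi_box :: (real^'n) set) \<in> sets borel"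
      using compact_pi_box by (rule borel_compact)
    have [measurable]: "h s \<in> borel_measurable borel"
      unfolding h_def F_def by measurable
    have int_g: "integrable lborel (\<lambda>\<xi>. eA \<xi> * g s \<xi> * cis (y \<bullet> \<xi>))"
    proof -
      have "integrable lborel (\<lambda>\<xi>. \<Sum>k\<le>K. of_real s ^ k * (P J k \<xi> * eA \<xi> * cis (y \<bullet> \<xi>)))"
        by (intro Bochner_Integration.integrable_sum integrable_mult_right rapid_integrable_cis rapid_P)
      then show ?thesis by (simp add: g_def sum_distrib_left sum_distrib_right mult_ac)
    qed
    have int_h: "integrable lborel (\<lambda>\<xi>. h s \<xi> * cis (y \<bullet> \<xi>))"
    proof (rule Bochner_Integration.integrable_bound)
      show "integrable lborel (\<lambda>\<xi>. s ^ (K + 1) * W \<xi>)" by (intro integrable_mult_right intW)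
      show "AE \<xi> in lborel. norm (h s \<xi> * cis (y \<bullet> \<xi>)) \<le> norm (s ^ (K + 1) * W \<xi>)"
        using h_bound[OF s] by (intro always_eventually allI) (simp add: norm_mult order_trans[OF _ abs_ge_self])
    qed measurable
    have "(LINT \<xi>|lborel. indicator pi_box (s *\<^sub>R \<xi>) *\<^sub>R ((- f s \<xi>) ^ J * exp (- f s \<xi>) * cis (y \<bullet> \<xi>)))
        = (LINT \<xi>|lborel. h s \<xi> * cis (y \<bullet> \<xi>) + eA \<xi> * g s \<xi> * cis (y \<bullet> \<xi>))"
      by (simp add: h_def F_def algebra_simps)
    also have "\<dots> = (LINT \<xi>|lborel. h s \<xi> * cis (y \<bullet> \<xi>)) + (LINT \<xi>|lborel. eA \<xi> * g s \<xi> * cis (y \<bullet> \<xi>))"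
      by (rule Bochner_Integration.integral_add[OF int_h int_g])
    finally have split: "(LINT \<xi>|lborel. indicator pi_box (s *\<^sub>R \<xi>) *\<^sub>R ((- f s \<xi>) ^ J * exp (- f s \<xi>) * cis (y \<bullet> \<xi>)))
        = (LINT \<xi>|lborel. h s \<xi> * cis (y \<bullet> \<xi>)) + (LINT \<xi>|lborel. eA \<xi> * g s \<xi> * cis (y \<bullet> \<xi>))" .
    have "(\<Sum>k\<le>K. of_real (s ^ k) * HJk l L a b J k y) = fourier (\<lambda>\<xi>. \<Sum>k\<le>K. of_real (s ^ k) * (P J k \<xi> * eA \<xi>)) y"
      unfolding HJk_eq by (intro fourier_sum rapid_P)
    also have "(\<lambda>\<xi>. \<Sum>k\<le>K. of_real (s ^ k) * (P J k \<xi> * eA \<xi>)) = (\<lambda>\<xi>. eA \<xi> * g s \<xi>)"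
      by (simp add: g_def sum_distrib_left mult_ac)
    finally have "(\<Sum>k\<le>K. of_real (s ^ k) * HJk l L a b J k y)
        = (LINT \<xi>|lborel. eA \<xi> * g s \<xi> * cis (y \<bullet> \<xi>)) / of_real ((2 * pi) ^ CARD('n))"
      by (simp add: fourier_def)
    then have "(LINT \<xi>|lborel. indicator pi_box (s *\<^sub>R \<xi>) *\<^sub>R ((- f s \<xi>) ^ J * exp (- f s \<xi>) * cis (y \<bullet> \<xi>))) /
        of_real ((2 * pi) ^ CARD('n)) - (\<Sum>k\<le>K. of_real (s ^ k) * HJk l L a b J k y)
        = (LINT \<xi>|lborel. h s \<xi> * cis (y \<bullet> \<xi>)) / of_real ((2 * pi) ^ CARD('n))"
      by (simp only: split add_divide_distrib) simp
    also have "cmod \<dots> \<le> (s ^ (K + 1) * (LINT \<xi>|lborel. W \<xi>)) / (2 * pi) ^ CARD('n)"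
    proof -
      have "cmod (LINT \<xi>|lborel. h s \<xi> * cis (y \<bullet> \<xi>)) \<le> (LINT \<xi>|lborel. s ^ (K + 1) * W \<xi>)"
        by (rule Bochner_Integration.integral_norm_bound_integral[OF int_h])
           (use h_bound[OF s] intW in \<open>auto simp: norm_mult\<close>)
      then show ?thesis by (simp only: norm_divide norm_of_real) (simp add: divide_right_mono)
    qed
    finally show "cmod ((LINT \<xi>|lborel. indicator pi_box (s *\<^sub>R \<xi>) *\<^sub>R ((- f s \<xi>) ^ J * exp (- f s \<xi>) * cis (y \<bullet> \<xi>))) /
        of_real ((2 * pi) ^ CARD('n))
      - (\<Sum>k\<le>K. of_real (s ^ k) * HJk l L a b J k y)) \<le> s ^ (K + 1) * ((LINT \<xi>|lborel. W \<xi>) / (2 * pi) ^ CARD('n))"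
      by (simp only: times_divide_eq_right)
  qed
qed

text \<open>Substitution of \<theta> = s \<xi> with s = \<epsilon> / \<tau>. The Jacobian s^d
  against (2 pi \<epsilon>)^d leaves \<tau>^(-d), and each of the J factors -A contributes 1 /
  t.\<close>

lemma green_scaled:
  assumes "first_Green l L a \<epsilon> u" "\<epsilon> > 0" "x \<in> lattice \<epsilon>" "t > 0"
  defines "\<tau> \<equiv> t powr (1 / real l)"
  shows "(tderivative ^^ J) (u x) t =
    (LINT \<xi>|lborel. indicator pi_box ((\<epsilon> / \<tau>) *\<^sub>R \<xi>) *\<^sub>R
       ((- f (\<epsilon> / \<tau>) \<xi>) ^ J * exp (- f (\<epsilon> / \<tau>) \<xi>) * cis ((x /\<^sub>R \<tau>) \<bullet> \<xi>))) /
     of_real ((2 * pi) ^ CARD('n)) / of_real (\<tau> ^ CARD('n) * t ^ J)"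
proof -
  interpret green_solution l L a \<epsilon> u by standard (use assms in auto)
  have \<tau>: "\<tau> > 0" using assms by (simp add: \<tau>_def)
  have \<tau>l: "\<tau> ^ l = t"
  proof -
    have "\<tau> ^ l = \<tau> powr (real l)" using \<tau> by (simp add: powr_realpow)
    also have "\<dots> = t" using l_pos \<open>t > 0\<close> by (simp add: \<tau>_def powr_powr)
    finally show ?thesis .
  qed
  define s where "s = \<epsilon> / \<tau>"
  have s: "s > 0" using \<tau> \<open>\<epsilon> > 0\<close> by (simp add: s_def)
  \<comment> \<open>From \<tau>^l = t follows t \<epsilon>^(-l) = s^(-l), so the exponent depends on
    t and \<epsilon> only through s.\<close>
  have A: "of_real t * A (s *\<^sub>R \<xi>) = f s \<xi>" for \<xi>
    using s \<tau> \<open>\<epsilon> > 0\<close> \<tau>l[symmetric] by (simp add: A_def scaled_symbol_eq s_def power_divide)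
  have A': "A (s *\<^sub>R \<xi>) = f s \<xi> / of_real t" for \<xi>
    using A[of \<xi>] \<open>t > 0\<close> by (simp add: field_simps)
  let ?g = "\<lambda>\<theta>. (- A \<theta>) ^ J * exp (- of_real t * A \<theta>)"
  have [measurable]: "(pi_box :: (real^'n) set) \<in> sets borel"
    using compact_pi_box by (rule borel_compact)
  have [measurable]: "(\<lambda>\<theta>. ?g \<theta> * cis ((x \<bullet> \<theta>) / \<epsilon>)) \<in> borel_measurable borel"
    by (intro borel_measurable_continuous_onI continuous_wave continuous_intros cont_A \<open>\<epsilon> > 0\<close>)
  have m: "(\<lambda>\<theta>. indicator pi_box \<theta> *\<^sub>R (?g \<theta> * cis ((x \<bullet> \<theta>) / \<epsilon>))) \<in> borel_measurable borel"
    by measurable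
  have "(LINT \<theta>|lborel. indicator pi_box \<theta> *\<^sub>R (?g \<theta> * cis ((x \<bullet> \<theta>) / \<epsilon>)))
      = s ^ CARD('n) *\<^sub>R (LINT \<xi>|lborel. indicator pi_box (s *\<^sub>R \<xi>) *\<^sub>R (?g (s *\<^sub>R \<xi>) * cis ((x \<bullet> (s *\<^sub>R \<xi>)) / \<epsilon>)))"
    using lborel_integral_scale[OF m s] by simp
  also have "(\<lambda>\<xi>. indicator pi_box (s *\<^sub>R \<xi>) *\<^sub>R (?g (s *\<^sub>R \<xi>) * cis ((x \<bullet> (s *\<^sub>R \<xi>)) / \<epsilon>)))
      = (\<lambda>\<xi>. (indicator pi_box (s *\<^sub>R \<xi>) *\<^sub>R ((- f s \<xi>) ^ J * exp (- f s \<xi>) * cis ((x /\<^sub>R \<tau>) \<bullet> \<xi>))) / of_real (t ^ J))"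
  proof
    fix \<xi>
    have 1: "(x \<bullet> (s *\<^sub>R \<xi>)) / \<epsilon> = (x /\<^sub>R \<tau>) \<bullet> \<xi>" using \<open>\<epsilon> > 0\<close> by (simp add: s_def field_simps)
    have 2: "- of_real t * A (s *\<^sub>R \<xi>) = - f s \<xi>" using A[of \<xi>] by simp
    have 3: "(- A (s *\<^sub>R \<xi>)) ^ J = (- f s \<xi>) ^ J / of_real (t ^ J)"
      unfolding A' minus_divide_left power_divide by simp
    show "indicator pi_box (s *\<^sub>R \<xi>) *\<^sub>R (?g (s *\<^sub>R \<xi>) * cis ((x \<bullet> (s *\<^sub>R \<xi>)) / \<epsilon>))
      = (indicator pi_box (s *\<^sub>R \<xi>) *\<^sub>R ((- f s \<xi>) ^ J * exp (- f s \<xi>) * cis ((x /\<^sub>R \<tau>) \<bullet> \<xi>))) / of_real (t ^ J)"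
      unfolding 1 2 3 by (simp add: scaleR_conv_of_real)
  qed
  finally have "wave ?g \<epsilon> x = s ^ CARD('n) *\<^sub>R ((LINT \<xi>|lborel. indicator pi_box (s *\<^sub>R \<xi>) *\<^sub>R
       ((- f s \<xi>) ^ J * exp (- f s \<xi>) * cis ((x /\<^sub>R \<tau>) \<bullet> \<xi>))) / of_real (t ^ J)) / of_real ((2 * pi * \<epsilon>) ^ CARD('n))"
    by (simp add: wave_def)
  also have "\<dots> = (LINT \<xi>|lborel. indicator pi_box (s *\<^sub>R \<xi>) *\<^sub>R
       ((- f s \<xi>) ^ J * exp (- f s \<xi>) * cis ((x /\<^sub>R \<tau>) \<bullet> \<xi>))) / of_real ((2 * pi) ^ CARD('n)) / of_real (\<tau> ^ CARD('n) * t ^ J)"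
    using \<open>\<epsilon> > 0\<close> by (simp add: s_def power_divide power_mult_distrib scaleR_conv_of_real)
  finally show ?thesis
    using u_tderivative(1)[OF \<open>x \<in> _\<close> \<open>t > 0\<close>, of J] by (simp only: w_def s_def)
qed

text \<open>The differentiability clause ensures that the iterated \<open>tderivative\<close> is a
  genuine J-th derivative.\<close>

lemma green_expansion:
  assumes green: "\<And>\<epsilon>. \<epsilon> > 0 \<Longrightarrow> first_Green l L a \<epsilon> (u \<epsilon>)" and "t0 > 0"
  shows "\<exists>R\<ge>0. \<forall>\<epsilon>>0. \<forall>x\<in>lattice \<epsilon>. \<forall>t\<ge>t0 * \<epsilon> ^ l.
        (\<forall>j<J. (tderivative ^^ j) (u \<epsilon> x) differentiable (at t)) \<and>
        cmod ((tderivative ^^ J) (u \<epsilon> x) t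
              - (\<Sum>k\<le>K. complex_of_real
                    (\<epsilon> ^ k / t powr (real (k + CARD('n)) / real l + real J))
                  * HJk l L a b J k (x /\<^sub>R t powr (1 / real l))))
          \<le> \<epsilon> ^ (K + 1) * R / t powr (real (K + CARD('n) + 1) / real l + real J)"
proof -
  \<comment> \<open>t \<ge> t0 \<epsilon>^l means s^l \<le> 1 / t0. The maximum with 1 bounds s
    itself without an l-th root, because s \<le> s^l once s > 1.\<close>
  define s0 where "s0 = max 1 (1 / t0)"
  have "s0 > 0" by (simp add: s0_def)
  then obtain R where R: "R \<ge> 0" and est: "\<And>s y. 0 < s \<Longrightarrow> s \<le> s0 \<Longrightarrow>
    cmod ((LINT \<xi>|lborel. indicator pi_box (s *\<^sub>R \<xi>) *\<^sub>R ((- f s \<xi>) ^ J * exp (- f s \<xi>) * cis (y \<bullet> \<xi>))) /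
        of_real ((2 * pi) ^ CARD('n))
      - (\<Sum>k\<le>K. of_real (s ^ k) * HJk l L a b J k y)) \<le> s ^ (K + 1) * R"
    by (rule integral_expansion[of s0 J K]) (rule that)
  show ?thesis
  proof (intro exI[of _ R] conjI R allI impI ballI)
    fix \<epsilon> t :: real and x :: "real^'n" and j
    assume \<epsilon>: "\<epsilon> > 0" and x: "x \<in> lattice \<epsilon>" and t: "t0 * \<epsilon> ^ l \<le> t"
    have t0: "t > 0" using t \<open>t0 > 0\<close> \<epsilon> by (meson less_le_trans mult_pos_pos zero_less_power)
    interpret green_solution l L a \<epsilon> "u \<epsilon>" by standard (use green \<epsilon> in auto)
    show "(tderivative ^^ j) (u \<epsilon> x) differentiable (at t)" by (rule u_tderivative(2)[OF x t0])
  next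
    fix \<epsilon> t :: real and x :: "real^'n"
    assume \<epsilon>: "\<epsilon> > 0" and x: "x \<in> lattice \<epsilon>" and t: "t0 * \<epsilon> ^ l \<le> t"
    have tpos: "t > 0" using t \<open>t0 > 0\<close> \<epsilon> by (meson less_le_trans mult_pos_pos zero_less_power)
    define \<tau> where "\<tau> = t powr (1 / real l)"
    have \<tau>: "\<tau> > 0" using tpos by (simp add: \<tau>_def)
    \<comment> \<open>All real exponents of t in the statement become natural powers of \<tau> and
      t, which then combine with those of s.\<close>
    have pw: "t powr (real n / real l + real J) = \<tau> ^ n * t ^ J" for n
    proof -
      have "t powr (real n / real l) = \<tau> powr real n" by (simp add: \<tau>_def powr_powr)
      then show ?thesis using \<tau> tpos by (simp add: powr_add powr_realpow)
    qed
    have \<tau>l: "\<tau> ^ l = t" using pw[of l] l_pos tpos by (simp add: powr_add powr_realpow)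
    define s where "s = \<epsilon> / \<tau>"
    have s: "s > 0" using \<tau> \<epsilon> by (simp add: s_def)
    have "s \<le> s0"
    proof (rule ccontr)
      assume "\<not> s \<le> s0"
      then have "s > 1" "s > 1 / t0" by (auto simp: s0_def)
      then have "s ^ 1 \<le> s ^ l" using l_pos by (intro power_increasing) auto
      then have "1 / t0 < s ^ l" using \<open>s > 1 / t0\<close> by simp
      also have "s ^ l = \<epsilon> ^ l / t" by (simp add: s_def power_divide \<tau>l)
      finally show False using t tpos \<open>t0 > 0\<close> by (simp add: field_simps)
    qed
    let ?I = "(LINT \<xi>|lborel. indicator pi_box (s *\<^sub>R \<xi>) *\<^sub>R
       ((- f s \<xi>) ^ J * exp (- f s \<xi>) * cis ((x /\<^sub>R \<tau>) \<bullet> \<xi>))) / of_real ((2 * pi) ^ CARD('n))"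
    let ?c = "\<tau> ^ CARD('n) * t ^ J"
    have c: "?c > 0" using \<tau> tpos by simp
    have "(tderivative ^^ J) (u \<epsilon> x) t = ?I / of_real ?c"
      using green_scaled[OF green[OF \<epsilon>] \<epsilon> x tpos, of J] by (simp only: s_def \<tau>_def)
    moreover have "(\<Sum>k\<le>K. complex_of_real (\<epsilon> ^ k / t powr (real (k + CARD('n)) / real l + real J))
          * HJk l L a b J k (x /\<^sub>R t powr (1 / real l)))
        = (\<Sum>k\<le>K. of_real (s ^ k) * HJk l L a b J k (x /\<^sub>R \<tau>)) / of_real ?c"
      unfolding sum_divide_distrib
    proof (rule sum.cong)
      fix k
      have "\<epsilon> ^ k / t powr (real (k + CARD('n)) / real l + real J) = s ^ k / ?c"
        unfolding pw by (simp add: s_def power_divide power_add)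
      then show "complex_of_real (\<epsilon> ^ k / t powr (real (k + CARD('n)) / real l + real J))
          * HJk l L a b J k (x /\<^sub>R t powr (1 / real l)) = of_real (s ^ k) * HJk l L a b J k (x /\<^sub>R \<tau>) / of_real ?c"
        by (simp add: \<tau>_def)
    qed simp
    ultimately have "cmod ((tderivative ^^ J) (u \<epsilon> x) t
              - (\<Sum>k\<le>K. complex_of_real
                    (\<epsilon> ^ k / t powr (real (k + CARD('n)) / real l + real J))
                  * HJk l L a b J k (x /\<^sub>R t powr (1 / real l))))
       = cmod (?I - (\<Sum>k\<le>K. of_real (s ^ k) * HJk l L a b J k (x /\<^sub>R \<tau>))) / ?c"
      using c by (simp only: diff_divide_distrib[symmetric] norm_divide norm_of_real abs_of_pos)
    also have "\<dots> \<le> s ^ (K + 1) * R / ?c"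
      using c by (intro divide_right_mono est[OF s \<open>s \<le> s0\<close>]) auto
    also have "\<dots> = \<epsilon> ^ (K + 1) * R / (\<tau> ^ (K + CARD('n) + 1) * t ^ J)"
      by (simp add: s_def power_divide power_add mult_ac)
    also have "\<dots> = \<epsilon> ^ (K + 1) * R / t powr (real (K + CARD('n) + 1) / real l + real J)"
      unfolding pw ..
    finally show "cmod ((tderivative ^^ J) (u \<epsilon> x) t
              - (\<Sum>k\<le>K. complex_of_real
                    (\<epsilon> ^ k / t powr (real (k + CARD('n)) / real l + real J))
                  * HJk l L a b J k (x /\<^sub>R t powr (1 / real l))))
          \<le> \<epsilon> ^ (K + 1) * R / t powr (real (K + CARD('n) + 1) / real l + real J)" .
  qed
qed

end

theorem theorem3p1:
  fixes l L M K J :: nat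
    and b :: "('n::finite \<Rightarrow> nat) \<Rightarrow> complex"
    and a :: "('n + 'n \<Rightarrow> nat) \<Rightarrow> complex"
    and u :: "real \<Rightarrow> real ^ 'n \<Rightarrow> real \<Rightarrow> complex"
    and t\<^sub>0 :: real
  assumes "even l" and "l > 0" and "l \<le> L" and "M > 0"
    and "strongly_elliptic l b"
    and "approximates M l L a b"
    and "\<And>\<theta>. (\<forall>i. \<bar>\<theta> $ i\<bar> \<le> pi) \<Longrightarrow> \<theta> \<noteq> 0 \<Longrightarrow> Re (discr_symbol l L a \<theta>) > 0"
    and "\<And>\<epsilon>. \<epsilon> > 0 \<Longrightarrow> first_Green l L a \<epsilon> (u \<epsilon>)"
    and "t\<^sub>0 > 0" and "K \<ge> M"
  shows
    "HJk l L a b J 0 = ((\<lambda>f y. - diff_op l b f y) ^^ J) (Hfun l b) \<and>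
     (\<forall>k\<in>{1..M-1}. HJk l L a b J k = (\<lambda>y. 0)) \<and>
     (\<forall>k\<in>{M..K}. \<exists>p :: 'n mpol. \<forall>y. HJk l L a b J k y =
        (\<Sum>\<alpha>\<in>Poly_Mapping.keys p.
           Poly_Mapping.lookup p \<alpha> * mi_op pderivative \<alpha> (Hfun l b) y)) \<and>
     (\<exists>R\<ge>0. \<forall>\<epsilon>>0. \<forall>x\<in>lattice \<epsilon>. \<forall>t\<ge>t\<^sub>0 * \<epsilon> ^ l.
        (\<forall>j<J. (tderivative ^^ j) (u \<epsilon> x) differentiable (at t)) \<and>
        cmod ((tderivative ^^ J) (u \<epsilon> x) t
              - (\<Sum>k\<le>K. complex_of_real
                    (\<epsilon> ^ k / t powr (real (k + CARD('n)) / real l + real J))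
                  * HJk l L a b J k (x /\<^sub>R t powr (1 / real l))))
          \<le> \<epsilon> ^ (K + 1) * R / t powr (real (K + CARD('n) + 1) / real l + real J))"
proof -
  interpret difference_scheme l L M b a
    by standard (use assms in auto)
  have "HJk l L a b J k = (\<lambda>y. 0)" if "k \<in> {1..M-1}" for k
    using that by (intro HJk_zero) auto
  then show ?thesis
    using HJk_0[of J] HJk_pderivatives[of J] green_expansion[of u t\<^sub>0 J K] assms(8,9) by blast
qed

end
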